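(* Let $\sigma>0$ and let $P$ be a Borel probability measure on $\mathbb{R}^d$ such that $\int\|x\|^s\,\mathrm{d}P(x) < \infty$ and $\dim^*_{\mathsf{SW}_1}(P) < s$. Then, for all $n > 1$, $$\mathbb{E}\left[\sqrt{n}\,\mathsf{W}_1^{\sigma}(P_n,P)\right] \leq C \sigma^{-\frac{s}{2}+1}(\log n)^{\frac 32},$$ where $C$ is a constant independent of $\sigma$ and $n$.
   Context: $\|\cdot\|$ is the Euclidean norm on $\mathbb{R}^d$. $\mathcal{N}_\sigma=\mathcal N(0,\sigma^2 \mathrm{I}_d)$, and $\ast$ denotes convolution. $\mathsf{W}_1(P,Q)=\inf_\pi\int\|x-y\|\,\mathrm{d}\pi(x,y)$ (infimum over couplings $\pi$ of $P$ and $Q$) is the 1-Wasserstein distance, and $\mathsf{W}_1^{\sigma}(P,Q):=\mathsf{W}_1(P\ast\mathcal{N}_\sigma,Q\ast\mathcal{N}_\sigma)$. $P_n$ is the empirical measure of $n$ i.i.d. samples from $P$. $N(\epsilon,S,\|\cdot\|)$ is the $\epsilon$-covering number of $S\subset\mathbb{R}^d$. The $(\epsilon,\tau)$-covering number of $P$ is $N_\epsilon(P,\tau):=\inf\{N(\epsilon,S,\|\cdot\|): S\subset\mathbb{R}^d\text{ Borel},\ P(S)\ge1-\tau\}$, and $d_\epsilon(P,\tau):=-\log N_\epsilon(P,\tau)/\log\epsilon$. The upper smooth 1-Wasserstein dimension is $\dim^*_{\mathsf{SW}_1}(P):=\inf\{s\in(2,\infty): \limsup_{\epsilon\to0}d_\epsilon(P,\epsilon^{s^2/(s-2)})\le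 s\}$.
   Formalization: The constant C is independent of n and of σ only for σ in (0, σ₀], with σ₀ > 0 arbitrary and C allowed to depend on it; uniformity over all σ > 0 fails, since s > 2 makes the right side tend to 0 as σ → ∞ while the left side does not for non-Dirac P. *)

theory Defs
  imports "HOL-Probability.Probability"
begin

definition gaussian :: "real \<Rightarrow> (real ^ 'd) measure" where
  "gaussian \<sigma> = density lborel (\<lambda>x. ennreal (\<Prod>i\<in>UNIV. normal_density 0 \<sigma> (x $ i)))"

definition couplings ::
  "(real ^ 'd) measure \<Rightarrow> (real ^ 'd) measure \<Rightarrow> ((real ^ 'd) \<times> (real ^ 'd)) measure set" where
  "couplings P Q = {\<pi>. sets \<pi> = sets (borel \<Otimes>\<^sub>M borel) \<and>
     distr \<pi> borel fst = P \<and> distr \<pi> borel snd = Q}"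

definition W1 :: "(real ^ 'd) measure \<Rightarrow> (real ^ 'd) measure \<Rightarrow> ennreal" where
  "W1 P Q = (INF \<pi>\<in>couplings P Q. \<integral>\<^sup>+ (x, y). ennreal (norm (x - y)) \<partial>\<pi>)"

definition smooth_W1 :: "real \<Rightarrow> (real ^ 'd) measure \<Rightarrow> (real ^ 'd) measure \<Rightarrow> ennreal" where
  "smooth_W1 \<sigma> P Q = W1 (P \<star> gaussian \<sigma>) (Q \<star> gaussian \<sigma>)"

text \<open>For \<open>n > 0\<close> this is the measure putting mass \<open>1 / n\<close> on each of \<open>x 0, \<dots>, x (n - 1)\<close>,
  counted with multiplicity.\<close>

definition empirical_measure :: "nat \<Rightarrow> (nat \<Rightarrow> real ^ 'd) \<Rightarrow> (real ^ 'd) measure" where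
  "empirical_measure n x = distr (uniform_count_measure {..<n}) borel x"

text \<open>Closed balls, whose centres need not belong to \<open>S\<close>. The value is \<open>\<infinity>\<close>
  if no finite cover exists.\<close>

definition covering_number :: "real \<Rightarrow> (real ^ 'd) set \<Rightarrow> enat" where
  "covering_number \<epsilon> S = (INF F \<in> {F. finite F \<and> S \<subseteq> (\<Union>c\<in>F. cball c \<epsilon>)}. enat (card F))"

definition measure_covering_number :: "(real ^ 'd) measure \<Rightarrow> real \<Rightarrow> real \<Rightarrow> enat" where
  "measure_covering_number P \<epsilon> \<tau> =
     (INF S \<in> {S. S \<in> sets borel \<and> measure P S \<ge> 1 - \<tau>}. covering_number \<epsilon> S)"

definition ln_enat :: "enat \<Rightarrow> ereal" where
  "ln_enat N = (case N of enat k \<Rightarrow> (if k = 0 then -\<infinity> else ereal (ln (real k))) | \<infinity> \<Rightarrow> \<infinity>)"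

definition covering_dim :: "(real ^ 'd) measure \<Rightarrow> real \<Rightarrow> real \<Rightarrow> ereal" where
  "covering_dim P \<epsilon> \<tau> = - ln_enat (measure_covering_number P \<epsilon> \<tau>) / ereal (ln \<epsilon>)"

text \<open>The infimum is taken in the extended reals, so it is \<open>\<infinity>\<close> if no \<open>s\<close> qualifies.\<close>

definition upper_SW1_dim :: "(real ^ 'd) measure \<Rightarrow> ereal" where
  "upper_SW1_dim P = (INF s \<in> {s::real. 2 < s \<and>
     Limsup (at_right 0) (\<lambda>\<epsilon>. covering_dim P \<epsilon> (\<epsilon> powr (s\<^sup>2 / (s - 2)))) \<le> ereal s}. ereal s)"

end

theory Submission
  imports Defs
begin

text \<open>Everything is done with an explicit coupling, without Kantorovich duality. Restrict both
  measures to dyadic cells of side about \<open>\<sigma>\<close>, smooth each piece, and keep the common part of the smoothed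
  pieces in place. The excess masses of the cells are matched by a coupling that is optimal on the whole
  dyadic tree at once, so scale \<open>2\<^sup>-\<^sup>k\<close> contributes \<open>2\<^sup>-\<^sup>k \<Sum>\<^sub>Q \<bar>P\<^sub>n(Q) - P(Q)\<bar>\<close>, with expectation at most
  \<open>2\<^sup>-\<^sup>k \<Sum>\<^sub>Q (P(Q) / n)\<^bsup>1/2\<^esup>\<close>. The dimension hypothesis gives sets \<open>S\<^sub>m\<close> covered by \<open>2\<^bsup>mt\<^esup>\<close> balls of radius
  \<open>2\<^sup>-\<^sup>m\<close>, where \<open>t < s\<close>, with \<open>P(- S\<^sub>m) \<le> 2\<^bsup>-m\<alpha>\<^esup>\<close> and \<open>\<alpha> (1 - 2 / s) > t\<close>. Together with the moment bound
  and the Cauchy-Schwarz inequality, sorting the cells by the first \<open>S\<^sub>m\<close> they meet yields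
  \<open>\<Sum>\<^sub>Q P(Q)\<^bsup>1/2\<^esup> = O(2\<^bsup>kt/2\<^esup>)\<close>. The sum over the scales down to \<open>\<sigma>\<close> is then \<open>O(\<sigma>\<^bsup>1-s/2\<^esup>)\<close>; the logarithm
  is only used through \<open>ln n \<ge> ln 2\<close>.\<close>

text \<open>The tree is not continued below scale \<open>\<sigma>\<close>: level k contributes 2^-k
  2^(k t / 2), which grows as soon as t > 2. Smoothing replaces all finer levels by one term: at a
  fixed point y the smoothed densities of a cell Q differ in mean by about (P(Q) / n)^(1/2) times a
  Gaussian, and gathering this difference at the cell costs a length of order
  \<open>\<sigma>\<close>. Stopping at 2^m ~ 1 / \<open>\<sigma>\<close> leaves
  \<open>\<sigma>\<close> 2^(m t / 2), whence the exponent 1 - s/2. Unbounded support causes two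
  obstacles. Unit cells are joined through the origin, so their sum carries a weight |z|; it is read
  off from the measure (1 + |x|)^2 P, as the square root makes the squared weight linear. A set of
  P-mass tau has mass O(tau^(1 - 2/s)) there, and s^2/(s - 2) is exactly the exponent alpha with
  alpha (1 - 2/s) = s: the mass missed by a cover then decays as fast as the number of balls grows.
  Infinitely many cells are avoided by sending the outside of a box of size about n^(1/2) to the
  cell of 0.\<close>

section \<open>Tree-like couplings of finite distributions\<close>

text \<open>Greedy matching: serve a pair \<open>(i, j)\<close> with \<open>p i > 0\<close>, \<open>q j > 0\<close> inside a smallest set \<open>Q\<^sub>0\<close> of the
  family containing such a pair. A set separating \<open>i\<close> from \<open>j\<close> lies strictly inside \<open>Q\<^sub>0\<close>, so it carries
  no \<open>p\<close>-mass or no \<open>q\<close>-mass, and its minimum stays \<open>0\<close>.\<close>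

lemma laminar_coupling:
  fixes p q :: "'a \<Rightarrow> real"
  assumes fin: "finite J"
    and p0: "\<And>j. j \<in> J \<Longrightarrow> 0 \<le> p j" and q0: "\<And>j. j \<in> J \<Longrightarrow> 0 \<le> q j"
    and eq: "sum p J = sum q J"
    and sub: "\<And>Q. Q \<in> L \<Longrightarrow> Q \<subseteq> J"
    and lam: "\<And>Q R. Q \<in> L \<Longrightarrow> R \<in> L \<Longrightarrow> Q \<subseteq> R \<or> R \<subseteq> Q \<or> Q \<inter> R = {}"
  shows "\<exists>\<gamma>. (\<forall>i\<in>J. \<forall>j\<in>J. 0 \<le> \<gamma> i j) \<and> (\<forall>i\<in>J. (\<Sum>j\<in>J. \<gamma> i j) = p i) \<and>
    (\<forall>j\<in>J. (\<Sum>i\<in>J. \<gamma> i j) = q j) \<and>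
    (\<forall>Q\<in>L. (\<Sum>i\<in>Q. \<Sum>j\<in>Q. \<gamma> i j) = min (sum p Q) (sum q Q))"
  using p0 q0 eq
\<comment> \<open>The induction counts points that still have unserved mass; moving
  \<open>min (p i) (q j)\<close> from i to j exhausts at least one of the two.\<close>
proof (induction "card {j\<in>J. p j \<noteq> 0} + card {j\<in>J. q j \<noteq> 0}" arbitrary: p q rule: less_induct)
  case less
  note p0 = less.prems(1) and q0 = less.prems(2) and eq = less.prems(3)
  have finQ: "finite Q" if "Q \<in> L" for Q
    using sub[OF that] fin finite_subset by blast
  show ?case
  proof (cases "\<forall>j\<in>J. p j = 0")
    case True
    have "sum q J = 0" using eq True by simp
    then have q: "\<forall>j\<in>J. q j = 0" using q0 fin by (simp add: sum_nonneg_eq_0_iff)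
    have "sum p Q = 0" "sum q Q = 0" if "Q \<in> L" for Q
      using sub[OF that] True q by (auto intro!: sum.neutral)
    then show ?thesis using True q by (intro exI[of _ "\<lambda>_ _. 0"]) auto
  next
    case False
    then obtain i0 where i0: "i0 \<in> J" "p i0 > 0" using p0 by (metis order_le_less)
    have "sum p J > 0" using i0 p0 fin by (meson sum_pos2)
    then have "sum q J \<noteq> 0" using eq by simp
    then have "\<exists>j\<in>J. q j \<noteq> 0" by (meson sum.neutral)
    then obtain j0 where j0: "j0 \<in> J" "q j0 > 0" using q0 by (metis order_le_less)
    \<comment> \<open>\<open>J\<close> is inserted because \<open>L\<close> need not contain it: it
      is always a candidate, so a smallest good set exists.\<close>
    define good where "good Q \<longleftrightarrow> Q \<in> insert J L \<and> (\<exists>i\<in>Q. \<exists>j\<in>Q. p i > 0 \<and> q j > 0)" for Q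
    have "good J" using i0 j0 by (auto simp: good_def)
    then obtain Q0 where Q0: "good Q0" and least: "\<And>Q. good Q \<Longrightarrow> card Q0 \<le> card Q"
      using ex_has_least_nat[of good J card] by blast
    then obtain i j where ij: "i \<in> Q0" "j \<in> Q0" "p i > 0" "q j > 0" by (auto simp: good_def)
    have Q0J: "Q0 \<subseteq> J" using Q0 sub by (auto simp: good_def)
    have finQ0: "finite Q0" using Q0J fin finite_subset by blast
    have iJ: "i \<in> J" and jJ: "j \<in> J" using ij Q0J by auto
    define m where "m = min (p i) (q j)"
    have m: "m > 0" "m \<le> p i" "m \<le> q j" using ij by (auto simp: m_def)
    define p' where "p' = (\<lambda>k. p k - (if k = i then m else 0))"
    define q' where "q' = (\<lambda>k. q k - (if k = j then m else 0))"
    have p'0: "\<And>k. k \<in> J \<Longrightarrow> 0 \<le> p' k" and q'0: "\<And>k. k \<in> J \<Longrightarrow> 0 \<le> q' k"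
      using p0 q0 m by (auto simp: p'_def q'_def)
    have sp: "sum p' Q = sum p Q - (if i \<in> Q then m else 0)"
      and sq: "sum q' Q = sum q Q - (if j \<in> Q then m else 0)" if "finite Q" for Q
      using that by (simp_all add: p'_def q'_def sum_subtractf)
    have eq': "sum p' J = sum q' J" using eq iJ jJ by (simp add: sp sq fin)
    have s1: "{k\<in>J. p' k \<noteq> 0} \<subseteq> {k\<in>J. p k \<noteq> 0}" "{k\<in>J. q' k \<noteq> 0} \<subseteq> {k\<in>J. q k \<noteq> 0}"
      using ij by (auto simp: p'_def q'_def split: if_splits)
    have "p' i = 0 \<or> q' j = 0" by (auto simp: p'_def q'_def m_def)
    moreover have "i \<in> {k\<in>J. p k \<noteq> 0}" "j \<in> {k\<in>J. q k \<noteq> 0}" using ij iJ jJ by auto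
    ultimately have "{k\<in>J. p' k \<noteq> 0} \<subset> {k\<in>J. p k \<noteq> 0} \<or> {k\<in>J. q' k \<noteq> 0} \<subset> {k\<in>J. q k \<noteq> 0}"
      using s1 by (metis (mono_tags, lifting) mem_Collect_eq psubsetI)
    then have "card {k\<in>J. p' k \<noteq> 0} < card {k\<in>J. p k \<noteq> 0} \<or> card {k\<in>J. q' k \<noteq> 0} < card {k\<in>J. q k \<noteq> 0}"
      proof (elim disjE)
      assume "{k\<in>J. p' k \<noteq> 0} \<subset> {k\<in>J. p k \<noteq> 0}"
      from psubset_card_mono[OF _ this] show ?thesis using fin by simp
    next
      assume "{k\<in>J. q' k \<noteq> 0} \<subset> {k\<in>J. q k \<noteq> 0}"
      from psubset_card_mono[OF _ this] show ?thesis using fin by simp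
    qed
    moreover have "card {k\<in>J. p' k \<noteq> 0} \<le> card {k\<in>J. p k \<noteq> 0}" "card {k\<in>J. q' k \<noteq> 0} \<le> card {k\<in>J. q k \<noteq> 0}"
      using s1 fin by (auto intro: card_mono)
    ultimately have "card {k\<in>J. p' k \<noteq> 0} + card {k\<in>J. q' k \<noteq> 0} < card {k\<in>J. p k \<noteq> 0} + card {k\<in>J. q k \<noteq> 0}"
      by linarith
    from less.hyps[OF this p'0 q'0 eq'] obtain \<gamma> where
      g0: "\<forall>i\<in>J. \<forall>j\<in>J. 0 \<le> \<gamma> i j" and g1: "\<forall>i\<in>J. (\<Sum>j\<in>J. \<gamma> i j) = p' i"
      and g2: "\<forall>j\<in>J. (\<Sum>i\<in>J. \<gamma> i j) = q' j"
      and g3: "\<forall>Q\<in>L. (\<Sum>i\<in>Q. \<Sum>j\<in>Q. \<gamma> i j) = min (sum p' Q) (sum q' Q)"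
      by blast
    define \<delta> where "\<delta> = (\<lambda>a b. \<gamma> a b + (if a = i then if b = j then m else 0 else 0))"
    have d1: "(\<Sum>b\<in>Q. \<delta> a b) = (\<Sum>b\<in>Q. \<gamma> a b) + (if a = i then if j \<in> Q then m else 0 else 0)"
      if "finite Q" for a Q
      using that by (auto simp: \<delta>_def sum.distrib)
    have d2: "(\<Sum>a\<in>Q. \<delta> a b) = (\<Sum>a\<in>Q. \<gamma> a b) + (if b = j then if i \<in> Q then m else 0 else 0)"
      if "finite Q" for b Q
      using that by (auto simp: \<delta>_def sum.distrib)
    have d3: "(\<Sum>a\<in>Q. \<Sum>b\<in>Q. \<delta> a b) = (\<Sum>a\<in>Q. \<Sum>b\<in>Q. \<gamma> a b) + (if i \<in> Q then if j \<in> Q then m else 0 else 0)"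
      if "finite Q" for Q
      using that by (simp add: d1 sum.distrib)
    have key: "(\<Sum>a\<in>Q. \<Sum>b\<in>Q. \<delta> a b) = min (sum p Q) (sum q Q)" if Q: "Q \<in> L" for Q
    proof -
      have QJ: "Q \<subseteq> J" using sub Q by blast
      have nn: "0 \<le> sum p' Q" "0 \<le> sum q' Q" "0 \<le> sum p Q" "0 \<le> sum q Q"
        using QJ p0 q0 p'0 q'0 by (auto intro!: sum_nonneg)
      have nest: "Q \<subset> Q0" if "i \<in> Q \<or> j \<in> Q" "\<not> (i \<in> Q \<and> j \<in> Q)"
      proof -
        have "Q \<subseteq> Q0 \<or> Q0 \<subseteq> Q \<or> Q \<inter> Q0 = {}"
          using Q0 lam[OF Q, of Q0] QJ by (auto simp: good_def)
        then show ?thesis using that ij by blast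
      qed
      have small: "\<not> good Q" if "i \<in> Q \<or> j \<in> Q" "\<not> (i \<in> Q \<and> j \<in> Q)"
        using nest[OF that] least[of Q] psubset_card_mono[OF finQ0, of Q] by linarith
      consider "i \<in> Q" "j \<in> Q" | "i \<notin> Q" "j \<notin> Q" | "i \<in> Q" "j \<notin> Q" | "i \<notin> Q" "j \<in> Q" by blast
      then show ?thesis
      proof cases
        case 1
        then show ?thesis using g3 Q by (simp add: d3 sp sq finQ)
      next
        case 2
        then show ?thesis using g3 Q by (simp add: d3 sp sq finQ)
      next
        case 3
        have "\<not> good Q" using small 3 by blast
        then have "\<not> q k > 0" if "k \<in> Q" for k
          using 3 ij that Q unfolding good_def by blast
        then have "q k = 0" if "k \<in> Q" for k
          using that q0[of k] QJ by (metis in_mono order_le_less)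
        then have "sum q Q = 0" by simp
        then show ?thesis using 3 g3 Q nn by (simp add: d3 sp sq finQ)
      next
        case 4
        have "\<not> good Q" using small 4 by blast
        then have "\<not> p k > 0" if "k \<in> Q" for k
          using 4 ij that Q unfolding good_def by blast
        then have "p k = 0" if "k \<in> Q" for k
          using that p0[of k] QJ by (metis in_mono order_le_less)
        then have "sum p Q = 0" by simp
        then show ?thesis using 4 g3 Q nn by (simp add: d3 sp sq finQ)
      qed
    qed
    show ?thesis
    proof (intro exI[of _ \<delta>] conjI ballI)
      show "0 \<le> \<delta> a b" if "a \<in> J" "b \<in> J" for a b using g0 that m by (simp add: \<delta>_def)
      show "(\<Sum>b\<in>J. \<delta> a b) = p a" if "a \<in> J" for a using g1 that jJ fin by (simp add: d1 p'_def)
      show "(\<Sum>a\<in>J. \<delta> a b) = q b" if "b \<in> J" for b using g2 that iJ fin by (simp add: d2 q'_def)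
    qed (use key in auto)
  qed
qed

text \<open>Since the mass kept inside a cell is the minimum of its two masses, the mass leaving is
  \<open>sum p - min\<close> and the mass entering is \<open>sum q - min\<close>; together they give
  the absolute difference. The weight \<open>w\<close> is charged once at each end of a move. It
  will be the norm for unit cells and a constant at finer levels.\<close>

lemma coupling_cost_across_cells:
  fixes \<gamma> :: "'a \<Rightarrow> 'a \<Rightarrow> real" and z :: "'a \<Rightarrow> 'b" and w :: "'b \<Rightarrow> real"
  assumes fin: "finite J"
    and m1: "\<And>i. i \<in> J \<Longrightarrow> (\<Sum>j\<in>J. \<gamma> i j) = p i" and m2: "\<And>j. j \<in> J \<Longrightarrow> (\<Sum>i\<in>J. \<gamma> i j) = q j"
    and cell: "\<And>a. a \<in> z ` J \<Longrightarrow> (\<Sum>i\<in>{i\<in>J. z i = a}. \<Sum>j\<in>{i\<in>J. z i = a}. \<gamma> i j)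
       = min (sum p {i\<in>J. z i = a}) (sum q {i\<in>J. z i = a})"
  shows "(\<Sum>i\<in>J. \<Sum>j\<in>J. if z i \<noteq> z j then \<gamma> i j * (w (z i) + w (z j)) else 0)
    = (\<Sum>a\<in>z ` J. w a * \<bar>sum p {i\<in>J. z i = a} - sum q {i\<in>J. z i = a}\<bar>)"
proof -
  let ?c = "\<lambda>a. {i\<in>J. z i = a}"
  have out: "(\<Sum>j\<in>J. if z j \<noteq> a then f j else 0) = (\<Sum>j\<in>J. f j) - (\<Sum>j\<in>?c a. f j)" for f :: "'a \<Rightarrow> real" and a
  proof -
    have "(\<Sum>j\<in>?c a. f j) = (\<Sum>j\<in>J. if z j = a then f j else 0)"
      using fin by (simp add: sum.inter_filter)
    then show ?thesis by (auto simp: sum_subtractf[symmetric] intro!: sum.cong)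
  qed
  have 1: "(\<Sum>i\<in>J. \<Sum>j\<in>J. if z i \<noteq> z j then \<gamma> i j * w (z i) else 0)
     = (\<Sum>a\<in>z ` J. w a * (sum p (?c a) - min (sum p (?c a)) (sum q (?c a))))"
  proof -
    have "(\<Sum>i\<in>J. \<Sum>j\<in>J. if z i \<noteq> z j then \<gamma> i j * w (z i) else 0)
      = (\<Sum>a\<in>z ` J. \<Sum>i\<in>?c a. \<Sum>j\<in>J. if z i \<noteq> z j then \<gamma> i j * w (z i) else 0)"
      using fin by (intro sum.image_gen)
    also have "\<dots> = (\<Sum>a\<in>z ` J. w a * (\<Sum>i\<in>?c a. (\<Sum>j\<in>J. if z j \<noteq> a then \<gamma> i j else 0)))"
      unfolding sum_distrib_left by (intro sum.cong) auto
    also have "\<dots> = (\<Sum>a\<in>z ` J. w a * (sum p (?c a) - min (sum p (?c a)) (sum q (?c a))))"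
      using m1 cell by (auto simp: out sum_subtractf intro!: sum.cong)
    finally show ?thesis .
  qed
  have 2: "(\<Sum>i\<in>J. \<Sum>j\<in>J. if z i \<noteq> z j then \<gamma> i j * w (z j) else 0)
     = (\<Sum>a\<in>z ` J. w a * (sum q (?c a) - min (sum p (?c a)) (sum q (?c a))))"
  proof -
    have "(\<Sum>i\<in>J. \<Sum>j\<in>J. if z i \<noteq> z j then \<gamma> i j * w (z j) else 0)
      = (\<Sum>j\<in>J. \<Sum>i\<in>J. if z i \<noteq> z j then \<gamma> i j * w (z j) else 0)" by (rule sum.swap)
    also have "\<dots> = (\<Sum>a\<in>z ` J. \<Sum>j\<in>?c a. \<Sum>i\<in>J. if z i \<noteq> z j then \<gamma> i j * w (z j) else 0)"
      using fin by (intro sum.image_gen)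
    also have "\<dots> = (\<Sum>a\<in>z ` J. w a * (\<Sum>j\<in>?c a. (\<Sum>i\<in>J. if z i \<noteq> a then \<gamma> i j else 0)))"
      unfolding sum_distrib_left by (intro sum.cong) auto
    also have "\<dots> = (\<Sum>a\<in>z ` J. w a * (sum q (?c a) - (\<Sum>j\<in>?c a. \<Sum>i\<in>?c a. \<gamma> i j)))"
      using m2 by (auto simp: out sum_subtractf intro!: sum.cong)
    also have "\<dots> = (\<Sum>a\<in>z ` J. w a * (sum q (?c a) - min (sum p (?c a)) (sum q (?c a))))"
      by (intro sum.cong refl, subst sum.swap, use cell in auto)
    finally show ?thesis .
  qed
  have "(\<Sum>i\<in>J. \<Sum>j\<in>J. if z i \<noteq> z j then \<gamma> i j * (w (z i) + w (z j)) else 0)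
    = (\<Sum>i\<in>J. \<Sum>j\<in>J. if z i \<noteq> z j then \<gamma> i j * w (z i) else 0)
    + (\<Sum>i\<in>J. \<Sum>j\<in>J. if z i \<noteq> z j then \<gamma> i j * w (z j) else 0)"
    unfolding sum.distrib[symmetric] by (intro sum.cong) (auto simp: algebra_simps)
  also have "\<dots> = (\<Sum>a\<in>z ` J. w a * \<bar>sum p (?c a) - sum q (?c a)\<bar>)"
    unfolding 1 2 sum.distrib[symmetric] by (intro sum.cong) (auto simp: min_def algebra_simps)
  finally show ?thesis .
qed

section \<open>Transport between mixtures\<close>

text \<open>Meant for a coupling with one part on the diagonal and one part with a Lebesgue density
  on the product; these are mutually singular, so they are added as measures and not as
  densities.\<close>

lemma exists_sum_measure:
  assumes sets: "sets N = sets M"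
  shows "\<exists>K. sets K = sets M \<and> (\<forall>f\<in>borel_measurable M. nn_integral K f = nn_integral M f + nn_integral N f)"
proof -
  define K where "K = measure_of (space M) (sets M) (\<lambda>A. emeasure M A + emeasure N A)"
  have space: "space N = space M" using sets by (rule sets_eq_imp_space_eq)
  have sK: "sets K = sets M" by (simp add: K_def)
  have spK: "space K = space M" using sK by (rule sets_eq_imp_space_eq)
  have em: "emeasure K A = emeasure M A + emeasure N A" if A: "A \<in> sets M" for A
    unfolding K_def
  proof (rule emeasure_measure_of_sigma)
    show "sigma_algebra (space M) (sets M)" by (rule sets.sigma_algebra_axioms)
    show "positive (sets M) (\<lambda>A. emeasure M A + emeasure N A)" by (simp add: positive_def)
    show "countably_additive (sets M) (\<lambda>A. emeasure M A + emeasure N A)"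
    proof (rule countably_additiveI)
      fix A :: "nat \<Rightarrow> 'a set"
      assume *: "range A \<subseteq> sets M" "disjoint_family A"
      have "(\<Sum>i. emeasure M (A i) + emeasure N (A i)) = (\<Sum>i. emeasure M (A i)) + (\<Sum>i. emeasure N (A i))"
        by (rule suminf_add[symmetric]) (rule summableI)+
      then show "(\<Sum>i. emeasure M (A i) + emeasure N (A i)) = emeasure M (\<Union>i. A i) + emeasure N (\<Union>i. A i)"
        using * sets by (simp add: suminf_emeasure)
    qed
  qed fact
  have "nn_integral K f = nn_integral M f + nn_integral N f" if "f \<in> borel_measurable M" for f
    using that
  proof (induction rule: borel_measurable_induct)
    case (cong f g)
    then show ?case
      using spK space by (metis nn_integral_cong)
  next
    case (set A)
    then show ?case using em sK sets by simp
  next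
    case (mult u c)
    then show ?case using sK sets
      by (simp add: nn_integral_cmult distrib_left cong: measurable_cong_sets)
  next
    case (add u v)
    then show ?case using sK sets
      by (simp add: nn_integral_add ac_simps cong: measurable_cong_sets)
  next
    case (seq U)
    have [measurable]: "U i \<in> borel_measurable N" "U i \<in> borel_measurable K" for i
      using seq(1) sK sets by (simp_all cong: measurable_cong_sets)
    have "incseq (\<lambda>i. nn_integral M (U i))" "incseq (\<lambda>i. nn_integral N (U i))"
      using seq(3) by (auto intro!: monoI nn_integral_mono dest: incseqD simp: le_fun_def mono_def)
    then show ?case using seq
      by (simp add: nn_integral_monotone_convergence_SUP ennreal_SUP_add SUP_apply[abs_def] image_comp)
  qed
  then show ?thesis using sK by blast
qed

text \<open>The coupling leaves min(u_j, v_j) in place and moves the excess of u_i to the excess of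
  v_j by a product measure of total mass \<open>\<gamma> i j\<close>. A moved point is charged along
  the route y, \<open>x i\<close>, \<open>x j\<close>, z. The middle leg gives the discrete cost of
  \<open>\<gamma>\<close>; the outer legs sum to the first moment of |u_j - v_j| around
  \<open>x j\<close>.\<close>

lemma W1_mixture_le:
  fixes u v :: "'a \<Rightarrow> real ^ 'd \<Rightarrow> real" and x :: "'a \<Rightarrow> real ^ 'd" and \<gamma> :: "'a \<Rightarrow> 'a \<Rightarrow> real"
  assumes fin: "finite J"
    and um[measurable]: "\<And>j. u j \<in> borel_measurable borel" and vm[measurable]: "\<And>j. v j \<in> borel_measurable borel"
    and u0: "\<And>j y. 0 \<le> u j y" and v0: "\<And>j y. 0 \<le> v j y"
    and p: "\<And>j. j \<in> J \<Longrightarrow> (\<integral>\<^sup>+y. ennreal (max 0 (u j y - v j y)) \<partial>lborel) = ennreal (p j)"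
    and q: "\<And>j. j \<in> J \<Longrightarrow> (\<integral>\<^sup>+y. ennreal (max 0 (v j y - u j y)) \<partial>lborel) = ennreal (q j)"
    and p0: "\<And>j. j \<in> J \<Longrightarrow> 0 \<le> p j" and q0: "\<And>j. j \<in> J \<Longrightarrow> 0 \<le> q j"
    and g0: "\<And>i j. i \<in> J \<Longrightarrow> j \<in> J \<Longrightarrow> 0 \<le> \<gamma> i j"
    and g1: "\<And>i. i \<in> J \<Longrightarrow> (\<Sum>j\<in>J. \<gamma> i j) = p i" and g2: "\<And>j. j \<in> J \<Longrightarrow> (\<Sum>i\<in>J. \<gamma> i j) = q j"
  shows "W1 (density lborel (\<lambda>y. \<Sum>j\<in>J. ennreal (u j y))) (density lborel (\<lambda>y. \<Sum>j\<in>J. ennreal (v j y)))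
    \<le> ennreal (\<Sum>i\<in>J. \<Sum>j\<in>J. \<gamma> i j * norm (x i - x j))
      + (\<Sum>j\<in>J. \<integral>\<^sup>+y. ennreal (norm (y - x j) * \<bar>u j y - v j y\<bar>) \<partial>lborel)"
proof -
  let ?B = "borel \<Otimes>\<^sub>M borel :: ((real ^ 'd) \<times> (real ^ 'd)) measure"
  let ?L = "lborel :: (real ^ 'd) measure"
  define a where "a = (\<lambda>j y. ennreal (max 0 (u j y - v j y)))"
  define b where "b = (\<lambda>j y. ennreal (max 0 (v j y - u j y)))"
  define m where "m = (\<lambda>y. \<Sum>j\<in>J. ennreal (min (u j y) (v j y)))"
  \<comment> \<open>Normalises the product of the two excesses, which has mass
    \<open>p i * q j\<close>. Division by zero yields 0, the right value, since
    \<open>\<gamma> i j\<close> is at most \<open>p i\<close> and at most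
    \<open>q j\<close>.\<close>
  define w where "w = (\<lambda>i j. \<gamma> i j / (p i * q j))"
  have [measurable]: "a j \<in> borel_measurable borel" "b j \<in> borel_measurable borel" "m \<in> borel_measurable borel" for j
    unfolding a_def b_def m_def by measurable
  have ia: "(\<integral>\<^sup>+y. a j y \<partial>?L) = ennreal (p j)" and ib: "(\<integral>\<^sup>+y. b j y \<partial>?L) = ennreal (q j)" if "j \<in> J" for j
    using p q that by (simp_all add: a_def b_def)
  have gp: "\<gamma> i j \<le> p i" and gq: "\<gamma> i j \<le> q j" if "i \<in> J" "j \<in> J" for i j
    using member_le_sum[of j J "\<gamma> i"] member_le_sum[of i J "\<lambda>i. \<gamma> i j"] g0 g1 g2 that fin by auto
  have w0: "0 \<le> w i j" if "i \<in> J" "j \<in> J" for i j using that g0 p0 q0 by (simp add: w_def)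
  have wpq: "w i j * (p i * q j) = \<gamma> i j" if "i \<in> J" "j \<in> J" for i j
    using gp[OF that] gq[OF that] g0[OF that] by (auto simp: w_def)
  have wq: "(\<Sum>j\<in>J. w i j * q j) = 1" if "i \<in> J" "p i \<noteq> 0" for i
  proof -
    have "w i j * q j = \<gamma> i j / p i" if "j \<in> J" for j
      using wpq[OF \<open>i \<in> J\<close> that] \<open>p i \<noteq> 0\<close> by (metis mult.commute mult.assoc nonzero_eq_divide_eq)
    then show ?thesis using g1 that by (simp add: sum_divide_distrib[symmetric])
  qed
  have wp: "(\<Sum>i\<in>J. w i j * p i) = 1" if "j \<in> J" "q j \<noteq> 0" for j
  proof -
    have "w i j * p i = \<gamma> i j / q j" if "i \<in> J" for i
      using wpq[OF that \<open>j \<in> J\<close>] \<open>q j \<noteq> 0\<close> by (metis mult.assoc nonzero_eq_divide_eq)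
    then show ?thesis using g2 that by (simp add: sum_divide_distrib[symmetric])
  qed
  \<comment> \<open>Integrating out the second coordinate returns the first excess. If
    \<open>p i = 0\<close> the weights vanish too, so the identity survives only because
    \<open>X\<close> is then 0, which \<open>za\<close> supplies.\<close>
  have c1: "(\<Sum>j\<in>J. ennreal (w i j) * (X * ennreal (q j))) = X" if "i \<in> J" "p i = 0 \<Longrightarrow> X = 0" for i X
  proof (cases "p i = 0")
    case False
    have "(\<Sum>j\<in>J. ennreal (w i j) * (X * ennreal (q j))) = (\<Sum>j\<in>J. ennreal (w i j * q j)) * X"
      unfolding sum_distrib_right using w0 q0 that(1) by (intro sum.cong refl) (simp add: ennreal_mult ac_simps)
    also have "(\<Sum>j\<in>J. ennreal (w i j * q j)) = 1"
      using w0 q0 that(1) wq[OF that(1) False] by (subst sum_ennreal) auto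
    finally show ?thesis by simp
  qed (use that in simp)
  have c2: "(\<Sum>i\<in>J. ennreal (w i j) * (ennreal (p i) * X)) = X" if "j \<in> J" "q j = 0 \<Longrightarrow> X = 0" for j X
  proof (cases "q j = 0")
    case False
    have "(\<Sum>i\<in>J. ennreal (w i j) * (ennreal (p i) * X)) = (\<Sum>i\<in>J. ennreal (w i j * p i)) * X"
      unfolding sum_distrib_right using w0 p0 that(1) by (intro sum.cong refl) (simp add: ennreal_mult ac_simps)
    also have "(\<Sum>i\<in>J. ennreal (w i j * p i)) = 1"
      using w0 p0 that(1) wp[OF that(1) False] by (subst sum_ennreal) auto
    finally show ?thesis by simp
  qed (use that in simp)
  have za: "(\<integral>\<^sup>+y. f y * a j y \<partial>?L) = 0" if "j \<in> J" "p j = 0" "f \<in> borel_measurable borel" for f j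
  proof -
    have "AE y in ?L. a j y = 0" using ia[OF that(1)] that(2) nn_integral_0_iff_AE[of "a j" ?L] by simp
    then show ?thesis using that(3) by (subst nn_integral_0_iff_AE) auto
  qed
  have zb: "(\<integral>\<^sup>+y. f y * b j y \<partial>?L) = 0" if "j \<in> J" "q j = 0" "f \<in> borel_measurable borel" for f j
  proof -
    have "AE y in ?L. b j y = 0" using ib[OF that(1)] that(2) nn_integral_0_iff_AE[of "b j" ?L] by simp
    then show ?thesis using that(3) by (subst nn_integral_0_iff_AE) auto
  qed
  \<comment> \<open>\<open>D\<close> is the stationary part on the diagonal, \<open>R\<close> the
    moved part; their sum \<open>K\<close> is the coupling.\<close>
  define D where "D = distr (density ?L m) ?B (\<lambda>y. (y, y))"
  define R where "R = density (?L \<Otimes>\<^sub>M ?L) (\<lambda>(y, z). \<Sum>i\<in>J. \<Sum>j\<in>J. ennreal (w i j) * (a i y * b j z))"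
  have sD: "sets D = sets ?B" by (simp add: D_def)
  have sLL: "sets (?L \<Otimes>\<^sub>M ?L) = sets ?B" by (intro sets_pair_measure_cong) auto
  have sR: "sets R = sets D" by (simp add: R_def sLL sD)
  have iD: "(\<integral>\<^sup>+z. f z \<partial>D) = (\<integral>\<^sup>+y. m y * f (y, y) \<partial>?L)" if [measurable]: "f \<in> borel_measurable ?B" for f
    unfolding D_def by (subst nn_integral_distr) (auto simp: nn_integral_density)
  have iR: "(\<integral>\<^sup>+z. f z \<partial>R) = (\<Sum>i\<in>J. \<Sum>j\<in>J. ennreal (w i j) * (\<integral>\<^sup>+y. \<integral>\<^sup>+z. f (y, z) * (a i y * b j z) \<partial>?L \<partial>?L))"
    if [measurable]: "f \<in> borel_measurable ?B" for f
  proof -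
    have "(\<integral>\<^sup>+z. f z \<partial>R) = (\<integral>\<^sup>+z. (\<Sum>i\<in>J. \<Sum>j\<in>J. ennreal (w i j) * (f z * (a i (fst z) * b j (snd z)))) \<partial>(?L \<Otimes>\<^sub>M ?L))"
      unfolding R_def by (subst nn_integral_density)
        (auto intro!: nn_integral_cong simp: sum_distrib_left sum_distrib_right ac_simps split_beta)
    also have "\<dots> = (\<Sum>i\<in>J. \<Sum>j\<in>J. ennreal (w i j) * (\<integral>\<^sup>+z. f z * (a i (fst z) * b j (snd z)) \<partial>(?L \<Otimes>\<^sub>M ?L)))"
      by (simp add: nn_integral_sum nn_integral_cmult)
    also have "\<dots> = (\<Sum>i\<in>J. \<Sum>j\<in>J. ennreal (w i j) * (\<integral>\<^sup>+y. \<integral>\<^sup>+z. f (y, z) * (a i y * b j z) \<partial>?L \<partial>?L))"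
      by (subst lborel.nn_integral_fst[symmetric]) auto
    finally show ?thesis .
  qed
  obtain K where sK: "sets K = sets D"
    and iK: "\<And>f. f \<in> borel_measurable D \<Longrightarrow> nn_integral K f = nn_integral D f + nn_integral R f"
    using exists_sum_measure[OF sR] by blast
  have mD: "f \<in> borel_measurable D \<longleftrightarrow> f \<in> borel_measurable ?B" for f :: "_ \<Rightarrow> ennreal"
    using sD by (intro arg_cong2[where f="(\<in>)"] measurable_cong_sets) auto
  have eK: "(\<integral>\<^sup>+z. f z \<partial>K) = (\<integral>\<^sup>+y. m y * f (y, y) \<partial>?L)
     + (\<Sum>i\<in>J. \<Sum>j\<in>J. ennreal (w i j) * (\<integral>\<^sup>+y. \<integral>\<^sup>+z. f (y, z) * (a i y * b j z) \<partial>?L \<partial>?L))"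
    if f: "f \<in> borel_measurable ?B" for f
    using iK[of f] iD[OF f] iR[OF f] mD f by simp
  have spK: "space K = UNIV" using sets_eq_imp_space_eq[OF sK] sets_eq_imp_space_eq[OF sD] by (simp add: space_pair_measure)
  have [measurable_cong]: "sets K = sets ?B" using sK sD by simp
  have split_u: "ennreal (u j y) = ennreal (min (u j y) (v j y)) + a j y"
    and split_v: "ennreal (v j y) = ennreal (min (u j y) (v j y)) + b j y" for j y
    using u0[of j y] v0[of j y] unfolding a_def b_def
    by (auto simp: ennreal_plus[symmetric] min_def max_def simp del: ennreal_plus)
  have marg1: "distr K borel fst = density lborel (\<lambda>y. \<Sum>j\<in>J. ennreal (u j y))"
  proof (rule measure_eqI)
    fix A assume "A \<in> sets (distr K borel fst)"
    then have A[measurable]: "A \<in> sets borel" by simp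
    have "emeasure (distr K borel fst) A = (\<integral>\<^sup>+z. indicator A (fst z) \<partial>K)"
      by (subst nn_integral_indicator[symmetric], simp, subst nn_integral_distr) auto
    also have "\<dots> = (\<integral>\<^sup>+y. m y * indicator A y \<partial>?L)
       + (\<Sum>i\<in>J. \<Sum>j\<in>J. ennreal (w i j) * (\<integral>\<^sup>+y. \<integral>\<^sup>+z. indicator A y * (a i y * b j z) \<partial>?L \<partial>?L))"
      by (subst eK) auto
    also have "(\<Sum>i\<in>J. \<Sum>j\<in>J. ennreal (w i j) * (\<integral>\<^sup>+y. \<integral>\<^sup>+z. indicator A y * (a i y * b j z) \<partial>?L \<partial>?L))
      = (\<Sum>i\<in>J. \<Sum>j\<in>J. ennreal (w i j) * ((\<integral>\<^sup>+y. indicator A y * a i y \<partial>?L) * ennreal (q j)))"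
      by (intro sum.cong refl) (simp add: nn_integral_cmult nn_integral_multc ib mult.assoc[symmetric])
    also have "\<dots> = (\<Sum>i\<in>J. \<integral>\<^sup>+y. indicator A y * a i y \<partial>?L)"
      by (intro sum.cong refl c1 za) auto
    also have "(\<integral>\<^sup>+y. m y * indicator A y \<partial>?L) + \<dots> = (\<integral>\<^sup>+y. m y * indicator A y + (\<Sum>i\<in>J. indicator A y * a i y) \<partial>?L)"
      by (simp add: nn_integral_add nn_integral_sum)
    also have "\<dots> = (\<integral>\<^sup>+y. (\<Sum>j\<in>J. ennreal (u j y)) * indicator A y \<partial>?L)"
      unfolding split_u m_def by (intro nn_integral_cong) (simp add: sum.distrib split: split_indicator)
    also have "\<dots> = emeasure (density lborel (\<lambda>y. \<Sum>j\<in>J. ennreal (u j y))) A"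
      by (subst emeasure_density) auto
    finally show "emeasure (distr K borel fst) A = emeasure (density lborel (\<lambda>y. \<Sum>j\<in>J. ennreal (u j y))) A" .
  qed simp
  have marg2: "distr K borel snd = density lborel (\<lambda>y. \<Sum>j\<in>J. ennreal (v j y))"
  proof (rule measure_eqI)
    fix A assume "A \<in> sets (distr K borel snd)"
    then have A[measurable]: "A \<in> sets borel" by simp
    have "emeasure (distr K borel snd) A = (\<integral>\<^sup>+z. indicator A (snd z) \<partial>K)"
      by (subst nn_integral_indicator[symmetric], simp, subst nn_integral_distr) auto
    also have "\<dots> = (\<integral>\<^sup>+y. m y * indicator A y \<partial>?L)
       + (\<Sum>i\<in>J. \<Sum>j\<in>J. ennreal (w i j) * (\<integral>\<^sup>+y. \<integral>\<^sup>+z. indicator A z * (a i y * b j z) \<partial>?L \<partial>?L))"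
      by (subst eK) auto
    also have "(\<Sum>i\<in>J. \<Sum>j\<in>J. ennreal (w i j) * (\<integral>\<^sup>+y. \<integral>\<^sup>+z. indicator A z * (a i y * b j z) \<partial>?L \<partial>?L))
      = (\<Sum>i\<in>J. \<Sum>j\<in>J. ennreal (w i j) * (ennreal (p i) * (\<integral>\<^sup>+y. indicator A y * b j y \<partial>?L)))"
    proof (intro sum.cong refl)
      fix i j assume "i \<in> J" "j \<in> J"
      have "(\<integral>\<^sup>+y. \<integral>\<^sup>+z. indicator A z * (a i y * b j z) \<partial>?L \<partial>?L)
        = (\<integral>\<^sup>+y. a i y * (\<integral>\<^sup>+z. indicator A z * b j z \<partial>?L) \<partial>?L)"
        by (intro nn_integral_cong, subst nn_integral_cmult[symmetric])
           (auto intro!: nn_integral_cong simp: mult.left_commute)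
      also have "\<dots> = ennreal (p i) * (\<integral>\<^sup>+y. indicator A y * b j y \<partial>?L)"
        using \<open>i \<in> J\<close> by (simp add: nn_integral_multc ia)
      finally show "ennreal (w i j) * (\<integral>\<^sup>+y. \<integral>\<^sup>+z. indicator A z * (a i y * b j z) \<partial>?L \<partial>?L)
        = ennreal (w i j) * (ennreal (p i) * (\<integral>\<^sup>+y. indicator A y * b j y \<partial>?L))" by simp
    qed
    also have "\<dots> = (\<Sum>j\<in>J. \<Sum>i\<in>J. ennreal (w i j) * (ennreal (p i) * (\<integral>\<^sup>+y. indicator A y * b j y \<partial>?L)))"
      by (rule sum.swap)
    also have "\<dots> = (\<Sum>i\<in>J. \<integral>\<^sup>+y. indicator A y * b i y \<partial>?L)"
      by (intro sum.cong refl c2 zb) auto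
    also have "(\<integral>\<^sup>+y. m y * indicator A y \<partial>?L) + \<dots> = (\<integral>\<^sup>+y. m y * indicator A y + (\<Sum>i\<in>J. indicator A y * b i y) \<partial>?L)"
      by (simp add: nn_integral_add nn_integral_sum)
    also have "\<dots> = (\<integral>\<^sup>+y. (\<Sum>j\<in>J. ennreal (v j y)) * indicator A y \<partial>?L)"
      unfolding split_v m_def by (intro nn_integral_cong) (simp add: sum.distrib split: split_indicator)
    also have "\<dots> = emeasure (density lborel (\<lambda>y. \<Sum>j\<in>J. ennreal (v j y))) A"
      by (subst emeasure_density) auto
    finally show "emeasure (distr K borel snd) A = emeasure (density lborel (\<lambda>y. \<Sum>j\<in>J. ennreal (v j y))) A" .
  qed simp
  define A where "A = (\<lambda>i. \<integral>\<^sup>+y. ennreal (norm (y - x i)) * a i y \<partial>?L)"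
  define B where "B = (\<lambda>j. \<integral>\<^sup>+y. ennreal (norm (y - x j)) * b j y \<partial>?L)"
  have tri: "(\<integral>\<^sup>+y. \<integral>\<^sup>+z. ennreal (norm (y - z)) * (a i y * b j z) \<partial>?L \<partial>?L)
     \<le> A i * ennreal (q j) + ennreal (norm (x i - x j)) * (ennreal (p i) * ennreal (q j)) + ennreal (p i) * B j"
    if "i \<in> J" "j \<in> J" for i j
  proof -
    have "ennreal (norm (y - z)) \<le> ennreal (norm (y - x i)) + ennreal (norm (x i - x j)) + ennreal (norm (z - x j))" for y z
    proof -
      have "norm (y - z) \<le> norm (y - x i) + norm (x i - x j) + norm (z - x j)"
        by norm
      then show ?thesis by (simp add: ennreal_plus[symmetric] del: ennreal_plus)
    qed
    then have "(\<integral>\<^sup>+y. \<integral>\<^sup>+z. ennreal (norm (y - z)) * (a i y * b j z) \<partial>?L \<partial>?L)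
      \<le> (\<integral>\<^sup>+y. \<integral>\<^sup>+z. (ennreal (norm (y - x i)) + ennreal (norm (x i - x j)) + ennreal (norm (z - x j))) * (a i y * b j z) \<partial>?L \<partial>?L)"
      by (intro nn_integral_mono mult_right_mono) auto
    also have "\<dots> = (\<integral>\<^sup>+y. \<integral>\<^sup>+z. ennreal (norm (y - x i)) * a i y * b j z + ennreal (norm (x i - x j)) * a i y * b j z
        + a i y * (ennreal (norm (z - x j)) * b j z) \<partial>?L \<partial>?L)"
      by (simp add: distrib_left distrib_right ac_simps)
    also have "\<dots> = (\<integral>\<^sup>+y. ennreal (norm (y - x i)) * a i y * ennreal (q j) + ennreal (norm (x i - x j)) * a i y * ennreal (q j)
        + a i y * B j \<partial>?L)"
      using that by (simp add: nn_integral_add nn_integral_cmult ib B_def)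
    also have "\<dots> = A i * ennreal (q j) + ennreal (norm (x i - x j)) * (ennreal (p i) * ennreal (q j)) + ennreal (p i) * B j"
      using that by (simp add: nn_integral_add nn_integral_cmult nn_integral_multc ia A_def mult.assoc[symmetric])
    finally show ?thesis .
  qed
  have "W1 (density lborel (\<lambda>y. \<Sum>j\<in>J. ennreal (u j y))) (density lborel (\<lambda>y. \<Sum>j\<in>J. ennreal (v j y)))
    \<le> (\<integral>\<^sup>+(y, z). ennreal (norm (y - z)) \<partial>K)"
    unfolding W1_def by (rule INF_lower) (auto simp: couplings_def marg1 marg2 sK sD)
  also have "\<dots> = (\<Sum>i\<in>J. \<Sum>j\<in>J. ennreal (w i j) * (\<integral>\<^sup>+y. \<integral>\<^sup>+z. ennreal (norm (y - z)) * (a i y * b j z) \<partial>?L \<partial>?L))"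
    by (subst eK) auto
  also have "\<dots> \<le> (\<Sum>i\<in>J. \<Sum>j\<in>J. ennreal (w i j) *
      (A i * ennreal (q j) + ennreal (norm (x i - x j)) * (ennreal (p i) * ennreal (q j)) + ennreal (p i) * B j))"
    by (intro sum_mono mult_left_mono tri) auto
  also have "\<dots> = (\<Sum>i\<in>J. \<Sum>j\<in>J. ennreal (w i j) * (A i * ennreal (q j)))
      + (\<Sum>i\<in>J. \<Sum>j\<in>J. ennreal (\<gamma> i j * norm (x i - x j)))
      + (\<Sum>i\<in>J. \<Sum>j\<in>J. ennreal (w i j) * (ennreal (p i) * B j))"
  proof -
    have "ennreal (w i j) * (ennreal (norm (x i - x j)) * (ennreal (p i) * ennreal (q j))) = ennreal (\<gamma> i j * norm (x i - x j))"
      if "i \<in> J" "j \<in> J" for i j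
      using that w0 p0 q0 by (simp add: ennreal_mult[symmetric] wpq[OF that, symmetric] ac_simps)
    then show ?thesis by (simp add: distrib_left sum.distrib)
  qed
  also have "(\<Sum>i\<in>J. \<Sum>j\<in>J. ennreal (w i j) * (A i * ennreal (q j))) = (\<Sum>i\<in>J. A i)"
    unfolding A_def by (intro sum.cong refl c1 za) auto
  also have "(\<Sum>i\<in>J. \<Sum>j\<in>J. ennreal (w i j) * (ennreal (p i) * B j)) = (\<Sum>j\<in>J. B j)"
    unfolding B_def by (subst sum.swap, intro sum.cong refl c2 zb) auto
  also have "(\<Sum>i\<in>J. \<Sum>j\<in>J. ennreal (\<gamma> i j * norm (x i - x j))) = ennreal (\<Sum>i\<in>J. \<Sum>j\<in>J. \<gamma> i j * norm (x i - x j))"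
    using g0 by (simp add: sum_ennreal sum_nonneg)
  also have "(\<Sum>i\<in>J. A i) + ennreal (\<Sum>i\<in>J. \<Sum>j\<in>J. \<gamma> i j * norm (x i - x j)) + (\<Sum>j\<in>J. B j)
    = ennreal (\<Sum>i\<in>J. \<Sum>j\<in>J. \<gamma> i j * norm (x i - x j)) + (\<Sum>j\<in>J. A j + B j)"
    by (simp add: sum.distrib ac_simps)
  \<comment> \<open>The positive and negative parts of u - v add up to its absolute value.\<close>
  also have "(\<Sum>j\<in>J. A j + B j) = (\<Sum>j\<in>J. \<integral>\<^sup>+y. ennreal (norm (y - x j) * \<bar>u j y - v j y\<bar>) \<partial>?L)"
  proof (intro sum.cong refl)
    fix j
    have "ennreal (norm (y - x j)) * a j y + ennreal (norm (y - x j)) * b j y = ennreal (norm (y - x j) * \<bar>u j y - v j y\<bar>)" for y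
      unfolding a_def b_def by (auto simp: max_def ennreal_mult ennreal_neg)
    then show "A j + B j = (\<integral>\<^sup>+y. ennreal (norm (y - x j) * \<bar>u j y - v j y\<bar>) \<partial>?L)"
      unfolding A_def B_def by (subst nn_integral_add[symmetric]) auto
  qed
  finally show ?thesis .
qed

section \<open>Gaussian densities\<close>

definition gauss_density :: "real \<Rightarrow> real ^ 'd \<Rightarrow> real" where
  "gauss_density \<sigma> x = (\<Prod>i\<in>UNIV. normal_density 0 \<sigma> (x $ i))"

lemma gauss_density_nonneg[simp]: "0 \<le> gauss_density \<sigma> x"
  by (simp add: gauss_density_def prod_nonneg)

lemma borel_measurable_gauss_density[measurable]: "gauss_density \<sigma> \<in> borel_measurable borel"
  unfolding gauss_density_def by measurable

lemma sets_gaussian[simp, measurable_cong]: "sets (gaussian \<sigma>) = sets borel"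
  by (simp add: gaussian_def)

lemma space_gaussian[simp]: "space (gaussian \<sigma>) = UNIV"
  by (simp add: gaussian_def)

lemma nn_integral_gaussian:
  assumes [measurable]: "f \<in> borel_measurable borel"
  shows "(\<integral>\<^sup>+x. f x \<partial>gaussian \<sigma>) = (\<integral>\<^sup>+x. ennreal (gauss_density \<sigma> x) * f x \<partial>lborel)"
  unfolding gaussian_def gauss_density_def[symmetric] by (subst nn_integral_density) auto

text \<open>Product integration is stated over basis vectors; \<open>axis\<close> identifies these
  with the index type, and \<open>g\<close> carries the factors along that identification.\<close>

lemma nn_integral_lborel_prod_vec:
  fixes f :: "'d::finite \<Rightarrow> real \<Rightarrow> ennreal"
  assumes [measurable]: "\<And>i. f i \<in> borel_measurable borel"
  shows "(\<integral>\<^sup>+x. (\<Prod>i\<in>UNIV. f i (x $ i)) \<partial>(lborel::(real^'d) measure)) = (\<Prod>i\<in>UNIV. \<integral>\<^sup>+x. f i x \<partial>lborel)"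
proof -
  have inj: "inj (\<lambda>i::'d. axis i (1::real))" by (auto simp: inj_on_def axis_eq_axis)
  have B: "(Basis :: (real^'d) set) = range (\<lambda>i. axis i 1)" by (auto simp: Basis_vec_def)
  define g where "g b = f (the_inv (\<lambda>i. axis i 1) b)" for b :: "real^'d"
  have gi: "g (axis i 1) = f i" for i using the_inv_f_f[OF inj, of i] by (simp add: g_def)
  have "(\<integral>\<^sup>+x. (\<Prod>b\<in>Basis. g b (x \<bullet> b)) \<partial>(lborel::(real^'d) measure)) = (\<Prod>b\<in>Basis. \<integral>\<^sup>+x. g b x \<partial>lborel)"
    by (rule nn_integral_lborel_prod) (auto simp: B gi)
  then show ?thesis
    by (simp add: B prod.reindex[OF inj] gi inner_axis)
qed

lemma nn_integral_normal_density[simp]: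
  "0 < \<sigma> \<Longrightarrow> (\<integral>\<^sup>+x. ennreal (normal_density \<mu> \<sigma> x) \<partial>lborel) = 1"
  by (subst nn_integral_eq_integral) auto

lemma nn_integral_gauss_density[simp]:
  assumes "0 < \<sigma>"
  shows "(\<integral>\<^sup>+x. ennreal (gauss_density \<sigma> x) \<partial>(lborel::(real^'d) measure)) = 1"
proof -
  have "(\<integral>\<^sup>+x. ennreal (gauss_density \<sigma> x) \<partial>(lborel::(real^'d) measure))
    = (\<integral>\<^sup>+x. (\<Prod>i\<in>UNIV. ennreal (normal_density 0 \<sigma> (x $ i))) \<partial>(lborel::(real^'d) measure))"
    by (simp add: gauss_density_def prod_ennreal)
  also have "\<dots> = 1" using assms by (subst nn_integral_lborel_prod_vec) simp_all
  finally show ?thesis .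
qed

lemma prob_space_gaussian: "0 < \<sigma> \<Longrightarrow> prob_space (gaussian \<sigma> :: (real^'d) measure)"
  by (rule prob_spaceI)
     (simp add: gaussian_def gauss_density_def[symmetric] emeasure_density)

lemma nn_integral_normal_abs_le:
  assumes "0 < \<sigma>"
  shows "(\<integral>\<^sup>+x. ennreal (normal_density 0 \<sigma> x * \<bar>x\<bar>) \<partial>lborel) \<le> ennreal \<sigma>"
proof -
  have i: "integrable lborel (\<lambda>x. normal_density 0 \<sigma> x * \<bar>x\<bar>)"
    using integrable_normal_moment_abs[OF assms, of 0 1] by simp
  have "(\<integral>x. normal_density 0 \<sigma> x * \<bar>x\<bar> \<partial>lborel) = \<sigma> * sqrt (2 / pi)"
    using integral_normal_moment_abs_odd[OF assms, of 0 0] by simp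
  also have "\<dots> \<le> \<sigma>"
    using assms pi_ge_two by (simp add: mult_le_cancel_left1)
  finally show ?thesis using i by (subst nn_integral_eq_integral) (auto intro: ennreal_leI)
qed

text \<open>Bounding the norm by the sum of the coordinates keeps each integrand a product of
  one-dimensional factors; the factor d comes from there and is not sharp.\<close>

lemma nn_integral_gauss_density_norm_le:
  assumes "0 < \<sigma>"
  shows "(\<integral>\<^sup>+x. ennreal (gauss_density \<sigma> x * norm x) \<partial>(lborel::(real^'d) measure)) \<le> ennreal (real CARD('d) * \<sigma>)"
proof -
  have one: "(\<integral>\<^sup>+x. ennreal (gauss_density \<sigma> x * \<bar>x $ k\<bar>) \<partial>(lborel::(real^'d) measure)) \<le> ennreal \<sigma>" for k
  proof -
    define f where "f = (\<lambda>i x. ennreal (normal_density 0 \<sigma> x * (if i = k then \<bar>x\<bar> else 1)))"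
    have [measurable]: "f i \<in> borel_measurable borel" for i by (auto simp: f_def)
    have "gauss_density \<sigma> x * \<bar>x $ k\<bar> = (\<Prod>i\<in>UNIV. normal_density 0 \<sigma> (x $ i) * (if i = k then \<bar>x $ i\<bar> else 1))" for x :: "real^'d"
      by (simp add: gauss_density_def prod.distrib)
    then have "(\<integral>\<^sup>+x. ennreal (gauss_density \<sigma> x * \<bar>x $ k\<bar>) \<partial>(lborel::(real^'d) measure))
      = (\<integral>\<^sup>+x. (\<Prod>i\<in>UNIV. f i (x $ i)) \<partial>(lborel::(real^'d) measure))"
      unfolding f_def by (subst prod_ennreal) auto
    also have "\<dots> = (\<Prod>i\<in>UNIV. \<integral>\<^sup>+x. f i x \<partial>lborel)" by (rule nn_integral_lborel_prod_vec) simp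
    also have "\<dots> = (\<Prod>i\<in>UNIV. if i = k then \<integral>\<^sup>+x. ennreal (normal_density 0 \<sigma> x * \<bar>x\<bar>) \<partial>lborel else 1)"
      using assms by (intro prod.cong refl) (auto simp: f_def)
    also have "\<dots> \<le> ennreal \<sigma>" using nn_integral_normal_abs_le[OF assms] by simp
    finally show ?thesis .
  qed
  have "(\<integral>\<^sup>+x. ennreal (gauss_density \<sigma> x * norm x) \<partial>(lborel::(real^'d) measure))
    \<le> (\<integral>\<^sup>+x. (\<Sum>k\<in>UNIV. ennreal (gauss_density \<sigma> x * \<bar>x $ k\<bar>)) \<partial>(lborel::(real^'d) measure))"
  proof (rule nn_integral_mono)
    fix x :: "real^'d"
    have "gauss_density \<sigma> x * norm x \<le> gauss_density \<sigma> x * (\<Sum>k\<in>UNIV. \<bar>x $ k\<bar>)"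
      by (intro mult_left_mono norm_le_l1_cart) auto
    then show "ennreal (gauss_density \<sigma> x * norm x) \<le> (\<Sum>k\<in>UNIV. ennreal (gauss_density \<sigma> x * \<bar>x $ k\<bar>))"
      by (subst sum_ennreal) (auto simp: sum_distrib_left intro: ennreal_leI)
  qed
  also have "\<dots> = (\<Sum>k\<in>UNIV. \<integral>\<^sup>+x. ennreal (gauss_density \<sigma> x * \<bar>x $ k\<bar>) \<partial>(lborel::(real^'d) measure))"
    by (rule nn_integral_sum) measurable
  also have "\<dots> \<le> (\<Sum>k\<in>(UNIV::'d set). ennreal \<sigma>)" by (intro sum_mono one)
  also have "\<dots> = ennreal (real CARD('d) * \<sigma>)"
    using assms by (subst sum_ennreal) auto
  finally show ?thesis .
qed

lemma nn_integral_lborel_shift: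
  fixes c :: "'a::euclidean_space"
  assumes [measurable]: "f \<in> borel_measurable borel"
  shows "(\<integral>\<^sup>+x. f (x + c) \<partial>lborel) = (\<integral>\<^sup>+x. f x \<partial>lborel)"
proof -
  have "(\<integral>\<^sup>+x. f x \<partial>lborel) = (\<integral>\<^sup>+x. f x \<partial>distr lborel borel ((+) c))" by (simp add: lborel_distr_plus)
  also have "\<dots> = (\<integral>\<^sup>+x. f (c + x) \<partial>lborel)" by (rule nn_integral_distr) measurable
  finally show ?thesis by (simp add: add.commute)
qed

lemma convolution_gaussian_eq_density:
  fixes P :: "(real^'d) measure"
  assumes P: "prob_space P" and s[measurable_cong]: "sets P = sets borel" and "0 < \<sigma>"
  shows "P \<star> gaussian \<sigma> = density lborel (\<lambda>y. \<integral>\<^sup>+x. ennreal (gauss_density \<sigma> (y - x)) \<partial>P)"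
proof (rule measure_eqI)
  interpret P: prob_space P by fact
  interpret pair_sigma_finite P lborel ..
  fix A assume "A \<in> sets (P \<star> gaussian \<sigma>)"
  then have A[measurable]: "A \<in> sets borel" by simp
  have "emeasure (P \<star> gaussian \<sigma>) A = (\<integral>\<^sup>+x. indicator A x \<partial>(P \<star> gaussian \<sigma>))"
    by simp
  also have "\<dots> = (\<integral>\<^sup>+x. \<integral>\<^sup>+y. indicator A (x + y) \<partial>gaussian \<sigma> \<partial>P)"
    using prob_space_gaussian[OF \<open>0 < \<sigma>\<close>, where 'd='d] assms
    by (intro nn_integral_convolution) (auto simp: prob_space_def)
  also have "\<dots> = (\<integral>\<^sup>+x. \<integral>\<^sup>+y. ennreal (gauss_density \<sigma> (y - x)) * indicator A y \<partial>lborel \<partial>P)"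
  proof (rule nn_integral_cong)
    fix x
    have "(\<integral>\<^sup>+y. indicator A (x + y) \<partial>gaussian \<sigma>)
      = (\<integral>\<^sup>+y. ennreal (gauss_density \<sigma> y) * indicator A (x + y) \<partial>lborel)"
      by (rule nn_integral_gaussian) measurable
    also have "\<dots> = (\<integral>\<^sup>+y. ennreal (gauss_density \<sigma> (y - x)) * indicator A y \<partial>lborel)"
      by (subst nn_integral_lborel_shift[of _ "-x", symmetric]) simp_all
    finally show "(\<integral>\<^sup>+y. indicator A (x + y) \<partial>gaussian \<sigma>)
      = (\<integral>\<^sup>+y. ennreal (gauss_density \<sigma> (y - x)) * indicator A y \<partial>lborel)" .
  qed
  also have "\<dots> = (\<integral>\<^sup>+y. \<integral>\<^sup>+x. ennreal (gauss_density \<sigma> (y - x)) * indicator A y \<partial>P \<partial>lborel)"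
    by (rule Fubini'[symmetric]) measurable
  also have "\<dots> = (\<integral>\<^sup>+y. (\<integral>\<^sup>+x. ennreal (gauss_density \<sigma> (y - x)) \<partial>P) * indicator A y \<partial>lborel)"
    by (intro nn_integral_cong nn_integral_multc) measurable
  also have "\<dots> = emeasure (density lborel (\<lambda>y. \<integral>\<^sup>+x. ennreal (gauss_density \<sigma> (y - x)) \<partial>P)) A"
    by (subst emeasure_density) auto
  finally show "emeasure (P \<star> gaussian \<sigma>) A = emeasure (density lborel (\<lambda>y. \<integral>\<^sup>+x. ennreal (gauss_density \<sigma> (y - x)) \<partial>P)) A" .
qed simp

lemma gauss_density_alt:
  fixes x :: "real^'d"
  shows "gauss_density \<sigma> x = (1 / sqrt (2 * pi * \<sigma>\<^sup>2)) ^ CARD('d) * exp (- (norm x)\<^sup>2 / (2 * \<sigma>\<^sup>2))"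
proof -
  have "(norm x)\<^sup>2 = (\<Sum>i\<in>UNIV. (x $ i)\<^sup>2)"
    by (simp add: norm_vec_def L2_set_def sum_nonneg)
  then show ?thesis
    by (simp add: gauss_density_def normal_density_def prod_dividef power_divide
      exp_sum[symmetric] sum_negf sum_divide_distrib)
qed

lemma gauss_density_bounded:
  fixes x :: "real^'d"
  shows "gauss_density \<sigma> x \<le> (1 / sqrt (2 * pi * \<sigma>\<^sup>2)) ^ CARD('d)"
  unfolding gauss_density_alt by (rule mult_left_le) auto

text \<open>From |x|^2 \<le> 2 |x - h|^2 + 2 |h|^2: doubling the variance absorbs the shift, and the
  power of sqrt 2 is the ratio of the normalising constants. It gives one dominating function for
  the kernels centred anywhere in a small cell.\<close>

lemma gauss_density_shift_le:
  fixes x :: "real^'d"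
  assumes "0 < \<sigma>" "norm h \<le> r * \<sigma>"
  shows "gauss_density \<sigma> (x - h) \<le> sqrt 2 ^ CARD('d) * exp (r\<^sup>2 / 2) * gauss_density (sqrt 2 * \<sigma>) x"
proof -
  have "norm x \<le> norm (x - h) + norm h" using norm_triangle_ineq[of "x - h" h] by simp
  then have "(norm x)\<^sup>2 \<le> (norm (x - h) + norm h)\<^sup>2" by (intro power_mono) auto
  also have "\<dots> \<le> 2 * (norm (x - h))\<^sup>2 + 2 * (norm h)\<^sup>2"
    using zero_le_power2[of "norm (x - h) - norm h"] by (simp add: power2_sum power2_diff)
  finally have a: "(norm x)\<^sup>2 \<le> 2 * (norm (x - h))\<^sup>2 + 2 * (norm h)\<^sup>2" .
  have "(norm h)\<^sup>2 \<le> (r * \<sigma>)\<^sup>2" using assms by (intro power_mono) auto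
  with a have "(norm x)\<^sup>2 \<le> 2 * (norm (x - h))\<^sup>2 + 2 * r\<^sup>2 * \<sigma>\<^sup>2" by (simp add: power_mult_distrib)
  then have "- (norm (x - h))\<^sup>2 / (2 * \<sigma>\<^sup>2) \<le> r\<^sup>2 / 2 - (norm x)\<^sup>2 / (2 * (sqrt 2 * \<sigma>)\<^sup>2)"
    using assms(1) by (simp add: power_mult_distrib field_simps)
  then have "exp (- (norm (x - h))\<^sup>2 / (2 * \<sigma>\<^sup>2)) \<le> exp (r\<^sup>2 / 2) * exp (- (norm x)\<^sup>2 / (2 * (sqrt 2 * \<sigma>)\<^sup>2))"
    by (simp add: exp_add[symmetric])
  then have "gauss_density \<sigma> (x - h) \<le> (1 / sqrt (2 * pi * \<sigma>\<^sup>2)) ^ CARD('d) *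
      (exp (r\<^sup>2 / 2) * exp (- (norm x)\<^sup>2 / (2 * (sqrt 2 * \<sigma>)\<^sup>2)))"
    unfolding gauss_density_alt by (intro mult_left_mono) auto
  moreover have b: "1 / sqrt (2 * pi * \<sigma>\<^sup>2) = sqrt 2 * (1 / sqrt (2 * pi * (sqrt 2 * \<sigma>)\<^sup>2))"
    by (simp add: real_sqrt_mult abs_mult)
  have c: "(1 / sqrt (2 * pi * \<sigma>\<^sup>2)) ^ CARD('d) = sqrt 2 ^ CARD('d) * (1 / sqrt (2 * pi * (sqrt 2 * \<sigma>)\<^sup>2)) ^ CARD('d)"
    using arg_cong[OF b, of "\<lambda>t. t ^ CARD('d)"] by (simp only: power_mult_distrib)
  ultimately show ?thesis
    unfolding gauss_density_alt[of "sqrt 2 * \<sigma>"] c by (simp only: mult_ac)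
qed

section \<open>Dyadic cells\<close>

text \<open>A half-open dyadic cell of side 2^-k is named by its lower corner. The corner is itself
  a point of the space, so one object serves both as index of the cell and as the anchor at which
  its mass is gathered.\<close>

definition grid :: "nat \<Rightarrow> real ^ 'd \<Rightarrow> real ^ 'd" where
  "grid k x = (\<chi> i. of_int \<lfloor>2 ^ k * x $ i\<rfloor> / 2 ^ k)"

lemma measurable_grid[measurable]: "grid k \<in> borel_measurable borel"
  unfolding borel_measurable_euclidean_space[where f="grid k"]
  by (auto simp: Basis_vec_def inner_axis grid_def)

lemma borel_grid_cell: "{x. grid k x = z} \<in> sets borel"
proof -
  have "{x. grid k x = z} = grid k -` {z} \<inter> space borel" by auto
  then show ?thesis using measurable_sets[OF measurable_grid, of "{z}" k] by simp
qed

lemma borel_half_open_box: "{x::real^'d. \<forall>i. a \<le> x $ i \<and> x $ i < b} \<in> sets borel"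
proof -
  have "{x::real^'d. \<forall>i. a \<le> x $ i \<and> x $ i < b} = (\<Inter>i\<in>UNIV. {x. a \<le> x $ i} \<inter> {x. x $ i < b})" by auto
  also have "\<dots> \<in> sets borel" by (intro sets.finite_INT) auto
  finally show ?thesis .
qed

text \<open>Nesting of the dyadic levels in one coordinate: rounding down and then dividing by the
  integer 2^(m - k) with a floor is the same as dividing first.\<close>

lemma floor_scaled_floor:
  fixes x :: real
  shows
  "k \<le> m \<Longrightarrow> \<lfloor>2 ^ k * real_of_int \<lfloor>2 ^ m * x\<rfloor> / 2 ^ m\<rfloor> = \<lfloor>2 ^ k * x\<rfloor>"
proof -
  assume "k \<le> m"
  then have m: "(2::real) ^ m = 2 ^ k * 2 ^ (m - k)" by (simp add: power_add[symmetric])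
  have "2 ^ k * real_of_int \<lfloor>2 ^ m * x\<rfloor> / 2 ^ m = (of_int \<lfloor>2 ^ m * x\<rfloor> / of_int (2 ^ (m - k)) :: real)"
    by (simp add: m)
  also have "\<lfloor>of_int \<lfloor>2 ^ m * x\<rfloor> / of_int (2 ^ (m - k)) :: real\<rfloor> = \<lfloor>2 ^ m * x\<rfloor> div 2 ^ (m - k)"
    by (rule floor_divide_of_int_eq)
  also have "\<dots> = \<lfloor>2 ^ m * x / real_of_int (2 ^ (m - k))\<rfloor>"
    by (subst floor_divide_real_eq_div) simp_all
  also have "2 ^ m * x / real_of_int (2 ^ (m - k)) = 2 ^ k * x" by (simp add: m)
  finally show ?thesis .
qed

lemma grid_grid: "k \<le> m \<Longrightarrow> grid k (grid m x) = grid k x"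
  by (simp add: grid_def floor_scaled_floor)

lemma grid_zero[simp]: "grid k 0 = 0"
  by (simp add: grid_def vec_eq_iff)

lemma grid_component_bounds:
  "grid k x $ i \<le> x $ i" "x $ i < grid k x $ i + 1 / 2 ^ k"
proof -
  have f: "of_int \<lfloor>2 ^ k * x $ i\<rfloor> \<le> 2 ^ k * x $ i" "2 ^ k * x $ i < of_int \<lfloor>2 ^ k * x $ i\<rfloor> + 1"
    by linarith+
  show "grid k x $ i \<le> x $ i" using f(1) by (simp add: grid_def field_simps)
  show "x $ i < grid k x $ i + 1 / 2 ^ k" using f(2) by (simp add: grid_def field_simps)
qed

lemma norm_diff_grid_le:
  fixes x :: "real ^ 'd"
  shows "norm (x - grid k x) \<le> real CARD('d) / 2 ^ k"
proof -
  have "norm (x - grid k x) \<le> (\<Sum>i\<in>UNIV. \<bar>(x - grid k x) $ i\<bar>)" by (rule norm_le_l1_cart)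
  also have "\<dots> \<le> (\<Sum>i\<in>(UNIV::'d set). 1 / 2 ^ k)"
  proof (rule sum_mono)
    fix i
    show "\<bar>(x - grid k x) $ i\<bar> \<le> 1 / 2 ^ k"
      using grid_component_bounds[where k=k and x=x and i=i] by simp
  qed
  finally show ?thesis by simp
qed

text \<open>Climb from both corners to the first common ancestor. One step from level k to k - 1
  moves a corner by at most d / 2^(k - 1), and there are two corners, hence 4 d / 2^k; nothing is
  charged at levels where the cells agree. Distinct unit cells are joined through the origin, which
  costs the two norms.\<close>

lemma norm_grid_diff_le:
  fixes x y :: "real ^ 'd"
  shows "norm (grid m x - grid m y) \<le> (if grid 0 x \<noteq> grid 0 y then norm (grid 0 x) + norm (grid 0 y) else 0)
    + (\<Sum>k\<in>{1..m}. 4 * real CARD('d) / 2 ^ k * (if grid k x \<noteq> grid k y then 1 else 0))"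
proof (induction m)
  case 0
  then show ?case using norm_triangle_ineq4[of "grid 0 x" "grid 0 y"] by simp
next
  case (Suc m)
  let ?r = "if grid 0 x \<noteq> grid 0 y then norm (grid 0 x) + norm (grid 0 y) else 0"
  show ?case
  proof (cases "grid (Suc m) x = grid (Suc m) y")
    case True
    have "0 \<le> ?r" "0 \<le> (\<Sum>k\<in>{1..Suc m}. 4 * real CARD('d) / 2 ^ k * (if grid k x \<noteq> grid k y then 1 else 0))"
      by (simp, intro sum_nonneg) simp
    then show ?thesis using True by simp
  next
    case False
    have d: "norm (grid (Suc m) z - grid m z) \<le> real CARD('d) / 2 ^ m" for z :: "real ^ 'd"
      using norm_diff_grid_le[of "grid (Suc m) z" m] by (simp add: grid_grid)
    have "norm (grid (Suc m) x - grid (Suc m) y) \<le> norm (grid m x - grid m y)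
       + norm (grid (Suc m) x - grid m x) + norm (grid (Suc m) y - grid m y)"
      by norm
    also have "\<dots> \<le> norm (grid m x - grid m y) + 4 * real CARD('d) / 2 ^ Suc m"
      using d[of x] d[of y] by simp
    finally show ?thesis using Suc.IH False by simp
  qed
qed

lemma finite_grid_box:
  fixes L :: nat
  shows "finite (grid m ` {x::real^'d. \<forall>i. - real L \<le> x $ i \<and> x $ i < real L})"
proof -
  let ?S = "{- (2 ^ m * int L)..2 ^ m * int L}"
  have "finite (PiE (UNIV::'d set) (\<lambda>_. ?S))" by (intro finite_PiE) auto
  then have "finite ((\<lambda>f. \<chi> i. of_int (f i) / 2 ^ m) ` PiE (UNIV::'d set) (\<lambda>_. ?S) :: (real^'d) set)" by (rule finite_imageI)
  moreover have "grid m ` {x::real^'d. \<forall>i. - real L \<le> x $ i \<and> x $ i < real L}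
      \<subseteq> (\<lambda>f. \<chi> i. of_int (f i) / 2 ^ m) ` PiE (UNIV::'d set) (\<lambda>_. ?S)"
  proof (intro image_subsetI)
    fix x :: "real^'d" assume "x \<in> {x. \<forall>i. - real L \<le> x $ i \<and> x $ i < real L}"
    then have x: "- real L \<le> x $ i" "x $ i < real L" for i by auto
    have "\<lfloor>2 ^ m * x $ i\<rfloor> \<in> ?S" for i
    proof -
      have "2 ^ m * (- real L) \<le> 2 ^ m * x $ i" "2 ^ m * x $ i \<le> 2 ^ m * real L"
        using x[of i] by (intro mult_left_mono; simp)+
      then have "- (2 ^ m * int L) \<le> \<lfloor>2 ^ m * x $ i\<rfloor>" "\<lfloor>2 ^ m * x $ i\<rfloor> \<le> 2 ^ m * int L"
        by (simp add: le_floor_iff) (use \<open>2 ^ m * x $ i \<le> 2 ^ m * real L\<close> in \<open>simp add: floor_le_iff add.commute add_strict_increasing\<close>)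
      then show ?thesis by simp
    qed
    then show "grid m x \<in> (\<lambda>f. \<chi> i. of_int (f i) / 2 ^ m) ` PiE (UNIV::'d set) (\<lambda>_. ?S)"
      by (intro image_eqI[of _ _ "\<lambda>i. \<lfloor>2 ^ m * x $ i\<rfloor>"]) (auto simp: grid_def)
  qed
  ultimately show ?thesis by (rule finite_subset[rotated])
qed

text \<open>The radius is at most the side of a cell, so each coordinate index differs from that of
  the centre by -1, 0 or 1.\<close>

lemma card_cells_meeting_cball:
  fixes c :: "real ^ 'd"
  assumes "k \<le> m"
  shows "finite (grid k ` cball c (1 / 2 ^ m))" "card (grid k ` cball c (1 / 2 ^ m)) \<le> 3 ^ CARD('d)"
proof -
  define S where "S i = {\<lfloor>2 ^ k * c $ i\<rfloor> - 1..\<lfloor>2 ^ k * c $ i\<rfloor> + 1}" for i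
  define T where "T = (\<lambda>f. \<chi> i. of_int (f i) / 2 ^ k :: real ^ 'd) ` PiE (UNIV::'d set) S"
  have finS: "finite (PiE (UNIV::'d set) S)" by (intro finite_PiE) (auto simp: S_def)
  have "card (PiE (UNIV::'d set) S) = 3 ^ CARD('d)" by (subst card_PiE) (auto simp: S_def)
  then have "card T \<le> 3 ^ CARD('d)" using card_image_le[OF finS] by (metis T_def)
  moreover have fT: "finite T" using finS by (simp add: T_def)
  moreover have sub: "grid k ` cball c (1 / 2 ^ m) \<subseteq> T"
  proof (intro image_subsetI)
    fix x assume "x \<in> cball c (1 / 2 ^ m)"
    then have n: "norm (x - c) \<le> 1 / 2 ^ m" by (simp add: dist_norm norm_minus_commute)
    have "\<lfloor>2 ^ k * x $ i\<rfloor> \<in> S i" for i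
    proof -
      have "\<bar>x $ i - c $ i\<bar> \<le> 1 / 2 ^ m" using n component_le_norm_cart[of "x - c" i] by simp
      also have "\<dots> \<le> 1 / 2 ^ k" using assms by (simp add: field_simps)
      finally have "2 ^ k * \<bar>x $ i - c $ i\<bar> \<le> 1" by (simp add: field_simps)
      then have "\<bar>2 ^ k * x $ i - 2 ^ k * c $ i\<bar> \<le> 1" by (simp add: abs_mult flip: right_diff_distrib)
      then show ?thesis unfolding S_def by (simp add: abs_le_iff) linarith
    qed
    then show "grid k x \<in> T" unfolding T_def
      by (intro image_eqI[of _ _ "\<lambda>i. \<lfloor>2 ^ k * x $ i\<rfloor>"]) (auto simp: grid_def)
  qed
  ultimately show "finite (grid k ` cball c (1 / 2 ^ m))" "card (grid k ` cball c (1 / 2 ^ m)) \<le> 3 ^ CARD('d)"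
    using finite_subset[OF sub fT] card_mono[OF fT sub] by auto
qed

lemma card_cells_meeting_cover:
  fixes F :: "(real ^ 'd) set"
  assumes "k \<le> m" "finite F" "S \<subseteq> (\<Union>c\<in>F. cball c (1 / 2 ^ m))"
  shows "finite (grid k ` S)" "card (grid k ` S) \<le> 3 ^ CARD('d) * card F"
proof -
  let ?U = "\<Union>c\<in>F. grid k ` cball c (1 / 2 ^ m)"
  have sub: "grid k ` S \<subseteq> ?U" using assms(3) by blast
  have fin: "finite ?U" using assms card_cells_meeting_cball(1)[OF assms(1)] by blast
  then show "finite (grid k ` S)" using sub finite_subset by blast
  have "card (grid k ` S) \<le> card ?U" using sub fin by (rule card_mono[rotated])
  also have "\<dots> \<le> (\<Sum>c\<in>F. card (grid k ` cball c (1 / 2 ^ m)))" using assms(2) by (rule card_UN_le)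
  also have "\<dots> \<le> (\<Sum>c\<in>F. (3::nat) ^ CARD('d))" by (intro sum_mono card_cells_meeting_cball assms)
  finally show "card (grid k ` S) \<le> 3 ^ CARD('d) * card F" by (simp add: mult.commute)
qed

lemma sum_sqrt_le:
  assumes "finite A" "\<And>a. a \<in> A \<Longrightarrow> 0 \<le> f a"
  shows "(\<Sum>a\<in>A. sqrt (f a)) \<le> sqrt (real (card A) * (\<Sum>a\<in>A. f a))"
proof (rule real_le_rsqrt)
  have "(\<Sum>a\<in>A. sqrt (f a))\<^sup>2 = (\<Sum>a\<in>A. 1 * sqrt (f a))\<^sup>2" by simp
  also have "\<dots> \<le> (\<Sum>a\<in>A. 1\<^sup>2) * (\<Sum>a\<in>A. (sqrt (f a))\<^sup>2)" by (rule Cauchy_Schwarz_ineq_sum)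
  also have "\<dots> = real (card A) * (\<Sum>a\<in>A. f a)" using assms by simp
  finally show "(\<Sum>a\<in>A. sqrt (f a))\<^sup>2 \<le> real (card A) * (\<Sum>a\<in>A. f a)" .
qed

section \<open>Deviations of empirical means\<close>

text \<open>After expanding the square, independence and the zero mean remove the off-diagonal
  terms.\<close>

lemma prob_space_empirical_sum_square:
  fixes h :: "'a \<Rightarrow> real"
  assumes P: "prob_space P" and [measurable]: "h \<in> borel_measurable P"
    and bd: "\<And>x. \<bar>h x\<bar> \<le> b" and zero: "(\<integral>x. h x \<partial>P) = 0"
  shows "integrable (PiM {..<n::nat} (\<lambda>_. P)) (\<lambda>\<omega>. (\<Sum>i<n. h (\<omega> i))\<^sup>2)"
    and "(\<integral>\<omega>. (\<Sum>i<n. h (\<omega> i))\<^sup>2 \<partial>PiM {..<n} (\<lambda>_. P)) = real n * (\<integral>x. (h x)\<^sup>2 \<partial>P)"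
proof -
  interpret prob_space P by fact
  interpret product_sigma_finite "\<lambda>_::nat. P" ..
  let ?M = "PiM {..<n} (\<lambda>_. P)"
  have b0: "0 \<le> b" using bd[of undefined] by linarith
  have inth: "integrable P h" by (rule integrable_const_bound[of _ b]) (use bd in auto)
  have inth2: "integrable P (\<lambda>x. h x * h x)"
    by (rule integrable_const_bound[of _ "b * b"])
       (use mult_mono[OF bd bd b0 abs_ge_zero] in \<open>auto simp: abs_mult[symmetric] intro: order_trans[OF abs_ge_self]\<close>)
  \<comment> \<open>Writes h(w_k) h(w_l) as a product over all coordinates, with factor 1 away from
    k and l and factor h^2 when k = l, so that the integral over the product space factorises in
    both cases.\<close>
  define f where "f = (\<lambda>k l (i::nat) x. (if i = k then h x else 1) * (if i = l then h x else 1))"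
  have intf: "integrable P (f k l i)" for k l i
    using inth inth2 by (cases "i = k"; cases "i = l") (simp_all add: f_def)
  have eq: "h (\<omega> k) * h (\<omega> l) = (\<Prod>i<n. f k l i (\<omega> i))" if "k < n" "l < n" for k l \<omega>
    using that by (simp add: f_def prod.distrib)
  have int: "integrable ?M (\<lambda>\<omega>. h (\<omega> k) * h (\<omega> l))" if "k < n" "l < n" for k l
    unfolding eq[OF that] by (rule product_integrable_prod) (use intf in auto)
  have val: "(\<integral>\<omega>. h (\<omega> k) * h (\<omega> l) \<partial>?M) = (if l = k then (\<integral>x. (h x)\<^sup>2 \<partial>P) else 0)" if "k < n" "l < n" for k l
  proof -
    have "(\<integral>\<omega>. h (\<omega> k) * h (\<omega> l) \<partial>?M) = (\<Prod>i<n. \<integral>x. f k l i x \<partial>P)"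
      unfolding eq[OF that] by (rule product_integral_prod) (use intf in auto)
    also have "\<dots> = (if l = k then (\<integral>x. (h x)\<^sup>2 \<partial>P) else 0)"
    proof (cases "l = k")
      case True
      have "(\<Prod>i<n. \<integral>x. f k l i x \<partial>P) = (\<Prod>i<n. if i = k then \<integral>x. (h x)\<^sup>2 \<partial>P else 1)"
        using True by (intro prod.cong) (auto simp: f_def power2_eq_square prob_space)
      then show ?thesis using True that by simp
    next
      case False
      have "(\<integral>x. f k l k x \<partial>P) = 0" using False zero by (simp add: f_def)
      then have "(\<Prod>i<n. \<integral>x. f k l i x \<partial>P) = 0"
        using that by (intro prod_zero) auto
      then show ?thesis using False by simp
    qed
    finally show ?thesis .
  qed
  have sq: "(\<Sum>i<n. h (\<omega> i))\<^sup>2 = (\<Sum>k<n. \<Sum>l<n. h (\<omega> k) * h (\<omega> l))" for \<omega>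
    by (simp add: power2_eq_square sum_product)
  show "integrable ?M (\<lambda>\<omega>. (\<Sum>i<n. h (\<omega> i))\<^sup>2)"
    unfolding sq using int by (intro Bochner_Integration.integrable_sum) auto
  have "(\<integral>\<omega>. (\<Sum>i<n. h (\<omega> i))\<^sup>2 \<partial>?M) = (\<Sum>k<n. \<Sum>l<n. \<integral>\<omega>. h (\<omega> k) * h (\<omega> l) \<partial>?M)"
    unfolding sq using int
    by (subst Bochner_Integration.integral_sum, (intro Bochner_Integration.integrable_sum, auto)[1])
       (intro sum.cong refl Bochner_Integration.integral_sum, auto)
  also have "\<dots> = (\<Sum>k<n. \<Sum>l<n. if l = k then (\<integral>x. (h x)\<^sup>2 \<partial>P) else 0)"
    by (intro sum.cong refl) (simp add: val)
  also have "\<dots> = real n * (\<integral>x. (h x)\<^sup>2 \<partial>P)" by simp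
  finally show "(\<integral>\<omega>. (\<Sum>i<n. h (\<omega> i))\<^sup>2 \<partial>?M) = real n * (\<integral>x. (h x)\<^sup>2 \<partial>P)" .
qed

text \<open>L1 is dominated by L2, and the variance by the second moment. The second moment is the
  useful form: for the indicator of a cell it is the mass of the cell, and for a kernel restricted
  to a cell it is still proportional to that mass.\<close>

lemma prob_space_empirical_mean_deviation:
  fixes g :: "'a \<Rightarrow> real"
  assumes P: "prob_space P" and [measurable]: "g \<in> borel_measurable P"
    and bd: "\<And>x. \<bar>g x\<bar> \<le> b" and n: "0 < n"
  shows "(\<integral>\<^sup>+\<omega>. ennreal \<bar>(\<Sum>i<n. g (\<omega> i)) / real n - (\<integral>x. g x \<partial>P)\<bar> \<partial>PiM {..<n} (\<lambda>_. P))
    \<le> ennreal (sqrt ((\<integral>x. (g x)\<^sup>2 \<partial>P) / real n))"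
proof -
  interpret prob_space P by fact
  interpret PP: prob_space "PiM {..<n} (\<lambda>_. P)" by (rule prob_space_PiM) (rule P)
  let ?M = "PiM {..<n} (\<lambda>_. P)"
  have b0: "0 \<le> b" using bd[of undefined] by linarith
  have intg: "integrable P g" by (rule integrable_const_bound[of _ b]) (use bd in auto)
  have intg2: "integrable P (\<lambda>x. (g x)\<^sup>2)"
    by (rule integrable_const_bound[of _ "b\<^sup>2"]) (use bd b0 in \<open>auto intro!: abs_le_square_iff[THEN iffD1]\<close>)
  define e where "e = (\<integral>x. g x \<partial>P)"
  define h where "h = (\<lambda>x. g x - e)"
  have hm[measurable]: "h \<in> borel_measurable P" by (simp add: h_def)
  have hb: "\<bar>h x\<bar> \<le> b + \<bar>e\<bar>" for x using bd[of x] by (auto simp: h_def)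
  have hz: "(\<integral>x. h x \<partial>P) = 0" using intg by (simp add: h_def e_def prob_space)
  note H = prob_space_empirical_sum_square[OF P hm hb hz, of n]
  define X where "X = (\<lambda>\<omega>. \<Sum>i<n. h (\<omega> i))"
  have Xm[measurable]: "X \<in> borel_measurable ?M" unfolding X_def by measurable
  have X2: "integrable ?M (\<lambda>\<omega>. (X \<omega>)\<^sup>2)" using H(1) by (simp add: X_def)
  have X1: "integrable ?M (\<lambda>\<omega>. \<bar>X \<omega>\<bar>)"
  proof (rule Bochner_Integration.integrable_bound[of _ "\<lambda>\<omega>. 1 + (X \<omega>)\<^sup>2"])
    have "\<bar>x\<bar> \<le> 1 + x\<^sup>2" for x :: real
      using zero_le_power2[of "\<bar>x\<bar> - 1"] by (auto simp: power2_diff)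
    then show "AE x in ?M. norm \<bar>X x\<bar> \<le> norm (1 + (X x)\<^sup>2)" by (auto intro: order_trans)
  qed (use X2 in auto)
  have var: "(\<integral>x. (h x)\<^sup>2 \<partial>P) \<le> (\<integral>x. (g x)\<^sup>2 \<partial>P)"
    using variance_eq[OF intg intg2] by (simp add: h_def e_def)
  \<comment> \<open>Nonnegativity of the variance of |X| is the inequality (E |X|)^2 \<le> E
    X^2.\<close>
  have "0 \<le> PP.variance (\<lambda>\<omega>. \<bar>X \<omega>\<bar>)" by (rule PP.variance_positive)
  also have "\<dots> = (\<integral>\<omega>. (X \<omega>)\<^sup>2 \<partial>?M) - (\<integral>\<omega>. \<bar>X \<omega>\<bar> \<partial>?M)\<^sup>2"
    using X1 X2 by (subst PP.variance_eq) auto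
  finally have "(\<integral>\<omega>. \<bar>X \<omega>\<bar> \<partial>?M)\<^sup>2 \<le> real n * (\<integral>x. (h x)\<^sup>2 \<partial>P)" using H(2) by (simp add: X_def)
  also have "\<dots> \<le> real n * (\<integral>x. (g x)\<^sup>2 \<partial>P)" using var by (intro mult_left_mono) auto
  finally have "(\<integral>\<omega>. \<bar>X \<omega>\<bar> \<partial>?M) \<le> sqrt (real n * (\<integral>x. (g x)\<^sup>2 \<partial>P))" by (rule real_le_rsqrt)
  then have "(\<integral>\<omega>. \<bar>X \<omega>\<bar> \<partial>?M) / real n \<le> sqrt (real n * (\<integral>x. (g x)\<^sup>2 \<partial>P)) / real n"
    by (rule divide_right_mono) simp
  also have "\<dots> = sqrt ((\<integral>x. (g x)\<^sup>2 \<partial>P) / real n)"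
    using n by (simp add: real_sqrt_mult real_sqrt_divide field_simps)
  finally have le: "(\<integral>\<omega>. \<bar>X \<omega>\<bar> / real n \<partial>?M) \<le> sqrt ((\<integral>x. (g x)\<^sup>2 \<partial>P) / real n)" using X1 by simp
  have "(\<Sum>i<n. g (\<omega> i)) / real n - e = X \<omega> / real n" for \<omega>
    using n by (simp add: X_def h_def sum_subtractf field_simps)
  then have "(\<integral>\<^sup>+\<omega>. ennreal \<bar>(\<Sum>i<n. g (\<omega> i)) / real n - e\<bar> \<partial>?M) = (\<integral>\<^sup>+\<omega>. ennreal (\<bar>X \<omega>\<bar> / real n) \<partial>?M)"
    by simp
  also have "\<dots> = ennreal (\<integral>\<omega>. \<bar>X \<omega>\<bar> / real n \<partial>?M)"
    using X1 by (intro nn_integral_eq_integral) auto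
  also have "\<dots> \<le> ennreal (sqrt ((\<integral>x. (g x)\<^sup>2 \<partial>P) / real n))" using le by (rule ennreal_leI)
  finally show ?thesis by (simp add: e_def)
qed

section \<open>Summing over dyadic cells\<close>

text \<open>Cells first met by \<open>S m\<close> number at most 3^d a^m and lie outside
  \<open>S (m - 1)\<close>, so they carry mass at most A b^(m - 1). Cauchy-Schwarz bounds their sum
  by a multiple of (a b)^(m/2), summable since a b < 1. Only the starting level, which has no
  predecessor, must use the total mass, and it alone produces the growth a^(k/2).\<close>

lemma sum_sqrt_cells_le:
  fixes \<rho> :: "(real ^ 'd) measure" and a b A :: real
  assumes fin: "finite_measure \<rho>" and sets[measurable_cong]: "sets \<rho> = sets borel"
    and a: "1 \<le> a" and b: "0 < b" and ab: "a * b < 1"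
    and cover: "\<And>m. m0 \<le> m \<Longrightarrow> \<exists>S F. S \<in> sets borel \<and> finite F \<and> S \<subseteq> (\<Union>c\<in>F. cball c (1 / 2 ^ m)) \<and>
      real (card F) \<le> a ^ m \<and> measure \<rho> (- S) \<le> A * b ^ m"
  shows "\<exists>C\<ge>0. \<forall>k G. finite G \<longrightarrow> (\<Sum>z\<in>G. sqrt (measure \<rho> {x. grid k x = z})) \<le> C * sqrt a ^ k"
proof -
  interpret finite_measure \<rho> by fact
  have sp[simp]: "space \<rho> = UNIV" using sets_eq_imp_space_eq[OF sets] by simp
  obtain S F where S: "\<And>m. m0 \<le> m \<Longrightarrow> S m \<in> sets borel" and finF: "\<And>m. m0 \<le> m \<Longrightarrow> finite (F m)"
    and SF: "\<And>m. m0 \<le> m \<Longrightarrow> S m \<subseteq> (\<Union>c\<in>F m. cball c (1 / 2 ^ m))"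
    and cF: "\<And>m. m0 \<le> m \<Longrightarrow> real (card (F m)) \<le> a ^ m"
    and mS: "\<And>m. m0 \<le> m \<Longrightarrow> measure \<rho> (- S m) \<le> A * b ^ m"
    using cover by metis
  have b1: "b < 1" using a b ab by (meson less_eq_real_def mult_left_le_one_le mult_right_mono not_le order_trans mult_le_cancel_right1)
  have A0: "0 \<le> A"
    using mS[of m0] b by (metis measure_nonneg order_refl order_trans zero_le_mult_iff zero_less_power not_le)
  define r where "r = sqrt (a * b)"
  have r: "0 \<le> r" "r < 1" using a b ab by (auto simp: r_def)
  define D where "D = (3::real) ^ CARD('d)"
  have D0: "0 \<le> D" by (simp add: D_def)
  \<comment> \<open>The division by \<open>b\<close> pays for the shift from m to m - 1 in the mass
    bound.\<close>
  define c where "c = sqrt (D * A / b)"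
  define R where "R = measure \<rho> UNIV"
  define c0 where "c0 = sqrt (D * R) * sqrt a ^ m0"
  have c0: "0 \<le> c0" using D0 a by (auto simp: c0_def R_def)
  have c: "0 \<le> c" using D0 A0 b by (auto simp: c_def)
  have a1: "1 \<le> sqrt a" using a by simp
  show ?thesis
  proof (intro exI[of _ "c0 + c / (1 - r)"] conjI allI impI)
    show "0 \<le> c0 + c / (1 - r)" using c0 c r by simp
    fix k and G :: "(real ^ 'd) set" assume G: "finite G"
    define cell where "cell z = {x :: real ^ 'd. grid k x = z}" for z
    have cm[measurable]: "cell z \<in> sets borel" for z
      unfolding cell_def by (rule borel_grid_cell)
    define m1 where "m1 = max k m0"
    define G' where "G' = {z\<in>G. measure \<rho> (cell z) \<noteq> 0}"
    have finG': "finite G'" using G by (simp add: G'_def)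
    \<comment> \<open>A cell that avoids every \<open>S m\<close> has mass at most A b^m for all
      large m, hence mass 0; such cells were removed from \<open>G'\<close>.\<close>
    have meets: "\<exists>m. m1 \<le> m \<and> cell z \<inter> S m \<noteq> {}" if "z \<in> G'" for z
    proof (rule ccontr)
      assume "\<not> ?thesis"
      then have sub: "cell z \<subseteq> - S m" if "m1 \<le> m" for m using that by blast
      have le: "measure \<rho> (cell z) \<le> A * b ^ m" if "m1 \<le> m" for m
      proof -
        have m: "m0 \<le> m" using that by (simp add: m1_def)
        have "measure \<rho> (cell z) \<le> measure \<rho> (- S m)"
          using sub[OF that] S[OF m] by (intro finite_measure_mono) (auto simp: sets)
        then show ?thesis using mS[OF m] by linarith
      qed
      have "(\<lambda>m. A * b ^ m) \<longlonglongrightarrow> A * 0"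
        using b b1 by (intro tendsto_intros LIMSEQ_power_zero) simp
      then have "measure \<rho> (cell z) \<le> A * 0"
        by (rule LIMSEQ_le_const) (use le in blast)
      then show False using \<open>z \<in> G'\<close> by (simp add: G'_def measure_le_0_iff)
    qed
    define lev where "lev z = (LEAST m. m1 \<le> m \<and> cell z \<inter> S m \<noteq> {})" for z
    have lev: "m1 \<le> lev z" "cell z \<inter> S (lev z) \<noteq> {}" if "z \<in> G'" for z
      using LeastI_ex[OF meets[OF that]] by (auto simp: lev_def)
    have lev_min: "cell z \<inter> S m = {}" if "m1 \<le> m" "m < lev z" for z m
      using not_less_Least[of m "\<lambda>m. m1 \<le> m \<and> cell z \<inter> S m \<noteq> {}"] that by (auto simp: lev_def)
    have level_sum: "(\<Sum>z\<in>{z\<in>G'. lev z = m}. sqrt (measure \<rho> (cell z))) \<le> (if m = m1 then c0 * sqrt a ^ k else 0) + c * r ^ m"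
      if m: "m \<in> lev ` G'" for m
    proof -
      let ?H = "{z\<in>G'. lev z = m}"
      have mm: "m1 \<le> m" "k \<le> m" "m0 \<le> m" using m lev(1) by (auto simp: m1_def)
      have finH: "finite ?H" using finG' by simp
      have "?H \<subseteq> grid k ` S m" using lev(2) by (force simp: cell_def)
      then have "card ?H \<le> 3 ^ CARD('d) * card (F m)"
        using card_cells_meeting_cover[OF \<open>k \<le> m\<close> finF SF] mm card_mono le_trans by blast
      from of_nat_mono[where 'a=real, OF this] have "real (card ?H) \<le> D * real (card (F m))"
        by (simp add: D_def)
      also have "\<dots> \<le> D * a ^ m" using cF[OF mm(3)] D0 by (intro mult_left_mono)
      finally have cH: "real (card ?H) \<le> D * a ^ m" .
      have disj: "disjoint_family_on cell ?H" by (auto simp: disjoint_family_on_def cell_def)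
      have un: "(\<Sum>z\<in>?H. measure \<rho> (cell z)) = measure \<rho> (\<Union>z\<in>?H. cell z)"
        using finH disj by (intro finite_measure_finite_Union[symmetric]) auto
      have bound: "(\<Sum>z\<in>?H. sqrt (measure \<rho> (cell z))) \<le> sqrt (D * a ^ m * X)"
        if "measure \<rho> (\<Union>z\<in>?H. cell z) \<le> X" for X
      proof -
        have "(\<Sum>z\<in>?H. sqrt (measure \<rho> (cell z))) \<le> sqrt (real (card ?H) * (\<Sum>z\<in>?H. measure \<rho> (cell z)))"
          by (rule sum_sqrt_le[OF finH]) simp
        also have "\<dots> \<le> sqrt (D * a ^ m * X)"
          unfolding un using cH that D0 a by (intro real_sqrt_le_mono mult_mono) auto
        finally show ?thesis .
      qed
      show ?thesis
      proof (cases "m = m1")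
        case True
        have "(\<Sum>z\<in>?H. sqrt (measure \<rho> (cell z))) \<le> sqrt (D * a ^ m * R)"
          by (rule bound) (auto simp: R_def intro!: finite_measure_mono)
        also have "\<dots> = sqrt (D * R) * sqrt a ^ m" by (simp add: real_sqrt_mult real_sqrt_power)
        \<comment> \<open>The maximum of k and \<open>m0\<close> is at most their sum, so the
          dependence on \<open>m0\<close> becomes a constant factor inside
          \<open>c0\<close>.\<close>
        also have "\<dots> \<le> sqrt (D * R) * sqrt a ^ (m0 + k)"
          using a1 D0 True by (intro mult_left_mono power_increasing) (auto simp: m1_def R_def)
        also have "\<dots> = c0 * sqrt a ^ k" by (simp add: c0_def power_add)
        finally show ?thesis using True c r by (auto intro: add_increasing2)
      next
        case False
        then obtain n where n: "m = Suc n" "m1 \<le> n" using mm(1) by (cases m) auto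
        then have n0: "m0 \<le> n" by (simp add: m1_def)
        have "cell z \<inter> S n = {}" if "z \<in> ?H" for z
          using lev_min[OF n(2), of z] n(1) that by simp
        then have "(\<Union>z\<in>?H. cell z) \<subseteq> - S n" by blast
        then have "measure \<rho> (\<Union>z\<in>?H. cell z) \<le> measure \<rho> (- S n)"
          using S[OF n0] sets by (intro finite_measure_mono) auto
        also have "\<dots> \<le> A * b ^ n" by (rule mS[OF n0])
        finally have "(\<Sum>z\<in>?H. sqrt (measure \<rho> (cell z))) \<le> sqrt (D * a ^ m * (A * b ^ n))" by (rule bound)
        also have "D * a ^ m * (A * b ^ n) = (D * A / b) * (a * b) ^ m"
          using b by (simp add: n power_mult_distrib)
        also have "sqrt \<dots> = c * r ^ m"
          by (simp only: c_def r_def real_sqrt_mult real_sqrt_divide real_sqrt_power)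
        finally show ?thesis using False by simp
      qed
    qed
    have "(\<Sum>z\<in>G. sqrt (measure \<rho> (cell z))) = (\<Sum>z\<in>G'. sqrt (measure \<rho> (cell z)))"
      using G by (intro sum.mono_neutral_right) (auto simp: G'_def)
    also have "\<dots> = (\<Sum>m\<in>lev ` G'. \<Sum>z\<in>{z\<in>G'. lev z = m}. sqrt (measure \<rho> (cell z)))"
      using finG' by (rule sum.image_gen)
    also have "\<dots> \<le> (\<Sum>m\<in>lev ` G'. (if m = m1 then c0 * sqrt a ^ k else 0) + c * r ^ m)"
      by (rule sum_mono) (rule level_sum)
    also have "\<dots> = (\<Sum>m\<in>lev ` G'. if m = m1 then c0 * sqrt a ^ k else 0) + c * (\<Sum>m\<in>lev ` G'. r ^ m)"
      by (simp add: sum.distrib sum_distrib_left)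
    also have "\<dots> \<le> c0 * sqrt a ^ k + c * (1 / (1 - r))"
    proof (intro add_mono mult_left_mono c)
      show "(\<Sum>m\<in>lev ` G'. if m = m1 then c0 * sqrt a ^ k else 0) \<le> c0 * sqrt a ^ k"
        using finG' c0 a by simp
      have "(\<Sum>m\<in>lev ` G'. r ^ m) \<le> (\<Sum>m. r ^ m)"
        using finG' r by (intro sum_le_suminf summable_geometric) auto
      then show "(\<Sum>m\<in>lev ` G'. r ^ m) \<le> 1 / (1 - r)" using r by (simp add: suminf_geometric)
    qed
    also have "\<dots> \<le> (c0 + c / (1 - r)) * sqrt a ^ k"
      using c r mult_left_mono[OF one_le_power[OF a1, of k], of "c / (1 - r)"] by (simp add: distrib_right)
    finally show "(\<Sum>z\<in>G. sqrt (measure \<rho> {x. grid k x = z})) \<le> (c0 + c / (1 - r)) * sqrt a ^ k"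
      by (simp add: cell_def)
  qed
qed

section \<open>Covers from the dimension hypothesis, and concentration from the moment\<close>

lemma Inf_enat_in:
  fixes A :: "enat set"
  shows "A \<noteq> {} \<Longrightarrow> Inf A \<in> A"
  by (metis Inf_enat_def LeastI ex_in_conv)

text \<open>Both infima range over extended naturals and are attained once they are finite, so an
  actual set and an actual family of centres can be extracted. Since ln \<epsilon> < 0, multiplying
  out the quotient turns the bound on the dimension into an upper bound on the cardinality.\<close>

lemma covering_dim_less_imp_cover:
  fixes P :: "(real ^ 'd) measure"
  assumes \<epsilon>: "0 < \<epsilon>" "\<epsilon> < 1" and less: "covering_dim P \<epsilon> \<tau> < ereal t"
  shows "\<exists>S F. S \<in> sets borel \<and> measure P S \<ge> 1 - \<tau> \<and> finite F \<and> S \<subseteq> (\<Union>c\<in>F. cball c \<epsilon>) \<and>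
    real (card F) \<le> \<epsilon> powr (- t)"
proof -
  have l: "ln \<epsilon> < 0" using \<epsilon> by simp
  \<comment> \<open>An infinite covering number would give the quotient -\<infinity> by a negative
    number, that is dimension \<infinity>.\<close>
  have "measure_covering_number P \<epsilon> \<tau> \<noteq> \<infinity>"
  proof
    assume "measure_covering_number P \<epsilon> \<tau> = \<infinity>"
    then show False using less l by (simp add: covering_dim_def ln_enat_def divide_ereal_def)
  qed
  then obtain k where k: "measure_covering_number P \<epsilon> \<tau> = enat k" by auto
  \<comment> \<open>The value 0 is separated because \<open>ln_enat\<close> sends it to
    -\<infinity>; the claimed bound is then trivial.\<close>
  have kt: "real k \<le> \<epsilon> powr (- t)"
  proof (cases "k = 0")
    case False
    then have "- ln (real k) / ln \<epsilon> < t" using less k l by (simp add: covering_dim_def ln_enat_def)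
    then have "ln (real k) \<le> (- t) * ln \<epsilon>" using l by (simp add: field_simps)
    then have "exp (ln (real k)) \<le> exp ((- t) * ln \<epsilon>)" by simp
    then show ?thesis using False \<epsilon> by (simp add: powr_def)
  qed simp
  let ?SS = "{S. S \<in> sets borel \<and> measure P S \<ge> 1 - \<tau>}"
  have ne: "?SS \<noteq> {}"
  proof
    assume "?SS = {}"
    then have "measure_covering_number P \<epsilon> \<tau> = Inf {}"
      unfolding measure_covering_number_def by (simp only: image_empty)
    then show False using k by (simp add: top_enat_def)
  qed
  have "measure_covering_number P \<epsilon> \<tau> \<in> covering_number \<epsilon> ` ?SS"
    unfolding measure_covering_number_def by (rule Inf_enat_in) (use ne in blast)
  then obtain S where S: "S \<in> ?SS" "covering_number \<epsilon> S = enat k" using k by auto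
  let ?FF = "{F. finite F \<and> S \<subseteq> (\<Union>c\<in>F. cball c \<epsilon>)}"
  have ne: "?FF \<noteq> {}"
  proof
    assume "?FF = {}"
    then have "covering_number \<epsilon> S = Inf {}"
      unfolding covering_number_def by (simp only: image_empty)
    then show False using S(2) by (simp add: top_enat_def)
  qed
  have "covering_number \<epsilon> S \<in> (\<lambda>F. enat (card F)) ` ?FF"
    unfolding covering_number_def by (rule Inf_enat_in) (use ne in blast)
  then obtain F where "F \<in> ?FF" "card F = k" using S by auto
  then show ?thesis using S kt by blast
qed

text \<open>A witness s' of the dimension lies strictly below s, and this gap is spent twice: t is
  put strictly between s' and s, and the moment exponent 1 - 2/s exceeds 1 - 2/s'. The cover
  condition is then read at the radii 2^-m, once they are small enough for the upper limit to
  apply.\<close>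

lemma upper_SW1_dim_less_imp_covers:
  fixes P :: "(real ^ 'd) measure"
  assumes "upper_SW1_dim P < ereal s"
  shows "\<exists>t \<alpha> m0. 0 < t \<and> t < s \<and> 2 < s \<and> t < \<alpha> * (1 - 2 / s) \<and> (\<forall>m\<ge>m0. \<exists>S F.
    S \<in> sets borel \<and> measure P S \<ge> 1 - (2 powr (- \<alpha>)) ^ m \<and> finite F \<and> S \<subseteq> (\<Union>c\<in>F. cball c (1 / 2 ^ m)) \<and>
    real (card F) \<le> (2 powr t) ^ m)"
proof -
  obtain s' :: real where s': "2 < s'" "s' < s"
    and lim: "Limsup (at_right 0) (\<lambda>\<epsilon>. covering_dim P \<epsilon> (\<epsilon> powr (s'\<^sup>2 / (s' - 2)))) \<le> ereal s'"
    using assms unfolding upper_SW1_dim_def INF_less_iff by auto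
  define \<alpha> where "\<alpha> = s'\<^sup>2 / (s' - 2)"
  \<comment> \<open>The identity behind the exponent s^2 / (s - 2) in the definition of the
    dimension; passing from s' to s makes it a strict inequality, which leaves room for t.\<close>
  have "s' = \<alpha> * (1 - 2 / s')" using s' by (simp add: \<alpha>_def field_simps power2_eq_square)
  also have "\<dots> < \<alpha> * (1 - 2 / s)"
    using s' by (intro mult_strict_left_mono) (auto simp: \<alpha>_def field_simps)
  finally have "s' < min s (\<alpha> * (1 - 2 / s))" using s' by simp
  then obtain t where t: "s' < t" "t < min s (\<alpha> * (1 - 2 / s))" using dense by blast
  have "Limsup (at_right 0) (\<lambda>\<epsilon>. covering_dim P \<epsilon> (\<epsilon> powr \<alpha>)) < ereal t"
    using lim t by (auto simp: \<alpha>_def intro: le_less_trans)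
  then have "\<forall>\<^sub>F \<epsilon> in at_right 0. covering_dim P \<epsilon> (\<epsilon> powr \<alpha>) < ereal t"
    by (rule Limsup_lessD)
  then obtain e :: real where e: "0 < e" "\<And>\<epsilon>. 0 < \<epsilon> \<Longrightarrow> \<epsilon> < e \<Longrightarrow> covering_dim P \<epsilon> (\<epsilon> powr \<alpha>) < ereal t"
    unfolding eventually_at_right_field by auto
  obtain m0 where m0: "(1/2) ^ m0 < min e 1" using real_arch_pow_inv[of "min e 1" "1/2"] e by auto
  have "\<exists>S F. S \<in> sets borel \<and> measure P S \<ge> 1 - (2 powr (- \<alpha>)) ^ m \<and> finite F \<and> S \<subseteq> (\<Union>c\<in>F. cball c (1 / 2 ^ m)) \<and>
    real (card F) \<le> (2 powr t) ^ m" if "m0 \<le> m" for m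
  proof -
    have "(1/2::real) ^ m \<le> (1/2) ^ m0" using that by (intro power_decreasing) auto
    from le_less_trans[OF this m0] have lt: "1 / 2 ^ m < e" "(1::real) / 2 ^ m < 1"
      by (simp_all add: power_one_over)
    have "(1 / 2 ^ m) powr x = (2 powr (- x)) ^ m" for x :: real
      by (simp add: powr_divide powr_realpow[symmetric] powr_powr powr_minus_divide mult.commute)
    then show ?thesis
      using covering_dim_less_imp_cover[OF _ lt(2) e(2)[OF _ lt(1)]] by simp
  qed
  then show ?thesis using s' t by (intro exI[of _ t] exI[of _ \<alpha>] exI[of _ m0]) auto
qed

text \<open>Cut at the height l of h^2. Below it the set \<open>E\<close> contributes at most l
  \<tau>. Above it h^2 = (h^2)^(1 - s/2) h^s is at most l^(1 - s/2) h^s, because 1 - s/2 is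
  negative.\<close>

lemma moment_concentration:
  fixes P :: "'a measure" and h :: "'a \<Rightarrow> real"
  assumes [measurable]: "h \<in> borel_measurable P" and h: "\<And>x. 1 \<le> h x" and s: "2 < s"
    and M: "(\<integral>\<^sup>+x. ennreal (h x powr s) \<partial>P) \<le> ennreal M" "0 \<le> M"
    and E[measurable]: "E \<in> sets P" and \<tau>: "0 < \<tau>" "emeasure P E \<le> ennreal \<tau>"
  shows "emeasure (density P (\<lambda>x. ennreal ((h x)\<^sup>2))) E \<le> ennreal ((1 + M) * \<tau> powr (1 - 2 / s))"
proof -
  \<comment> \<open>Chosen to balance the two contributions: both l \<tau> and l^(1 - s/2) become
    \<tau>^(1 - 2/s).\<close>
  define l where "l = \<tau> powr (- (2 / s))"
  have l: "0 < l" using \<tau> by (simp add: l_def)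
  have "- (2 / s) * (1 - s / 2) = 1 - 2 / s" using s by (simp add: field_simps)
  then have l1: "l powr (1 - s / 2) = \<tau> powr (1 - 2 / s)" by (simp add: l_def powr_powr)
  have l2: "l * \<tau> = \<tau> powr (1 - 2 / s)" using \<tau> by (simp add: l_def powr_diff powr_minus_divide)
  have pw: "(h x)\<^sup>2 \<le> l + \<tau> powr (1 - 2 / s) * h x powr s" for x
  proof (cases "(h x)\<^sup>2 \<le> l")
    case True
    then show ?thesis by (simp add: add_increasing2)
  next
    case False
    have hp: "0 < h x" using h[of x] by linarith
    have "((h x)\<^sup>2) powr (1 - s / 2) \<le> l powr (1 - s / 2)"
      using False l s by (intro powr_mono2') auto
    then have "((h x)\<^sup>2) powr (1 - s / 2) * h x powr s \<le> \<tau> powr (1 - 2 / s) * h x powr s"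
      unfolding l1 by (intro mult_right_mono) auto
    moreover have "((h x)\<^sup>2) powr (1 - s / 2) * h x powr s = (h x)\<^sup>2"
    proof -
      have "((h x)\<^sup>2) powr (1 - s / 2) * h x powr s = h x powr (2 * (1 - s / 2) + s)"
        using hp by (simp add: powr_powr flip: powr_numeral powr_add)
      also have "2 * (1 - s / 2) + s = 2" by simp
      finally show ?thesis using hp by simp
    qed
    ultimately show ?thesis using l by simp
  qed
  have "emeasure (density P (\<lambda>x. ennreal ((h x)\<^sup>2))) E = (\<integral>\<^sup>+x. ennreal ((h x)\<^sup>2) * indicator E x \<partial>P)"
    by (rule emeasure_density) measurable
  also have "\<dots> \<le> (\<integral>\<^sup>+x. ennreal l * indicator E x + ennreal (\<tau> powr (1 - 2 / s)) * ennreal (h x powr s) \<partial>P)"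
  proof (rule nn_integral_mono)
    fix x
    have "ennreal ((h x)\<^sup>2) \<le> ennreal l + ennreal (\<tau> powr (1 - 2 / s)) * ennreal (h x powr s)"
      using pw[of x] l by (simp add: ennreal_mult[symmetric] ennreal_plus[symmetric] del: ennreal_plus)
    then show "ennreal ((h x)\<^sup>2) * indicator E x \<le> ennreal l * indicator E x + ennreal (\<tau> powr (1 - 2 / s)) * ennreal (h x powr s)"
      by (auto split: split_indicator)
  qed
  also have "\<dots> = ennreal l * emeasure P E + ennreal (\<tau> powr (1 - 2 / s)) * (\<integral>\<^sup>+x. ennreal (h x powr s) \<partial>P)"
    by (subst nn_integral_add) (auto simp: nn_integral_cmult)
  also have "\<dots> \<le> ennreal l * ennreal \<tau> + ennreal (\<tau> powr (1 - 2 / s)) * ennreal M"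
    by (intro add_mono mult_left_mono M \<tau>) auto
  also have "\<dots> = ennreal ((1 + M) * \<tau> powr (1 - 2 / s))"
    using l \<tau> M by (simp add: ennreal_mult[symmetric] ennreal_plus[symmetric] l2[symmetric] algebra_simps del: ennreal_plus)
  finally show ?thesis .
qed

section \<open>Smoothed transport cost of a dyadic partition\<close>

text \<open>The Lebesgue density of the Gaussian convolution of \<open>M\<close> restricted to
  \<open>Q\<close>. It is real-valued, and not in \<open>ennreal\<close>, so that the densities of
  two measures can be subtracted.\<close>

definition smoothed_cell :: "real \<Rightarrow> (real ^ 'd) measure \<Rightarrow> (real ^ 'd) set \<Rightarrow> real ^ 'd \<Rightarrow> real" where
  "smoothed_cell \<sigma> M Q y = (\<integral>x. indicator Q x * gauss_density \<sigma> (y - x) \<partial>M)"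

lemma smoothed_cell_nonneg[simp]: "0 \<le> smoothed_cell \<sigma> M Q y"
  unfolding smoothed_cell_def by (intro integral_nonneg_AE) auto

lemma abs_indicator_gauss_density_le:
  fixes z :: "real ^ 'd"
  shows "\<bar>indicator Q x * gauss_density \<sigma> z\<bar> \<le> (1 / sqrt (2 * pi * \<sigma>\<^sup>2)) ^ CARD('d)"
  using gauss_density_bounded[of \<sigma> z] gauss_density_nonneg[of \<sigma> z]
  by (auto simp: indicator_def simp del: gauss_density_nonneg)

lemma integrable_indicator_gauss_density:
  fixes M :: "(real ^ 'd) measure"
  assumes "finite_measure M" and [measurable_cong]: "sets M = sets borel" and [measurable]: "Q \<in> sets borel"
  shows "integrable M (\<lambda>x. indicator Q x * gauss_density \<sigma> (y - x))"
proof -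
  interpret finite_measure M by fact
  show ?thesis
  proof (rule integrable_const_bound)
    show "AE x in M. norm (indicator Q x * gauss_density \<sigma> (y - x)) \<le> (1 / sqrt (2 * pi * \<sigma>\<^sup>2)) ^ CARD('d)"
      unfolding real_norm_def by (intro AE_I2 abs_indicator_gauss_density_le)
  qed measurable
qed

lemma ennreal_smoothed_cell:
  fixes M :: "(real ^ 'd) measure"
  assumes "finite_measure M" "sets M = sets borel" "Q \<in> sets borel"
  shows "ennreal (smoothed_cell \<sigma> M Q y) = (\<integral>\<^sup>+x. indicator Q x * ennreal (gauss_density \<sigma> (y - x)) \<partial>M)"
proof -
  have "(\<integral>\<^sup>+x. indicator Q x * ennreal (gauss_density \<sigma> (y - x)) \<partial>M)
    = (\<integral>\<^sup>+x. ennreal (indicator Q x * gauss_density \<sigma> (y - x)) \<partial>M)"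
    by (intro nn_integral_cong) (auto split: split_indicator)
  also have "\<dots> = ennreal (smoothed_cell \<sigma> M Q y)"
    unfolding smoothed_cell_def
    by (intro nn_integral_eq_integral integrable_indicator_gauss_density assms) auto
  finally show ?thesis by simp
qed

lemma measurable_smoothed_cell:
  fixes M :: "(real ^ 'd) measure"
  assumes "finite_measure M" and [measurable_cong]: "sets M = sets borel" and [measurable]: "Q \<in> sets borel"
  shows "smoothed_cell \<sigma> M Q \<in> borel_measurable borel"
proof -
  interpret finite_measure M by fact
  show ?thesis unfolding smoothed_cell_def by measurable
qed

text \<open>By Fubini, integrating against the smoothed piece is averaging f over x plus independent
  noise, for x in \<open>Q\<close>.\<close>

lemma nn_integral_smoothed_cell:
  fixes M :: "(real ^ 'd) measure"
  assumes fM: "finite_measure M" and s[measurable_cong]: "sets M = sets borel" and Q[measurable]: "Q \<in> sets borel"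
    and \<sigma>: "0 < \<sigma>" and [measurable]: "f \<in> borel_measurable borel"
  shows "(\<integral>\<^sup>+y. f y * ennreal (smoothed_cell \<sigma> M Q y) \<partial>lborel)
    = (\<integral>\<^sup>+x. indicator Q x * (\<integral>\<^sup>+y. f (y + x) * ennreal (gauss_density \<sigma> y) \<partial>lborel) \<partial>M)"
proof -
  interpret finite_measure M by fact
  interpret pair_sigma_finite M lborel ..
  have "(\<integral>\<^sup>+y. f y * ennreal (smoothed_cell \<sigma> M Q y) \<partial>lborel)
    = (\<integral>\<^sup>+y. \<integral>\<^sup>+x. f y * (indicator Q x * ennreal (gauss_density \<sigma> (y - x))) \<partial>M \<partial>lborel)"
    by (simp add: ennreal_smoothed_cell[OF fM s Q] nn_integral_cmult)
  also have "\<dots> = (\<integral>\<^sup>+x. \<integral>\<^sup>+y. f y * (indicator Q x * ennreal (gauss_density \<sigma> (y - x))) \<partial>lborel \<partial>M)"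
    by (rule Fubini') measurable
  also have "\<dots> = (\<integral>\<^sup>+x. indicator Q x * (\<integral>\<^sup>+y. f y * ennreal (gauss_density \<sigma> (y - x)) \<partial>lborel) \<partial>M)"
    by (intro nn_integral_cong, subst nn_integral_cmult[symmetric])
       (auto intro!: nn_integral_cong simp: mult.left_commute)
  also have "\<dots> = (\<integral>\<^sup>+x. indicator Q x * (\<integral>\<^sup>+y. f (y + x) * ennreal (gauss_density \<sigma> y) \<partial>lborel) \<partial>M)"
  proof -
    have "(\<integral>\<^sup>+y. f y * ennreal (gauss_density \<sigma> (y - x)) \<partial>lborel) = (\<integral>\<^sup>+y. f (y + x) * ennreal (gauss_density \<sigma> y) \<partial>lborel)" for x
      by (subst nn_integral_lborel_shift[of _ x, symmetric]) simp_all
    then show ?thesis by simp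
  qed
  finally show ?thesis .
qed

lemma nn_integral_smoothed_cell_one:
  fixes M :: "(real ^ 'd) measure"
  assumes "finite_measure M" "sets M = sets borel" "Q \<in> sets borel" "0 < \<sigma>"
  shows "(\<integral>\<^sup>+y. ennreal (smoothed_cell \<sigma> M Q y) \<partial>lborel) = emeasure M Q"
  using nn_integral_smoothed_cell[OF assms, of "\<lambda>_. 1"] assms by simp

text \<open>Purely deterministic. The map \<open>c\<close> quantises the space to finitely many
  level-m corners; each fibre is smoothed separately and only the excesses travel. The laminar
  coupling turns the travel between anchors into cell deviations at all levels at once, and the last
  sum is the cost of gathering each excess at its anchor.\<close>

lemma smooth_W1_le:
  fixes \<mu> \<nu> :: "(real ^ 'd) measure" and c :: "real ^ 'd \<Rightarrow> real ^ 'd"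
  assumes \<mu>: "prob_space \<mu>" "sets \<mu> = sets borel" and \<nu>: "prob_space \<nu>" "sets \<nu> = sets borel"
    and \<sigma>: "0 < \<sigma>" and c[measurable]: "c \<in> borel_measurable borel" and fin: "finite (range c)"
    and gridc: "\<And>x. grid m (c x) = c x"
  defines "\<Delta> k z \<equiv> \<bar>measure \<mu> {x. grid k (c x) = z} - measure \<nu> {x. grid k (c x) = z}\<bar>"
  shows "smooth_W1 \<sigma> \<mu> \<nu> \<le> ennreal ((\<Sum>z\<in>grid 0 ` range c. norm z * \<Delta> 0 z)
      + (\<Sum>k\<in>{1..m}. 2 * real CARD('d) / 2 ^ k * (\<Sum>z\<in>grid k ` range c. \<Delta> k z)))
      + (\<Sum>z\<in>range c. \<integral>\<^sup>+y. ennreal (norm (y - z) *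
          \<bar>smoothed_cell \<sigma> \<mu> (c -` {z}) y - smoothed_cell \<sigma> \<nu> (c -` {z}) y\<bar>) \<partial>lborel)"
proof -
  interpret \<mu>: prob_space \<mu> by (rule \<mu>)
  interpret \<nu>: prob_space \<nu> by (rule \<nu>)
  note [measurable_cong] = \<mu>(2) \<nu>(2)
  let ?J = "range c"
  have sp\<mu>: "space \<mu> = UNIV" and sp\<nu>: "space \<nu> = UNIV"
    using sets_eq_imp_space_eq[OF \<mu>(2)] sets_eq_imp_space_eq[OF \<nu>(2)] by simp_all
  have cell[measurable]: "c -` A \<in> sets borel" if "A \<in> sets borel" for A
    using measurable_sets[OF c that] by simp
  have cz: "c -` {z} \<in> sets borel" for z by (rule cell) simp
  define u where "u = (\<lambda>z. smoothed_cell \<sigma> \<mu> (c -` {z}))"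
  define v where "v = (\<lambda>z. smoothed_cell \<sigma> \<nu> (c -` {z}))"
  have um[measurable]: "u z \<in> borel_measurable borel" and vm[measurable]: "v z \<in> borel_measurable borel" for z
    unfolding u_def v_def
    using measurable_smoothed_cell[OF \<mu>.finite_measure_axioms \<mu>(2) cz]
      measurable_smoothed_cell[OF \<nu>.finite_measure_axioms \<nu>(2) cz] by simp_all
  have u0: "0 \<le> u z y" and v0: "0 \<le> v z y" for z y by (simp_all add: u_def v_def)
  have iu: "(\<integral>\<^sup>+y. ennreal (u z y) \<partial>lborel) = ennreal (measure \<mu> (c -` {z}))" for z
    unfolding u_def nn_integral_smoothed_cell_one[OF \<mu>.finite_measure_axioms \<mu>(2) cz \<sigma>]
    by (rule \<mu>.emeasure_eq_measure)
  have iv: "(\<integral>\<^sup>+y. ennreal (v z y) \<partial>lborel) = ennreal (measure \<nu> (c -` {z}))" for z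
    unfolding v_def nn_integral_smoothed_cell_one[OF \<nu>.finite_measure_axioms \<nu>(2) cz \<sigma>]
    by (rule \<nu>.emeasure_eq_measure)
  have partition: "(\<Sum>z\<in>?J. indicator (c -` {z}) x * t) = t" for x and t :: ennreal
  proof -
    have "(\<Sum>z\<in>?J. indicator (c -` {z}) x * t) = (\<Sum>z\<in>?J. if z = c x then t else 0)"
      by (intro sum.cong) (auto simp: indicator_def)
    then show ?thesis using fin by simp
  qed
  have du: "\<mu> \<star> gaussian \<sigma> = density lborel (\<lambda>y. \<Sum>z\<in>?J. ennreal (u z y))"
  proof -
    have "(\<Sum>z\<in>?J. ennreal (u z y)) = (\<integral>\<^sup>+x. ennreal (gauss_density \<sigma> (y - x)) \<partial>\<mu>)" for y
      unfolding u_def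
      by (simp add: ennreal_smoothed_cell[OF \<mu>.finite_measure_axioms \<mu>(2) cz] nn_integral_sum[symmetric] partition
          del: nn_integral_sum)
    then show ?thesis by (simp add: convolution_gaussian_eq_density[OF \<mu> \<sigma>])
  qed
  have dv: "\<nu> \<star> gaussian \<sigma> = density lborel (\<lambda>y. \<Sum>z\<in>?J. ennreal (v z y))"
  proof -
    have "(\<Sum>z\<in>?J. ennreal (v z y)) = (\<integral>\<^sup>+x. ennreal (gauss_density \<sigma> (y - x)) \<partial>\<nu>)" for y
      unfolding v_def
      by (simp add: ennreal_smoothed_cell[OF \<nu>.finite_measure_axioms \<nu>(2) cz] nn_integral_sum[symmetric] partition
          del: nn_integral_sum)
    then show ?thesis by (simp add: convolution_gaussian_eq_density[OF \<nu> \<sigma>])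
  qed
  define p where "p z = enn2real (\<integral>\<^sup>+y. ennreal (max 0 (u z y - v z y)) \<partial>lborel)" for z
  define q where "q z = enn2real (\<integral>\<^sup>+y. ennreal (max 0 (v z y - u z y)) \<partial>lborel)" for z
  have le1: "(\<integral>\<^sup>+y. ennreal (max 0 (u z y - v z y)) \<partial>lborel) \<le> (\<integral>\<^sup>+y. ennreal (u z y) \<partial>lborel)" for z
    using u0 v0 by (intro nn_integral_mono ennreal_leI) auto
  have le2: "(\<integral>\<^sup>+y. ennreal (max 0 (v z y - u z y)) \<partial>lborel) \<le> (\<integral>\<^sup>+y. ennreal (v z y) \<partial>lborel)" for z
    using u0 v0 by (intro nn_integral_mono ennreal_leI) auto
  have p: "(\<integral>\<^sup>+y. ennreal (max 0 (u z y - v z y)) \<partial>lborel) = ennreal (p z)" for z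
    using le_less_trans[OF le1[of z, unfolded iu] ennreal_less_top] unfolding p_def
    by (rule ennreal_enn2real[symmetric])
  have q: "(\<integral>\<^sup>+y. ennreal (max 0 (v z y - u z y)) \<partial>lborel) = ennreal (q z)" for z
    using le_less_trans[OF le2[of z, unfolded iv] ennreal_less_top] unfolding q_def
    by (rule ennreal_enn2real[symmetric])
  have p0: "0 \<le> p z" and q0: "0 \<le> q z" for z by (simp_all add: p_def q_def)
  \<comment> \<open>Removing the common part lowers both masses equally, and smoothing preserves
    mass. The differences p - q are therefore those of the original cells, so the cost on the tree
    does not see the smoothing.\<close>
  have pq: "p z - q z = measure \<mu> (c -` {z}) - measure \<nu> (c -` {z})" for z
  proof -
    have "(\<integral>\<^sup>+y. ennreal (max 0 (u z y - v z y)) \<partial>lborel) + (\<integral>\<^sup>+y. ennreal (v z y) \<partial>lborel)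
      = (\<integral>\<^sup>+y. ennreal (max 0 (u z y - v z y)) + ennreal (v z y) \<partial>lborel)"
      by (subst nn_integral_add) auto
    also have "\<dots> = (\<integral>\<^sup>+y. ennreal (max 0 (v z y - u z y)) + ennreal (u z y) \<partial>lborel)"
      using u0[of z] v0[of z]
      by (intro nn_integral_cong) (auto simp: max_def ennreal_plus[symmetric] simp del: ennreal_plus)
    also have "\<dots> = (\<integral>\<^sup>+y. ennreal (max 0 (v z y - u z y)) \<partial>lborel) + (\<integral>\<^sup>+y. ennreal (u z y) \<partial>lborel)"
      by (subst nn_integral_add) auto
    finally have "ennreal (p z + measure \<nu> (c -` {z})) = ennreal (q z + measure \<mu> (c -` {z}))"
      unfolding p q iu iv using p0 q0 by simp
    then have "p z + measure \<nu> (c -` {z}) = q z + measure \<mu> (c -` {z})"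
      using p0[of z] q0[of z] by (subst (asm) ennreal_inj) simp_all
    then show ?thesis by linarith
  qed
  have s\<mu>: "(\<lambda>z. c -` {z}) ` X \<subseteq> sets \<mu>" and s\<nu>: "(\<lambda>z. c -` {z}) ` X \<subseteq> sets \<nu>" for X
    using cz unfolding \<mu>(2) \<nu>(2) by blast+
  have cells: "measure \<mu> {x. grid k (c x) = a} - measure \<nu> {x. grid k (c x) = a}
      = sum p {z\<in>?J. grid k z = a} - sum q {z\<in>?J. grid k z = a}" for k a
  proof -
    have U: "{x. grid k (c x) = a} = (\<Union>z\<in>{z\<in>?J. grid k z = a}. c -` {z})" by auto
    have d: "disjoint_family_on (\<lambda>z. c -` {z}) {z\<in>?J. grid k z = a}" by (auto simp: disjoint_family_on_def)
    have f: "finite {z\<in>?J. grid k z = a}" using fin by simp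
    have "measure \<mu> {x. grid k (c x) = a} = (\<Sum>z\<in>{z\<in>?J. grid k z = a}. measure \<mu> (c -` {z}))"
      unfolding U by (rule \<mu>.finite_measure_finite_Union[OF f s\<mu> d])
    moreover have "measure \<nu> {x. grid k (c x) = a} = (\<Sum>z\<in>{z\<in>?J. grid k z = a}. measure \<nu> (c -` {z}))"
      unfolding U by (rule \<nu>.finite_measure_finite_Union[OF f s\<nu> d])
    ultimately show ?thesis by (simp add: sum_subtractf[symmetric] pq)
  qed
  have tot: "sum p ?J = sum q ?J"
  proof -
    have d: "disjoint_family_on (\<lambda>z. c -` {z}) ?J" by (auto simp: disjoint_family_on_def)
    have U: "(\<Union>z\<in>?J. c -` {z}) = UNIV" by auto
    have "(\<Sum>z\<in>?J. measure \<mu> (c -` {z})) = 1"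
      using \<mu>.finite_measure_finite_Union[OF fin s\<mu> d] \<mu>.prob_space by (simp only: U sp\<mu>)
    moreover have "(\<Sum>z\<in>?J. measure \<nu> (c -` {z})) = 1"
      using \<nu>.finite_measure_finite_Union[OF fin s\<nu> d] \<nu>.prob_space by (simp only: U sp\<nu>)
    ultimately have "(\<Sum>z\<in>?J. p z - q z) = 0" by (simp add: pq sum_subtractf)
    then show ?thesis by (simp add: sum_subtractf)
  qed
  \<comment> \<open>All cells of all levels at once: dyadic nesting makes this family laminar, so a
    single coupling keeps the maximal mass inside every cell.\<close>
  define L where "L = {{z\<in>?J. grid k z = a} | k a. True}"
  have lam: "Q \<subseteq> R \<or> R \<subseteq> Q \<or> Q \<inter> R = {}" if Q: "Q \<in> L" and R: "R \<in> L" for Q R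
  proof -
    obtain k a k' a' where Q': "Q = {z\<in>?J. grid k z = a}" and R': "R = {z\<in>?J. grid k' z = a'}"
      using Q R by (auto simp: L_def)
    have *: "grid k x = grid k y" if "k \<le> k'" "grid k' x = grid k' y" for k k' and x y :: "real ^ 'd"
      using that by (metis grid_grid)
    consider "k \<le> k'" | "k' \<le> k" by linarith
    then show ?thesis
      by cases (auto simp: Q' R' dest: *)
  qed
  have Lsub: "Q \<subseteq> ?J" if "Q \<in> L" for Q using that by (auto simp: L_def)
  obtain \<gamma> where g0: "\<forall>i\<in>?J. \<forall>j\<in>?J. 0 \<le> \<gamma> i j" and g1: "\<forall>i\<in>?J. (\<Sum>j\<in>?J. \<gamma> i j) = p i"
    and g2: "\<forall>j\<in>?J. (\<Sum>i\<in>?J. \<gamma> i j) = q j"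
    and g3: "\<forall>Q\<in>L. (\<Sum>i\<in>Q. \<Sum>j\<in>Q. \<gamma> i j) = min (sum p Q) (sum q Q)"
    using laminar_coupling[where L=L, OF fin p0 q0 tot Lsub lam] by blast
  have "{z\<in>?J. grid k z = a} \<in> L" for k a unfolding L_def by blast
  note g3' = bspec[OF g3 this]
  have cost: "(\<Sum>i\<in>?J. \<Sum>j\<in>?J. if grid k i \<noteq> grid k j then \<gamma> i j * (w (grid k i) + w (grid k j)) else 0)
    = (\<Sum>a\<in>grid k ` ?J. w a * \<Delta> k a)" for k and w :: "real ^ 'd \<Rightarrow> real"
    unfolding \<Delta>_def cells
    by (rule coupling_cost_across_cells[OF fin]) (use g1 g2 in blast, use g2 in blast, rule g3')
  \<comment> \<open>The factor 4 d / 2^k is split evenly between the two endpoints to match the form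
    w (z i) + w (z j); hence the 2 d in the conclusion.\<close>
  have "(\<Sum>i\<in>?J. \<Sum>j\<in>?J. \<gamma> i j * norm (i - j))
    \<le> (\<Sum>i\<in>?J. \<Sum>j\<in>?J. (if grid 0 i \<noteq> grid 0 j then \<gamma> i j * (norm (grid 0 i) + norm (grid 0 j)) else 0)
      + (\<Sum>k\<in>{1..m}. if grid k i \<noteq> grid k j then \<gamma> i j * (2 * real CARD('d) / 2 ^ k + 2 * real CARD('d) / 2 ^ k) else 0))"
  proof (intro sum_mono)
    fix i j assume ij: "i \<in> ?J" "j \<in> ?J"
    then have "grid m i = i" "grid m j = j" using gridc by auto
    then have "\<gamma> i j * norm (i - j) \<le> \<gamma> i j * ((if grid 0 i \<noteq> grid 0 j then norm (grid 0 i) + norm (grid 0 j) else 0)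
      + (\<Sum>k\<in>{1..m}. 4 * real CARD('d) / 2 ^ k * (if grid k i \<noteq> grid k j then 1 else 0)))"
      using norm_grid_diff_le[of m i j] g0 ij by (intro mult_left_mono) auto
    also have "\<dots> = (if grid 0 i \<noteq> grid 0 j then \<gamma> i j * (norm (grid 0 i) + norm (grid 0 j)) else 0)
      + (\<Sum>k\<in>{1..m}. if grid k i \<noteq> grid k j then \<gamma> i j * (2 * real CARD('d) / 2 ^ k + 2 * real CARD('d) / 2 ^ k) else 0)"
      by (auto simp: distrib_left sum_distrib_left intro!: sum.cong)
    finally show "\<gamma> i j * norm (i - j) \<le> \<dots>" .
  qed
  also have "\<dots> = (\<Sum>z\<in>grid 0 ` ?J. norm z * \<Delta> 0 z) + (\<Sum>k\<in>{1..m}. \<Sum>z\<in>grid k ` ?J. 2 * real CARD('d) / 2 ^ k * \<Delta> k z)"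
  proof -
    have "(\<Sum>i\<in>?J. \<Sum>j\<in>?J. \<Sum>k\<in>{1..m}. if grid k i \<noteq> grid k j then \<gamma> i j * (2 * real CARD('d) / 2 ^ k + 2 * real CARD('d) / 2 ^ k) else 0)
      = (\<Sum>k\<in>{1..m}. \<Sum>i\<in>?J. \<Sum>j\<in>?J. if grid k i \<noteq> grid k j then \<gamma> i j * (2 * real CARD('d) / 2 ^ k + 2 * real CARD('d) / 2 ^ k) else 0)"
      by (subst (3) sum.swap, subst sum.swap) simp
    also have "\<dots> = (\<Sum>k\<in>{1..m}. \<Sum>z\<in>grid k ` ?J. 2 * real CARD('d) / 2 ^ k * \<Delta> k z)"
      by (intro sum.cong refl cost)
    finally show ?thesis unfolding sum.distrib by (simp only: cost)
  qed
  finally have le: "(\<Sum>i\<in>?J. \<Sum>j\<in>?J. \<gamma> i j * norm (i - j)) \<le> (\<Sum>z\<in>grid 0 ` range c. norm z * \<Delta> 0 z)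
      + (\<Sum>k\<in>{1..m}. 2 * real CARD('d) / 2 ^ k * (\<Sum>z\<in>grid k ` range c. \<Delta> k z))"
    by (simp only: sum_distrib_left)
  have "smooth_W1 \<sigma> \<mu> \<nu> \<le> ennreal (\<Sum>i\<in>?J. \<Sum>j\<in>?J. \<gamma> i j * norm (i - j))
      + (\<Sum>j\<in>?J. \<integral>\<^sup>+y. ennreal (norm (y - j) * \<bar>u j y - v j y\<bar>) \<partial>lborel)"
    unfolding smooth_W1_def du dv
    by (rule W1_mixture_le[OF fin um vm u0 v0 p q p0 q0]) (use g0 g1 g2 in auto)
  also have "\<dots> \<le> ennreal ((\<Sum>z\<in>grid 0 ` range c. norm z * \<Delta> 0 z)
      + (\<Sum>k\<in>{1..m}. 2 * real CARD('d) / 2 ^ k * (\<Sum>z\<in>grid k ` range c. \<Delta> k z)))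
      + (\<Sum>j\<in>?J. \<integral>\<^sup>+y. ennreal (norm (y - j) * \<bar>u j y - v j y\<bar>) \<partial>lborel)"
    using le by (intro add_right_mono ennreal_leI)
  finally show ?thesis by (simp add: u_def v_def)
qed

section \<open>Expected deviations\<close>

lemma measurable_uniform_count_measure_borel:
  "\<omega> \<in> measurable (uniform_count_measure {..<n}) borel"
  by (auto simp: measurable_def)

lemma sets_empirical_measure[simp, measurable_cong]: "sets (empirical_measure n \<omega>) = sets borel"
  by (simp add: empirical_measure_def)

lemma prob_space_empirical_measure: "0 < n \<Longrightarrow> prob_space (empirical_measure n \<omega>)"
  unfolding empirical_measure_def
  by (intro prob_space.prob_space_distr prob_space_uniform_count_measure measurable_uniform_count_measure_borel) auto

lemma integral_empirical_measure:
  fixes f :: "real ^ 'd \<Rightarrow> real"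
  assumes "f \<in> borel_measurable borel"
  shows "(\<integral>x. f x \<partial>empirical_measure n \<omega>) = (\<Sum>i<n. f (\<omega> i)) / real n"
  unfolding empirical_measure_def using assms
  by (subst integral_distr[OF measurable_uniform_count_measure_borel]) (auto simp: uniform_count_measure_def lebesgue_integral_point_measure_finite sum_divide_distrib)

lemma measure_empirical_measure:
  fixes \<omega> :: "nat \<Rightarrow> real ^ 'd"
  assumes "0 < n" and [measurable]: "A \<in> sets borel"
  shows "measure (empirical_measure n \<omega>) A = (\<Sum>i<n. indicator A (\<omega> i)) / real n"
proof -
  interpret E: prob_space "empirical_measure n \<omega>" by (rule prob_space_empirical_measure) fact
  have "measure (empirical_measure n \<omega>) A = (\<integral>x. indicator A x \<partial>empirical_measure n \<omega>)" by simp
  then show ?thesis by (subst (asm) integral_empirical_measure) auto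
qed

lemma smoothed_cell_empirical_measure:
  assumes [measurable]: "A \<in> sets borel"
  shows "smoothed_cell \<sigma> (empirical_measure n \<omega>) A y
    = (\<Sum>i<n. indicator A (\<omega> i) * gauss_density \<sigma> (y - \<omega> i)) / real n"
  unfolding smoothed_cell_def by (rule integral_empirical_measure) measurable

lemma measurable_measure_empirical_measure:
  fixes P :: "(real ^ 'd) measure"
  assumes [measurable_cong]: "sets P = sets borel" and n: "0 < n" and A[measurable]: "A \<in> sets borel"
  shows "(\<lambda>\<omega>. measure (empirical_measure n \<omega>) A) \<in> borel_measurable (PiM {..<n} (\<lambda>_. P))"
  unfolding measure_empirical_measure[OF n A] by measurable

text \<open>Unfolding to a finite average over the sample makes the joint dependence on the sample
  and on y explicit.\<close>

lemma measurable_smoothed_cell_empirical_measure: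
  fixes P :: "(real ^ 'd) measure"
  assumes [measurable_cong]: "sets P = sets borel" and A[measurable]: "A \<in> sets borel"
    and [measurable]: "v \<in> borel_measurable borel"
  shows "(\<lambda>\<omega>. \<integral>\<^sup>+y. ennreal (norm (y - z) * \<bar>smoothed_cell \<sigma> (empirical_measure n \<omega>) A y - v y\<bar>) \<partial>lborel)
    \<in> borel_measurable (PiM {..<n} (\<lambda>_. P))"
  unfolding smoothed_cell_empirical_measure[OF A] by measurable

text \<open>An indicator equals its square, so the second moment in the deviation bound is the mass
  of the set.\<close>

lemma expected_cell_deviation_le:
  fixes P :: "(real ^ 'd) measure"
  assumes P: "prob_space P" and s[measurable_cong]: "sets P = sets borel" and n: "0 < n" and A[measurable]: "A \<in> sets borel"
  shows "(\<integral>\<^sup>+\<omega>. ennreal \<bar>measure (empirical_measure n \<omega>) A - measure P A\<bar> \<partial>PiM {..<n} (\<lambda>_. P))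
    \<le> ennreal (sqrt (measure P A / real n))"
proof -
  interpret prob_space P by (rule P)
  have sp: "space P = UNIV" using sets_eq_imp_space_eq[OF s] by simp
  have m: "(\<integral>x. indicator A x \<partial>P) = measure P A" "(\<integral>x. (indicator A x)\<^sup>2 \<partial>P) = measure P A"
  proof -
    show "(\<integral>x. indicator A x \<partial>P) = measure P A" by (simp add: sp)
    have "(indicator A x :: real)\<^sup>2 = indicator A x" for x by (auto split: split_indicator)
    then show "(\<integral>x. (indicator A x)\<^sup>2 \<partial>P) = measure P A" by (simp add: sp)
  qed
  have im: "(indicator A :: _ \<Rightarrow> real) \<in> borel_measurable P" by measurable
  show ?thesis
    using prob_space_empirical_mean_deviation[OF P im _ n, of 1] by (simp add: measure_empirical_measure[OF n A] m)
qed

lemma nn_integral_PiM_component: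
  assumes P: "prob_space P" and "i < n" and [measurable]: "f \<in> borel_measurable P"
  shows "(\<integral>\<^sup>+\<omega>. f (\<omega> i) \<partial>PiM {..<n::nat} (\<lambda>_. P)) = (\<integral>\<^sup>+x. f x \<partial>P)"
proof -
  have "distr (PiM {..<n} (\<lambda>_. P)) P (\<lambda>\<omega>. \<omega> i) = P"
    using assms by (intro distr_PiM_component) auto
  then have "(\<integral>\<^sup>+x. f x \<partial>P) = (\<integral>\<^sup>+x. f x \<partial>distr (PiM {..<n} (\<lambda>_. P)) P (\<lambda>\<omega>. \<omega> i))" by simp
  also have "\<dots> = (\<integral>\<^sup>+\<omega>. f (\<omega> i) \<partial>PiM {..<n::nat} (\<lambda>_. P))"
    using assms by (intro nn_integral_distr) auto
  finally show ?thesis ..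
qed

text \<open>On the part \<open>Q\<close> close to \<open>z\<close> the variance bound is used, while on \<open>E\<close> both measures are
  bounded separately.\<close>

lemma expected_smoothed_cell_deviation_le:
  fixes P :: "(real ^ 'd) measure" and z :: "real ^ 'd"
  assumes P: "prob_space P" and s[measurable_cong]: "sets P = sets borel" and n: "0 < n" and \<sigma>: "0 < \<sigma>"
    and Q[measurable]: "Q \<in> sets borel" and E[measurable]: "E \<in> sets borel" and QE: "Q \<inter> E = {}"
    and near: "\<And>x. x \<in> Q \<Longrightarrow> norm (x - z) \<le> r * \<sigma>"
  shows "(\<integral>\<^sup>+\<omega>. \<integral>\<^sup>+y. ennreal (norm (y - z) *
      \<bar>smoothed_cell \<sigma> (empirical_measure n \<omega>) (Q \<union> E) y - smoothed_cell \<sigma> P (Q \<union> E) y\<bar>) \<partial>lborel \<partial>PiM {..<n} (\<lambda>_. P))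
    \<le> ennreal (sqrt 2 ^ CARD('d) * exp (r\<^sup>2 / 2) * (real CARD('d) * sqrt 2) * \<sigma> * sqrt (measure P Q / real n))
      + 2 * (\<integral>\<^sup>+x. indicator E x * ennreal (norm (x - z) + real CARD('d) * \<sigma>) \<partial>P)"
proof -
  interpret P: prob_space P by (rule P)
  let ?M = "PiM {..<n} (\<lambda>_. P)"
  interpret M: prob_space ?M by (rule prob_space_PiM) (rule P)
  interpret pair_sigma_finite lborel ?M ..
  have sp: "space P = UNIV" using sets_eq_imp_space_eq[OF s] by simp
  define g where "g A y x = indicator A x * gauss_density \<sigma> (y - x)" for A and x y :: "real ^ 'd"
  have [measurable]: "(\<lambda>(x, y). g A (f x) (h y)) \<in> borel_measurable (M1 \<Otimes>\<^sub>M M2)"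
    if [measurable]: "A \<in> sets borel" "f \<in> borel_measurable M1" "h \<in> borel_measurable M2" for A f h and M1 :: "'x measure" and M2 :: "'y measure"
    unfolding g_def by measurable
  have gm[measurable]: "g A y \<in> borel_measurable P" if [measurable]: "A \<in> sets borel" for A y
    unfolding g_def by measurable
  have g0: "0 \<le> g A y x" for A y x by (simp add: g_def)
  have gb: "\<bar>g A y x\<bar> \<le> (1 / sqrt (2 * pi * \<sigma>\<^sup>2)) ^ CARD('d)" for A y x
    unfolding g_def by (rule abs_indicator_gauss_density_le)
  have gint: "integrable P (g A y)" if "A \<in> sets borel" for A y
    unfolding g_def using integrable_indicator_gauss_density[OF P.finite_measure_axioms s that] .
  have scP: "smoothed_cell \<sigma> P A y = (\<integral>x. g A y x \<partial>P)" for A y by (simp add: smoothed_cell_def g_def)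
  have scE: "smoothed_cell \<sigma> (empirical_measure n \<omega>) A y = (\<Sum>i<n. g A y (\<omega> i)) / real n"
    if [measurable]: "A \<in> sets borel" for A y \<omega>
    unfolding g_def by (rule smoothed_cell_empirical_measure[OF that])
  have QEm[measurable]: "Q \<union> E \<in> sets borel" by measurable
  \<comment> \<open>A majorant of the kernel that does not depend on which point of \<open>Q\<close>
    is the centre. It makes the second moment at y at most P(Q) B(y)^2, and it has a finite first
    moment around z.\<close>
  define B where "B y = sqrt 2 ^ CARD('d) * exp (r\<^sup>2 / 2) * gauss_density (sqrt 2 * \<sigma>) (y - z)" for y
  have B0: "0 \<le> B y" for y by (simp add: B_def)
  have Bm[measurable]: "B \<in> borel_measurable borel" unfolding B_def by measurable
  have gB: "g Q y x \<le> indicator Q x * B y" for y x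
    using gauss_density_shift_le[OF \<sigma> near[of x], of "y - z"] by (auto simp: g_def B_def split: split_indicator)
  have devQ: "(\<integral>\<^sup>+\<omega>. ennreal \<bar>(\<Sum>i<n. g Q y (\<omega> i)) / real n - (\<integral>x. g Q y x \<partial>P)\<bar> \<partial>?M)
      \<le> ennreal (sqrt (measure P Q / real n) * B y)" for y
  proof -
    have "(\<integral>x. (g Q y x)\<^sup>2 \<partial>P) \<le> (\<integral>x. indicator Q x * (B y)\<^sup>2 \<partial>P)"
    proof (rule integral_mono_AE')
      show "AE x in P. (g Q y x)\<^sup>2 \<le> indicator Q x * (B y)\<^sup>2"
      proof (intro AE_I2)
        fix x
        have "(g Q y x)\<^sup>2 \<le> (indicator Q x * B y)\<^sup>2" by (intro power_mono gB g0)
        then show "(g Q y x)\<^sup>2 \<le> indicator Q x * (B y)\<^sup>2" by (auto split: split_indicator)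
      qed
    qed (auto simp: P.emeasure_eq_measure)
    also have "\<dots> = measure P Q * (B y)\<^sup>2" by (simp add: sp)
    finally have "sqrt ((\<integral>x. (g Q y x)\<^sup>2 \<partial>P) / real n) \<le> sqrt (measure P Q * (B y)\<^sup>2 / real n)"
      by (intro real_sqrt_le_mono divide_right_mono) auto
    also have "\<dots> = sqrt (measure P Q / real n) * B y"
      using B0[of y] by (simp add: real_sqrt_mult real_sqrt_divide)
    finally show ?thesis
      using prob_space_empirical_mean_deviation[OF P gm[OF Q] gb n, of y]
      by (meson ennreal_leI order_trans)
  qed
  \<comment> \<open>The empirical density is unbiased, so on \<open>E\<close> the empirical and the
    true contribution have the same mean; this explains the factor 2 on the second term.\<close>
  have meanE: "(\<integral>\<^sup>+\<omega>. ennreal ((\<Sum>i<n. g E y (\<omega> i)) / real n) \<partial>?M) = ennreal (\<integral>x. g E y x \<partial>P)" for y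
  proof -
    have "ennreal ((\<Sum>i<n. g E y (\<omega> i)) / real n) = (\<Sum>i<n. ennreal (g E y (\<omega> i) / real n))" for \<omega>
      using g0 by (subst sum_ennreal) (auto simp: sum_divide_distrib)
    then have "(\<integral>\<^sup>+\<omega>. ennreal ((\<Sum>i<n. g E y (\<omega> i)) / real n) \<partial>?M) = (\<integral>\<^sup>+\<omega>. (\<Sum>i<n. ennreal (g E y (\<omega> i) / real n)) \<partial>?M)"
      by simp
    also have "\<dots> = (\<Sum>i<n. \<integral>\<^sup>+\<omega>. ennreal (g E y (\<omega> i) / real n) \<partial>?M)"
      by (intro nn_integral_sum) measurable
    also have "\<dots> = (\<Sum>i<n. \<integral>\<^sup>+x. ennreal (g E y x / real n) \<partial>P)"
      by (intro sum.cong refl nn_integral_PiM_component[OF P]) auto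
    also have "\<dots> = (\<Sum>i<n. ennreal ((\<integral>x. g E y x \<partial>P) / real n))"
      using gint[OF E] g0 by (subst nn_integral_eq_integral) auto
    also have "\<dots> = ennreal (\<integral>x. g E y x \<partial>P)"
      using n g0 by (subst sum_ennreal) (auto intro!: integral_nonneg_AE)
    finally show ?thesis .
  qed
  have inner: "(\<integral>\<^sup>+\<omega>. ennreal \<bar>(\<Sum>i<n. g (Q \<union> E) y (\<omega> i)) / real n - (\<integral>x. g (Q \<union> E) y x \<partial>P)\<bar> \<partial>?M)
      \<le> ennreal (sqrt (measure P Q / real n) * B y) + 2 * ennreal (\<integral>x. g E y x \<partial>P)" for y
  proof -
    have split: "g (Q \<union> E) y x = g Q y x + g E y x" for x
      using QE by (auto simp: g_def split: split_indicator)
    have iE: "0 \<le> (\<integral>x. g E y x \<partial>P)" using g0 by (intro integral_nonneg_AE) auto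
    have "(\<integral>\<^sup>+\<omega>. ennreal \<bar>(\<Sum>i<n. g (Q \<union> E) y (\<omega> i)) / real n - (\<integral>x. g (Q \<union> E) y x \<partial>P)\<bar> \<partial>?M)
      \<le> (\<integral>\<^sup>+\<omega>. ennreal \<bar>(\<Sum>i<n. g Q y (\<omega> i)) / real n - (\<integral>x. g Q y x \<partial>P)\<bar>
        + (ennreal ((\<Sum>i<n. g E y (\<omega> i)) / real n) + ennreal (\<integral>x. g E y x \<partial>P)) \<partial>?M)"
    proof (rule nn_integral_mono)
      fix \<omega>
      define X1 where "X1 = (\<Sum>i<n. g Q y (\<omega> i)) / real n - (\<integral>x. g Q y x \<partial>P)"
      define X2 where "X2 = (\<Sum>i<n. g E y (\<omega> i)) / real n"
      define X3 where "X3 = (\<integral>x. g E y x \<partial>P)"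
      have X: "0 \<le> X2" "0 \<le> X3" using g0 iE by (auto simp: X2_def X3_def intro!: sum_nonneg divide_nonneg_nonneg)
      have "(\<Sum>i<n. g (Q \<union> E) y (\<omega> i)) / real n - (\<integral>x. g (Q \<union> E) y x \<partial>P) = X1 + X2 - X3"
        using gint[OF Q, of y] gint[OF E, of y] by (simp add: split sum.distrib add_divide_distrib X1_def X2_def X3_def)
      moreover have "\<bar>X1 + X2 - X3\<bar> \<le> \<bar>X1\<bar> + (X2 + X3)" using X by linarith
      then have "ennreal \<bar>X1 + X2 - X3\<bar> \<le> ennreal \<bar>X1\<bar> + (ennreal X2 + ennreal X3)"
        using X by (simp add: ennreal_plus[symmetric] ennreal_leI del: ennreal_plus)
      ultimately show "ennreal \<bar>(\<Sum>i<n. g (Q \<union> E) y (\<omega> i)) / real n - (\<integral>x. g (Q \<union> E) y x \<partial>P)\<bar>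
        \<le> ennreal \<bar>(\<Sum>i<n. g Q y (\<omega> i)) / real n - (\<integral>x. g Q y x \<partial>P)\<bar>
          + (ennreal ((\<Sum>i<n. g E y (\<omega> i)) / real n) + ennreal (\<integral>x. g E y x \<partial>P))"
        by (simp add: X1_def X2_def X3_def)
    qed
    also have "\<dots> = (\<integral>\<^sup>+\<omega>. ennreal \<bar>(\<Sum>i<n. g Q y (\<omega> i)) / real n - (\<integral>x. g Q y x \<partial>P)\<bar> \<partial>?M)
        + (ennreal (\<integral>x. g E y x \<partial>P) + ennreal (\<integral>x. g E y x \<partial>P))"
      by (subst nn_integral_add, measurable, subst nn_integral_add, measurable) (simp add: meanE M.emeasure_space_1)
    also have "\<dots> \<le> ennreal (sqrt (measure P Q / real n) * B y) + 2 * ennreal (\<integral>x. g E y x \<partial>P)"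
      by (intro add_mono devQ) (simp add: mult_2)
    finally show ?thesis .
  qed
  have "(\<integral>\<^sup>+\<omega>. \<integral>\<^sup>+y. ennreal (norm (y - z) *
      \<bar>smoothed_cell \<sigma> (empirical_measure n \<omega>) (Q \<union> E) y - smoothed_cell \<sigma> P (Q \<union> E) y\<bar>) \<partial>lborel \<partial>?M)
    = (\<integral>\<^sup>+\<omega>. \<integral>\<^sup>+y. ennreal (norm (y - z)) *
      ennreal \<bar>(\<Sum>i<n. g (Q \<union> E) y (\<omega> i)) / real n - (\<integral>x. g (Q \<union> E) y x \<partial>P)\<bar> \<partial>lborel \<partial>?M)"
    by (simp add: scP scE[OF QEm] ennreal_mult)
  \<comment> \<open>Fubini brings the expectation inside, so that the deviation bound is applied at
    a fixed y and only then integrated over space.\<close>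
  also have "\<dots> = (\<integral>\<^sup>+y. \<integral>\<^sup>+\<omega>. ennreal (norm (y - z)) *
      ennreal \<bar>(\<Sum>i<n. g (Q \<union> E) y (\<omega> i)) / real n - (\<integral>x. g (Q \<union> E) y x \<partial>P)\<bar> \<partial>?M \<partial>lborel)"
    by (rule Fubini') (measurable)
  also have "\<dots> = (\<integral>\<^sup>+y. ennreal (norm (y - z)) * (\<integral>\<^sup>+\<omega>.
      ennreal \<bar>(\<Sum>i<n. g (Q \<union> E) y (\<omega> i)) / real n - (\<integral>x. g (Q \<union> E) y x \<partial>P)\<bar> \<partial>?M) \<partial>lborel)"
    by (intro nn_integral_cong nn_integral_cmult) measurable
  also have "\<dots> \<le> (\<integral>\<^sup>+y. ennreal (norm (y - z)) *
      (ennreal (sqrt (measure P Q / real n) * B y) + 2 * ennreal (\<integral>x. g E y x \<partial>P)) \<partial>lborel)"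
    by (intro nn_integral_mono mult_left_mono inner) auto
  also have "\<dots> = (\<integral>\<^sup>+y. ennreal (sqrt (measure P Q / real n)) * (ennreal (norm (y - z)) * ennreal (B y))
      + 2 * (ennreal (norm (y - z)) * ennreal (smoothed_cell \<sigma> P E y)) \<partial>lborel)"
    using B0 by (intro nn_integral_cong) (simp add: ennreal_mult distrib_left scP ac_simps)
  also have "\<dots> = ennreal (sqrt (measure P Q / real n)) * (\<integral>\<^sup>+y. ennreal (norm (y - z)) * ennreal (B y) \<partial>lborel)
      + 2 * (\<integral>\<^sup>+y. ennreal (norm (y - z)) * ennreal (smoothed_cell \<sigma> P E y) \<partial>lborel)"
    using measurable_smoothed_cell[OF P.finite_measure_axioms s E]
    by (simp add: nn_integral_add nn_integral_cmult)
  also have "\<dots> \<le> ennreal (sqrt (measure P Q / real n)) * ennreal (sqrt 2 ^ CARD('d) * exp (r\<^sup>2 / 2) * (real CARD('d) * (sqrt 2 * \<sigma>)))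
      + 2 * (\<integral>\<^sup>+x. indicator E x * ennreal (norm (x - z) + real CARD('d) * \<sigma>) \<partial>P)"
  proof (intro add_mono mult_left_mono)
    let ?D = "sqrt 2 ^ CARD('d) * exp (r\<^sup>2 / 2)"
    have "(\<integral>\<^sup>+y. ennreal (norm (y - z)) * ennreal (B y) \<partial>lborel)
      = (\<integral>\<^sup>+y. ennreal (norm y) * (ennreal ?D * ennreal (gauss_density (sqrt 2 * \<sigma>) y)) \<partial>(lborel :: (real ^ 'd) measure))"
      by (subst nn_integral_lborel_shift[of _ z, symmetric]) (simp_all add: B_def ennreal_mult)
    also have "\<dots> = ennreal ?D * (\<integral>\<^sup>+y. ennreal (gauss_density (sqrt 2 * \<sigma>) y * norm y) \<partial>(lborel :: (real ^ 'd) measure))"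
      by (subst nn_integral_cmult[symmetric]) (auto intro!: nn_integral_cong simp: ennreal_mult ac_simps)
    \<comment> \<open>The majorant is a Gaussian of standard deviation sqrt 2 times
      \<open>\<sigma>\<close> around z, so this first moment supplies the factor
      \<open>\<sigma>\<close> of the local cost.\<close>
    also have "\<dots> \<le> ennreal ?D * ennreal (real CARD('d) * (sqrt 2 * \<sigma>))"
      using \<sigma> by (intro mult_left_mono nn_integral_gauss_density_norm_le) auto
    also have "\<dots> = ennreal (?D * (real CARD('d) * (sqrt 2 * \<sigma>)))"
      using \<sigma> by (subst ennreal_mult[symmetric]) auto
    finally show "(\<integral>\<^sup>+y. ennreal (norm (y - z)) * ennreal (B y) \<partial>lborel) \<le> \<dots>" .
    have "(\<integral>\<^sup>+y. ennreal (norm (y - z)) * ennreal (smoothed_cell \<sigma> P E y) \<partial>lborel)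
      = (\<integral>\<^sup>+x. indicator E x * (\<integral>\<^sup>+y. ennreal (norm (y + x - z)) * ennreal (gauss_density \<sigma> y) \<partial>lborel) \<partial>P)"
      by (rule nn_integral_smoothed_cell[OF P.finite_measure_axioms s E \<sigma>]) measurable
    also have "\<dots> \<le> (\<integral>\<^sup>+x. indicator E x * ennreal (norm (x - z) + real CARD('d) * \<sigma>) \<partial>P)"
    proof (intro nn_integral_mono mult_left_mono)
      fix x
      have "(\<integral>\<^sup>+y. ennreal (norm (y + x - z)) * ennreal (gauss_density \<sigma> y) \<partial>lborel)
        \<le> (\<integral>\<^sup>+y. ennreal (norm (x - z)) * ennreal (gauss_density \<sigma> y) + ennreal (gauss_density \<sigma> y * norm y) \<partial>(lborel :: (real ^ 'd) measure))"
      proof (rule nn_integral_mono)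
        fix y
        have "norm (y + x - z) \<le> norm (x - z) + norm y" by norm
        then have "norm (y + x - z) * gauss_density \<sigma> y \<le> (norm (x - z) + norm y) * gauss_density \<sigma> y"
          by (intro mult_right_mono) auto
        then show "ennreal (norm (y + x - z)) * ennreal (gauss_density \<sigma> y)
          \<le> ennreal (norm (x - z)) * ennreal (gauss_density \<sigma> y) + ennreal (gauss_density \<sigma> y * norm y)"
          by (simp add: ennreal_mult[symmetric] ennreal_plus[symmetric] algebra_simps ennreal_leI del: ennreal_plus)
      qed
      also have "\<dots> = ennreal (norm (x - z)) + (\<integral>\<^sup>+y. ennreal (gauss_density \<sigma> y * norm y) \<partial>(lborel :: (real ^ 'd) measure))"
        using \<sigma> by (simp add: nn_integral_add nn_integral_cmult)
      also have "\<dots> \<le> ennreal (norm (x - z)) + ennreal (real CARD('d) * \<sigma>)"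
        by (intro add_left_mono nn_integral_gauss_density_norm_le \<sigma>)
      finally show "(\<integral>\<^sup>+y. ennreal (norm (y + x - z)) * ennreal (gauss_density \<sigma> y) \<partial>lborel)
        \<le> ennreal (norm (x - z) + real CARD('d) * \<sigma>)" using \<sigma> by simp
    qed simp
    finally show "(\<integral>\<^sup>+y. ennreal (norm (y - z)) * ennreal (smoothed_cell \<sigma> P E y) \<partial>lborel) \<le> \<dots>" .
  qed auto
  also have "ennreal (sqrt (measure P Q / real n)) * ennreal (sqrt 2 ^ CARD('d) * exp (r\<^sup>2 / 2) * (real CARD('d) * (sqrt 2 * \<sigma>)))
    = ennreal (sqrt 2 ^ CARD('d) * exp (r\<^sup>2 / 2) * (real CARD('d) * sqrt 2) * \<sigma> * sqrt (measure P Q / real n))"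
    using \<sigma> by (subst ennreal_mult[symmetric]) (auto simp: ac_simps)
  finally show ?thesis .
qed

section \<open>The main estimate\<close>

lemma nn_integral_weighted_sum_le:
  fixes f :: "'i \<Rightarrow> 'a \<Rightarrow> real"
  assumes "\<And>i. i \<in> I \<Longrightarrow> 0 \<le> a i" "\<And>i x. i \<in> I \<Longrightarrow> 0 \<le> f i x" "\<And>i. i \<in> I \<Longrightarrow> 0 \<le> b i"
    and [measurable]: "\<And>i. i \<in> I \<Longrightarrow> f i \<in> borel_measurable M"
    and le: "\<And>i. i \<in> I \<Longrightarrow> (\<integral>\<^sup>+x. ennreal (f i x) \<partial>M) \<le> ennreal (b i)"
  shows "(\<integral>\<^sup>+x. ennreal (\<Sum>i\<in>I. a i * f i x) \<partial>M) \<le> ennreal (\<Sum>i\<in>I. a i * b i)"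
proof -
  have "(\<integral>\<^sup>+x. ennreal (\<Sum>i\<in>I. a i * f i x) \<partial>M) = (\<integral>\<^sup>+x. (\<Sum>i\<in>I. ennreal (a i) * ennreal (f i x)) \<partial>M)"
    using assms(1,2) by (intro nn_integral_cong, subst sum_ennreal[symmetric]) (auto simp: ennreal_mult)
  also have "\<dots> = (\<Sum>i\<in>I. ennreal (a i) * (\<integral>\<^sup>+x. ennreal (f i x) \<partial>M))"
    by (subst nn_integral_sum) (auto simp: nn_integral_cmult)
  also have "\<dots> \<le> (\<Sum>i\<in>I. ennreal (a i) * ennreal (b i))"
    by (intro sum_mono mult_left_mono le) auto
  also have "\<dots> = ennreal (\<Sum>i\<in>I. a i * b i)"
    using assms(1,3) by (subst sum_ennreal[symmetric]) (auto simp: ennreal_mult)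
  finally show ?thesis .
qed

text \<open>Takes expectations in the deterministic bound, with cells of side 2^-m \<le> \<sigma>.
  The bounds \<open>cells\<close> and \<open>cells0\<close> hold for every finite set of cells, so
  apart from the final tail integral nothing depends on \<open>L\<close>, and \<open>L\<close> may
  later be chosen in terms of n.\<close>

lemma expected_smooth_W1_le:
  fixes P :: "(real ^ 'd) measure" and L n :: nat
  assumes P: "prob_space P" and s[measurable_cong]: "sets P = sets borel" and n: "0 < n"
    and \<sigma>: "0 < \<sigma>" and m: "1 / 2 ^ m \<le> \<sigma>" and L: "0 < L"
    and cells: "\<And>k G. finite G \<Longrightarrow> (\<Sum>z\<in>G. sqrt (measure P {x. grid k x = z})) \<le> C1 * a ^ k"
    and cells0: "\<And>G. finite G \<Longrightarrow> (\<Sum>z\<in>G. norm z * sqrt (measure P {x. grid 0 x = z})) \<le> C2"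
  shows "(\<integral>\<^sup>+\<omega>. ennreal (sqrt (real n)) * smooth_W1 \<sigma> (empirical_measure n \<omega>) P \<partial>PiM {..<n} (\<lambda>_. P))
    \<le> ennreal (C2 + (\<Sum>k\<in>{1..m}. 2 * real CARD('d) / 2 ^ k * (C1 * a ^ k + 1))
        + sqrt 2 ^ CARD('d) * exp ((real CARD('d))\<^sup>2 / 2) * (real CARD('d) * sqrt 2) * \<sigma> * (C1 * a ^ m))
      + ennreal (sqrt (real n)) * (2 * (\<integral>\<^sup>+x. indicator (- {x. \<forall>i. - real L \<le> x $ i \<and> x $ i < real L}) x
          * ennreal (norm x + real CARD('d) * \<sigma>) \<partial>P))"
proof -
  interpret P: prob_space P by (rule P)
  let ?M = "PiM {..<n} (\<lambda>_. P)"
  let ?d = "real CARD('d)"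
  let ?D = "sqrt 2 ^ CARD('d) * exp (?d\<^sup>2 / 2) * (?d * sqrt 2)"
  define B where "B = {x::real^'d. \<forall>i. - real L \<le> x $ i \<and> x $ i < real L}"
  have Bm[measurable]: "B \<in> sets borel"
    unfolding B_def by (rule borel_half_open_box)
  have sp: "space P = UNIV" using sets_eq_imp_space_eq[OF s] by simp
  \<comment> \<open>Everything outside the box is assigned to the origin, which makes the range of
    the quantiser finite; \<open>L\<close> is positive so that the origin lies in the box.\<close>
  define T where "T x = (if x \<in> B then x else 0)" for x
  define c where "c x = grid m (T x)" for x
  have cm[measurable]: "c \<in> borel_measurable borel" unfolding c_def T_def by measurable
  have "0 \<in> B" using L by (simp add: B_def)
  then have "range c \<subseteq> grid m ` B" by (auto simp: c_def T_def)
  then have fin: "finite (range c)" using finite_grid_box[of m L] by (auto simp: B_def intro: finite_subset)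
  have gridc: "grid m (c x) = c x" for x by (simp add: c_def grid_grid)
  define cell where "cell k z = {x::real^'d. grid k x = z}" for k z
  have cellm[measurable]: "cell k z \<in> sets borel" for k z
    unfolding cell_def by (rule borel_grid_cell)
  define D where "D k z = {x. grid k (c x) = z}" for k z
  have Dm[measurable]: "D k z \<in> sets borel" for k z
  proof -
    have "D k z = (\<lambda>x. grid k (c x)) -` {z} \<inter> space borel" by (auto simp: D_def)
    moreover have "(\<lambda>x. grid k (c x)) \<in> borel_measurable borel" by measurable
    ultimately show ?thesis using measurable_sets[of "\<lambda>x. grid k (c x)" borel borel "{z}"] by simp
  qed
  \<comment> \<open>Only the fibre over 0 can be larger than its dyadic cell, because it also
    absorbs the outside of the box; its root is bounded by 1. This is the \<open>+ 1\<close> at each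
    level k \<ge> 1, while at level 0 the weight \<open>norm z\<close> removes it.\<close>
  have Dle: "sqrt (measure P (D k z)) \<le> sqrt (measure P (cell k z)) + (if z = 0 then 1 else 0)" if "k \<le> m" for k z
  proof (cases "z = 0")
    case True
    have "sqrt (measure P (D k z)) \<le> 1" by simp
    then show ?thesis using True by (simp add: add_increasing)
  next
    case False
    then have "D k z \<subseteq> cell k z"
      using that by (auto simp: D_def cell_def c_def T_def grid_grid split: if_splits)
    then have "measure P (D k z) \<le> measure P (cell k z)" by (intro P.finite_measure_mono) auto
    then show ?thesis using False by simp
  qed
  define \<Delta> where "\<Delta> k \<omega> z = \<bar>measure (empirical_measure n \<omega>) (D k z) - measure P (D k z)\<bar>" for k \<omega> z
  have \<Delta>m[measurable]: "(\<lambda>\<omega>. \<Delta> k \<omega> z) \<in> borel_measurable ?M" for k z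
    unfolding \<Delta>_def using measurable_measure_empirical_measure[OF s n Dm[of k z]] by measurable
  have \<Delta>: "(\<integral>\<^sup>+\<omega>. ennreal (\<Delta> k \<omega> z) \<partial>?M) \<le> ennreal (sqrt (measure P (D k z) / real n))" for k z
    unfolding \<Delta>_def by (rule expected_cell_deviation_le[OF P s n Dm])
  define X where "X \<omega> = (\<Sum>z\<in>grid 0 ` range c. norm z * \<Delta> 0 \<omega> z)" for \<omega>
  define Y where "Y \<omega> = (\<Sum>k\<in>{1..m}. 2 * ?d / 2 ^ k * (\<Sum>z\<in>grid k ` range c. 1 * \<Delta> k \<omega> z))" for \<omega>
  define I where "I \<omega> z = (\<integral>\<^sup>+y. ennreal (norm (y - z) *
          \<bar>smoothed_cell \<sigma> (empirical_measure n \<omega>) (c -` {z}) y - smoothed_cell \<sigma> P (c -` {z}) y\<bar>) \<partial>lborel)" for \<omega> z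
  have \<Delta>0: "0 \<le> \<Delta> k \<omega> z" for k \<omega> z by (simp add: \<Delta>_def)
  have X0: "0 \<le> X \<omega>" and Y0: "0 \<le> Y \<omega>" for \<omega>
    unfolding X_def Y_def by (auto intro!: sum_nonneg mult_nonneg_nonneg divide_nonneg_nonneg \<Delta>0)
  have Xm[measurable]: "X \<in> borel_measurable ?M" and Ym[measurable]: "Y \<in> borel_measurable ?M"
    unfolding X_def Y_def by measurable
  have czm[measurable]: "c -` {z} \<in> sets borel" for z
    using measurable_sets[OF cm, of "{z}"] by simp
  have Im[measurable]: "(\<lambda>\<omega>. I \<omega> z) \<in> borel_measurable ?M" for z
    unfolding I_def
    by (rule measurable_smoothed_cell_empirical_measure[OF s czm measurable_smoothed_cell[OF P.finite_measure_axioms s czm]])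
  have EX: "(\<integral>\<^sup>+\<omega>. ennreal (X \<omega>) \<partial>?M) \<le> ennreal (\<Sum>z\<in>grid 0 ` range c. norm z * sqrt (measure P (D 0 z) / real n))"
    unfolding X_def using \<Delta>0 \<Delta> by (intro nn_integral_weighted_sum_le) auto
  have EY: "(\<integral>\<^sup>+\<omega>. ennreal (Y \<omega>) \<partial>?M) \<le> ennreal (\<Sum>k\<in>{1..m}. 2 * ?d / 2 ^ k * (\<Sum>z\<in>grid k ` range c. 1 * sqrt (measure P (D k z) / real n)))"
    unfolding Y_def
  proof (rule nn_integral_weighted_sum_le)
    show "(\<integral>\<^sup>+\<omega>. ennreal (\<Sum>z\<in>grid k ` range c. 1 * \<Delta> k \<omega> z) \<partial>?M)
      \<le> ennreal (\<Sum>z\<in>grid k ` range c. 1 * sqrt (measure P (D k z) / real n))" for k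
      using \<Delta>0 \<Delta> by (intro nn_integral_weighted_sum_le) auto
  qed (auto intro!: sum_nonneg \<Delta>0)
  define S where "S = C2 + (\<Sum>k\<in>{1..m}. 2 * ?d / 2 ^ k * (C1 * a ^ k + 1))"
  have sn: "0 < sqrt (real n)" using n by simp
  have EXY: "ennreal (sqrt (real n)) * (\<integral>\<^sup>+\<omega>. ennreal (X \<omega> + Y \<omega>) \<partial>?M) \<le> ennreal S"
  proof -
    define SX where "SX = (\<Sum>z\<in>grid 0 ` range c. norm z * sqrt (measure P (D 0 z)))"
    define SY where "SY = (\<Sum>k\<in>{1..m}. 2 * ?d / 2 ^ k * (\<Sum>z\<in>grid k ` range c. sqrt (measure P (D k z))))"
    have p: "0 \<le> SX" "0 \<le> SY"
      unfolding SX_def SY_def by (auto intro!: sum_nonneg mult_nonneg_nonneg divide_nonneg_nonneg)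
    have e1: "(\<Sum>z\<in>grid 0 ` range c. norm z * sqrt (measure P (D 0 z) / real n)) = SX / sqrt (real n)"
      by (simp add: SX_def real_sqrt_divide sum_divide_distrib)
    have e2: "(\<Sum>k\<in>{1..m}. 2 * ?d / 2 ^ k * (\<Sum>z\<in>grid k ` range c. 1 * sqrt (measure P (D k z) / real n))) = SY / sqrt (real n)"
      by (simp add: SY_def real_sqrt_divide sum_divide_distrib sum_distrib_left)
    have "(\<integral>\<^sup>+\<omega>. ennreal (X \<omega> + Y \<omega>) \<partial>?M) = (\<integral>\<^sup>+\<omega>. ennreal (X \<omega>) \<partial>?M) + (\<integral>\<^sup>+\<omega>. ennreal (Y \<omega>) \<partial>?M)"
      using X0 Y0 by (simp add: nn_integral_add)
    also have "\<dots> \<le> ennreal (SX / sqrt (real n)) + ennreal (SY / sqrt (real n))"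
      using EX EY unfolding e1 e2 by (rule add_mono)
    also have "\<dots> = ennreal ((SX + SY) / sqrt (real n))"
      using p by (subst ennreal_plus[symmetric]) (auto simp: add_divide_distrib)
    finally have "ennreal (sqrt (real n)) * (\<integral>\<^sup>+\<omega>. ennreal (X \<omega> + Y \<omega>) \<partial>?M)
      \<le> ennreal (sqrt (real n)) * ennreal ((SX + SY) / sqrt (real n))" by (rule mult_left_mono) simp
    also have "\<dots> = ennreal (SX + SY)"
      using sn p by (subst ennreal_mult[symmetric]) auto
    also have "\<dots> \<le> ennreal S"
    proof (intro ennreal_leI)
      have "SX \<le> (\<Sum>z\<in>grid 0 ` range c. norm z * sqrt (measure P (cell 0 z)))"
        unfolding SX_def
      proof (rule sum_mono)
        fix z :: "real ^ 'd"
        have "norm z * sqrt (measure P (D 0 z)) \<le> norm z * (sqrt (measure P (cell 0 z)) + (if z = 0 then 1 else 0))"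
          by (intro mult_left_mono Dle) auto
        then show "norm z * sqrt (measure P (D 0 z)) \<le> norm z * sqrt (measure P (cell 0 z))"
          by (auto split: if_splits)
      qed
      also have "\<dots> \<le> C2" unfolding cell_def using fin by (intro cells0) auto
      finally have "SX \<le> C2" .
      moreover have "SY \<le> (\<Sum>k\<in>{1..m}. 2 * ?d / 2 ^ k * (C1 * a ^ k + 1))"
        unfolding SY_def
      proof (intro sum_mono mult_left_mono)
        fix k assume k: "k \<in> {1..m}"
        have "(\<Sum>z\<in>grid k ` range c. sqrt (measure P (D k z)))
          \<le> (\<Sum>z\<in>grid k ` range c. sqrt (measure P (cell k z)) + (if z = 0 then 1 else 0))"
          using k by (intro sum_mono Dle) auto
        also have "\<dots> = (\<Sum>z\<in>grid k ` range c. sqrt (measure P (cell k z))) + (if 0 \<in> grid k ` range c then 1 else 0)"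
          using fin by (simp add: sum.distrib)
        also have "\<dots> \<le> C1 * a ^ k + 1"
          unfolding cell_def using fin by (intro add_mono cells) auto
        finally show "(\<Sum>z\<in>grid k ` range c. sqrt (measure P (D k z))) \<le> C1 * a ^ k + 1" .
      qed simp
      ultimately show "SX + SY \<le> S" by (simp add: S_def)
    qed
    finally show ?thesis .
  qed
  \<comment> \<open>The part of a fibre far from its anchor, nonempty at most for the anchor 0. It
    plays the role of \<open>E\<close> in the deviation bound, while the part inside the box lies
    within d \<sigma> of its corner.\<close>
  define R where "R z = (\<integral>\<^sup>+x. indicator (if z = 0 then - B else {}) x * ennreal (norm (x - z) + ?d * \<sigma>) \<partial>P)" for z :: "real ^ 'd"
  have EI: "(\<integral>\<^sup>+\<omega>. I \<omega> z \<partial>?M) \<le> ennreal (?D * \<sigma> * sqrt (measure P (cell m z) / real n)) + 2 * R z" for z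
  proof -
    have split: "c -` {z} = (cell m z \<inter> B) \<union> (if z = 0 then - B else {})"
      by (auto simp: c_def T_def cell_def split: if_splits)
    have Em: "(if z = 0 then - B else {}) \<in> sets borel" by auto
    have "(\<integral>\<^sup>+\<omega>. I \<omega> z \<partial>?M) \<le> ennreal (?D * \<sigma> * sqrt (measure P (cell m z \<inter> B) / real n)) + 2 * R z"
      unfolding I_def split R_def
    proof (rule expected_smoothed_cell_deviation_le[OF P s n \<sigma> _ Em])
      fix x assume "x \<in> cell m z \<inter> B"
      then have "norm (x - z) \<le> ?d / 2 ^ m" using norm_diff_grid_le[of x m] by (simp add: cell_def)
      also have "\<dots> \<le> ?d * \<sigma>" using mult_left_mono[OF m, of ?d] by simp
      finally show "norm (x - z) \<le> ?d * \<sigma>" .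
    qed auto
    also have "\<dots> \<le> ennreal (?D * \<sigma> * sqrt (measure P (cell m z) / real n)) + 2 * R z"
      using \<sigma> by (intro add_right_mono ennreal_leI mult_left_mono real_sqrt_le_mono divide_right_mono P.finite_measure_mono) auto
    finally show ?thesis .
  qed
  have EIsum: "ennreal (sqrt (real n)) * (\<Sum>z\<in>range c. \<integral>\<^sup>+\<omega>. I \<omega> z \<partial>?M)
    \<le> ennreal (?D * \<sigma> * (C1 * a ^ m)) + ennreal (sqrt (real n)) * (2 * R 0)"
  proof -
    have D0: "0 \<le> ?D * \<sigma>" using \<sigma> by simp
    have "(\<Sum>z\<in>range c. \<integral>\<^sup>+\<omega>. I \<omega> z \<partial>?M) \<le> (\<Sum>z\<in>range c. ennreal (?D * \<sigma> * sqrt (measure P (cell m z) / real n)) + 2 * R z)"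
      by (intro sum_mono EI)
    also have "\<dots> = (\<Sum>z\<in>range c. ennreal (?D * \<sigma> * sqrt (measure P (cell m z) / real n))) + (\<Sum>z\<in>range c. 2 * R z)"
      by (rule sum.distrib)
    also have "\<dots> \<le> ennreal ((?D * \<sigma> * (\<Sum>z\<in>range c. sqrt (measure P (cell m z)))) / sqrt (real n)) + 2 * R 0"
    proof (rule add_mono)
      show "(\<Sum>z\<in>range c. ennreal (?D * \<sigma> * sqrt (measure P (cell m z) / real n)))
        \<le> ennreal ((?D * \<sigma> * (\<Sum>z\<in>range c. sqrt (measure P (cell m z)))) / sqrt (real n))"
        using D0 by (subst sum_ennreal) (auto simp: real_sqrt_divide sum_divide_distrib sum_distrib_left)
      have "(\<Sum>z\<in>range c. 2 * R z) = (\<Sum>z\<in>range c. if z = 0 then 2 * R 0 else 0)"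
        by (intro sum.cong) (auto simp: R_def)
      also have "\<dots> \<le> 2 * R 0" using fin by simp
      finally show "(\<Sum>z\<in>range c. 2 * R z) \<le> 2 * R 0" .
    qed
    finally have "ennreal (sqrt (real n)) * (\<Sum>z\<in>range c. \<integral>\<^sup>+\<omega>. I \<omega> z \<partial>?M)
      \<le> ennreal (sqrt (real n)) * (ennreal ((?D * \<sigma> * (\<Sum>z\<in>range c. sqrt (measure P (cell m z)))) / sqrt (real n)) + 2 * R 0)"
      by (rule mult_left_mono) simp
    also have "\<dots> = ennreal (?D * \<sigma> * (\<Sum>z\<in>range c. sqrt (measure P (cell m z)))) + ennreal (sqrt (real n)) * (2 * R 0)"
    proof -
      have Z0: "0 \<le> ?D * \<sigma> * (\<Sum>z\<in>range c. sqrt (measure P (cell m z)))"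
        by (rule mult_nonneg_nonneg[OF D0 sum_nonneg]) simp
      show ?thesis
        unfolding distrib_left ennreal_mult[OF less_imp_le[OF sn] divide_nonneg_pos[OF Z0 sn], symmetric]
        using n by simp
    qed
    also have "\<dots> \<le> ennreal (?D * \<sigma> * (C1 * a ^ m)) + ennreal (sqrt (real n)) * (2 * R 0)"
      using cells[OF fin, of m] D0 by (intro add_right_mono ennreal_leI mult_left_mono) (auto simp: cell_def)
    finally show ?thesis .
  qed
  have "(\<integral>\<^sup>+\<omega>. ennreal (sqrt (real n)) * smooth_W1 \<sigma> (empirical_measure n \<omega>) P \<partial>?M)
    \<le> (\<integral>\<^sup>+\<omega>. ennreal (sqrt (real n)) * (ennreal (X \<omega> + Y \<omega>) + (\<Sum>z\<in>range c. I \<omega> z)) \<partial>?M)"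
  proof (intro nn_integral_mono mult_left_mono)
    fix \<omega>
    show "smooth_W1 \<sigma> (empirical_measure n \<omega>) P \<le> ennreal (X \<omega> + Y \<omega>) + (\<Sum>z\<in>range c. I \<omega> z)"
      using smooth_W1_le[OF prob_space_empirical_measure[OF n] sets_empirical_measure P s \<sigma> cm fin gridc, of \<omega>]
      by (simp add: X_def Y_def \<Delta>_def D_def I_def)
  qed simp
  also have "\<dots> = ennreal (sqrt (real n)) * (\<integral>\<^sup>+\<omega>. ennreal (X \<omega> + Y \<omega>) \<partial>?M)
      + ennreal (sqrt (real n)) * (\<Sum>z\<in>range c. \<integral>\<^sup>+\<omega>. I \<omega> z \<partial>?M)"
    by (simp add: nn_integral_cmult nn_integral_add nn_integral_sum distrib_left)
  also have "\<dots> \<le> ennreal S + (ennreal (?D * \<sigma> * (C1 * a ^ m)) + ennreal (sqrt (real n)) * (2 * R 0))"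
    by (rule add_mono[OF EXY EIsum])
  also have "\<dots> = ennreal (S + ?D * \<sigma> * (C1 * a ^ m)) + ennreal (sqrt (real n)) * (2 * R 0)"
  proof -
    have "0 \<le> C2" using cells0[of "{}"] by simp
    moreover have c: "0 \<le> C1 * a ^ k" for k using cells[of "{}" k] by simp
    ultimately have "0 \<le> S" unfolding S_def
      by (intro add_nonneg_nonneg sum_nonneg mult_nonneg_nonneg[OF _ add_nonneg_nonneg[OF c zero_le_one]]) auto
    then show ?thesis using c[of m] \<sigma> by (simp add: add.assoc)
  qed
  finally show ?thesis by (simp add: S_def R_def B_def)
qed

text \<open>On \<open>Q\<close> the squared weight w^2 is at most \<kappa>^2 times the density of
  the weighted measure; integrate and take roots. With w = 1 and with w the norm of a corner, one
  cell sum for the weighted measure controls both sums needed for \<open>P\<close>.\<close>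

lemma weighted_sqrt_measure_le:
  fixes P :: "(real ^ 'd) measure"
  assumes P: "finite_measure P" and s[measurable_cong]: "sets P = sets borel"
    and fin: "finite_measure (density P (\<lambda>x. ennreal ((1 + norm x)\<^sup>2)))"
    and Q[measurable]: "Q \<in> sets borel" and w: "0 \<le> w" "\<And>x. x \<in> Q \<Longrightarrow> w \<le> \<kappa> * (1 + norm x)" and \<kappa>: "0 \<le> \<kappa>"
  shows "w * sqrt (measure P Q) \<le> \<kappa> * sqrt (measure (density P (\<lambda>x. ennreal ((1 + norm x)\<^sup>2))) Q)"
proof -
  let ?\<rho> = "density P (\<lambda>x. ennreal ((1 + norm x)\<^sup>2))"
  interpret P: finite_measure P by (rule P)
  interpret R: finite_measure ?\<rho> by (rule fin)
  have "ennreal (w\<^sup>2) * emeasure P Q = (\<integral>\<^sup>+x. ennreal (w\<^sup>2) * indicator Q x \<partial>P)"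
    by (simp add: nn_integral_cmult_indicator s)
  also have "\<dots> \<le> (\<integral>\<^sup>+x. ennreal (\<kappa>\<^sup>2) * (ennreal ((1 + norm x)\<^sup>2) * indicator Q x) \<partial>P)"
  proof (rule nn_integral_mono)
    fix x
    show "ennreal (w\<^sup>2) * indicator Q x \<le> ennreal (\<kappa>\<^sup>2) * (ennreal ((1 + norm x)\<^sup>2) * indicator Q x)"
    proof (cases "x \<in> Q")
      case True
      have "w\<^sup>2 \<le> (\<kappa> * (1 + norm x))\<^sup>2" using w True by (intro power_mono) auto
      then show ?thesis using True by (simp add: ennreal_mult[symmetric] power_mult_distrib ennreal_leI)
    qed simp
  qed
  also have "\<dots> = ennreal (\<kappa>\<^sup>2) * emeasure ?\<rho> Q"
    by (simp add: nn_integral_cmult emeasure_density)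
  finally have "ennreal (w\<^sup>2 * measure P Q) \<le> ennreal (\<kappa>\<^sup>2 * measure ?\<rho> Q)"
    by (simp add: P.emeasure_eq_measure R.emeasure_eq_measure ennreal_mult)
  then have "w\<^sup>2 * measure P Q \<le> \<kappa>\<^sup>2 * measure ?\<rho> Q" by (simp add: ennreal_le_iff)
  then have "sqrt (w\<^sup>2 * measure P Q) \<le> sqrt (\<kappa>\<^sup>2 * measure ?\<rho> Q)" by (rule real_sqrt_le_mono)
  then show ?thesis using w \<kappa> by (simp add: real_sqrt_mult)
qed

lemma shifted_moment_finite:
  fixes P :: "(real ^ 'd) measure"
  assumes P: "finite_measure P" and s[measurable_cong]: "sets P = sets borel" and "0 < s"
    and fin: "(\<integral>\<^sup>+x. ennreal (norm x powr s) \<partial>P) < \<infinity>"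
  shows "\<exists>M\<ge>0. (\<integral>\<^sup>+x. ennreal ((1 + norm x) powr s) \<partial>P) \<le> ennreal M"
proof -
  interpret P: finite_measure P by (rule P)
  have pw: "(1 + r) powr s \<le> 2 powr s * (1 + r powr s)" if "0 \<le> r" for r :: real
  proof (cases "r \<le> 1")
    case True
    have "(1 + r) powr s \<le> 2 powr s" using True that assms by (intro powr_mono2) auto
    also have "\<dots> \<le> 2 powr s * (1 + r powr s)" by simp
    finally show ?thesis .
  next
    case False
    have "(1 + r) powr s \<le> (2 * r) powr s" using False assms by (intro powr_mono2) auto
    also have "\<dots> = 2 powr s * r powr s" using that by (simp add: powr_mult)
    also have "\<dots> \<le> 2 powr s * (1 + r powr s)" by simp
    finally show ?thesis .
  qed
  have "(\<integral>\<^sup>+x. ennreal ((1 + norm x) powr s) \<partial>P) \<le> (\<integral>\<^sup>+x. ennreal (2 powr s) * (1 + ennreal (norm x powr s)) \<partial>P)"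
  proof (rule nn_integral_mono)
    fix x :: "real ^ 'd"
    have "ennreal ((1 + norm x) powr s) \<le> ennreal (2 powr s * (1 + norm x powr s))"
      using pw[of "norm x"] by (intro ennreal_leI) simp
    also have "\<dots> = ennreal (2 powr s) * (1 + ennreal (norm x powr s))"
      by (simp add: ennreal_mult ennreal_plus[symmetric] del: ennreal_plus flip: ennreal_1)
    finally show "ennreal ((1 + norm x) powr s) \<le> ennreal (2 powr s) * (1 + ennreal (norm x powr s))" .
  qed
  also have "\<dots> = ennreal (2 powr s) * (emeasure P (space P) + (\<integral>\<^sup>+x. ennreal (norm x powr s) \<partial>P))"
    by (simp add: nn_integral_cmult nn_integral_add)
  also have "\<dots> < \<infinity>"
  proof -
    have "emeasure P (space P) < top" by (simp add: less_top[symmetric])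
    then show ?thesis using fin by (simp add: ennreal_mult_less_top)
  qed
  finally have "(\<integral>\<^sup>+x. ennreal ((1 + norm x) powr s) \<partial>P) < top" by simp
  then show ?thesis
    by (intro exI[of _ "enn2real (\<integral>\<^sup>+x. ennreal ((1 + norm x) powr s) \<partial>P)"]) simp
qed

text \<open>For the least admissible m > 0, the value m - 1 fails, so 2^(m - 1) < 1 / \<sigma>. If m
  = 0, the upper bound rests on \<sigma> \<le> \<kappa>.\<close>

lemma exists_dyadic_scale:
  fixes \<sigma> \<kappa> :: real
  assumes "0 < \<sigma>" "\<sigma> \<le> \<kappa>" "1 \<le> \<kappa>"
  shows "\<exists>m. 1 / 2 ^ m \<le> \<sigma> \<and> 2 ^ m \<le> 2 * \<kappa> / \<sigma>"
proof -
  have "\<exists>m. 1 / 2 ^ m \<le> \<sigma>"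
    using real_arch_pow_inv[of \<sigma> "1/2"] assms by (auto simp: power_one_over intro: less_imp_le)
  then obtain m where m: "1 / 2 ^ m \<le> \<sigma>" and least: "\<And>k. k < m \<Longrightarrow> \<not> 1 / 2 ^ k \<le> \<sigma>"
    using exists_least_iff[of "\<lambda>m. 1 / 2 ^ m \<le> \<sigma>"] by blast
  have "2 ^ m \<le> 2 * \<kappa> / \<sigma>"
  proof (cases m)
    case 0
    then show ?thesis using assms by (simp add: field_simps)
  next
    case (Suc k)
    then have "\<sigma> < 1 / 2 ^ k" using least[of k] by simp
    then have "\<sigma> * 2 ^ k < 1" by (simp add: field_simps)
    then have "2 ^ m * \<sigma> \<le> 2 * \<kappa>" using Suc assms by (simp add: mult.commute mult.left_commute)
    then show ?thesis using assms by (simp add: field_simps)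
  qed
  then show ?thesis using m by blast
qed

text \<open>Markov's inequality with one of the two factors 1 + |x|, which is at least
  \<open>L\<close> off \<open>B\<close>.\<close>

lemma tail_first_moment_le:
  fixes P :: "(real ^ 'd) measure"
  assumes s[measurable_cong]: "sets P = sets borel" and B: "\<And>x. x \<notin> B \<Longrightarrow> L \<le> norm x" and L: "0 < L"
    and Bm[measurable]: "B \<in> sets borel"
    and fin: "(\<integral>\<^sup>+x. ennreal ((1 + norm x)\<^sup>2) \<partial>P) \<le> ennreal R" and R: "0 \<le> R"
  shows "(\<integral>\<^sup>+x. indicator (- B) x * ennreal (1 + norm x) \<partial>P) \<le> ennreal (R / L)"
proof -
  have "(\<integral>\<^sup>+x. indicator (- B) x * ennreal (1 + norm x) \<partial>P) \<le> (\<integral>\<^sup>+x. ennreal (1 / L) * ennreal ((1 + norm x)\<^sup>2) \<partial>P)"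
  proof (rule nn_integral_mono)
    fix x
    show "indicator (- B) x * ennreal (1 + norm x) \<le> ennreal (1 / L) * ennreal ((1 + norm x)\<^sup>2)"
    proof (cases "x \<in> B")
      case False
      have "L * (1 + norm x) \<le> (1 + norm x) * (1 + norm x)"
        using B[OF False] by (intro mult_right_mono) auto
      then have "1 + norm x \<le> 1 / L * (1 + norm x)\<^sup>2"
        using L by (simp add: field_simps power2_eq_square)
      then show ?thesis using False L by (simp add: ennreal_mult[symmetric] ennreal_leI del: ennreal_plus)
    qed simp
  qed
  also have "\<dots> \<le> ennreal (1 / L) * ennreal R"
    by (subst nn_integral_cmult) (auto intro: mult_left_mono fin)
  also have "\<dots> = ennreal (R / L)" using R L by (simp add: ennreal_mult[symmetric])
  finally show ?thesis .
qed

text \<open>The terms are dominated by \<beta>^k with \<beta> > 1, so the sum is comparable to its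
  last term: the coarsest scales cost no more than the finest one.\<close>

lemma sum_dyadic_growth_le:
  fixes a \<beta> :: real
  assumes "0 \<le> a" "a \<le> 2 * \<beta>" "1 < \<beta>" "0 \<le> C"
  shows "(\<Sum>k\<in>{1..m}. 1 / 2 ^ k * (C * a ^ k + 1)) \<le> (C * \<beta> / (\<beta> - 1) + 1) * \<beta> ^ m"
proof -
  have "(\<Sum>k\<in>{1..m}. 1 / 2 ^ k * (C * a ^ k + 1)) = C * (\<Sum>k\<in>{1..m}. (a / 2) ^ k) + (\<Sum>k\<in>{1..m}. (1 / 2) ^ k)"
    by (simp add: sum.distrib sum_distrib_left power_divide distrib_left mult.commute add_divide_distrib)
  also have "\<dots> \<le> C * (\<beta> / (\<beta> - 1) * \<beta> ^ m) + 1 * \<beta> ^ m"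
  proof (intro add_mono mult_left_mono)
    have "(\<Sum>k\<in>{1..m}. (a / 2) ^ k) \<le> (\<Sum>k\<in>{1..m}. \<beta> ^ k)"
      using assms by (intro sum_mono power_mono) auto
    also have "\<dots> \<le> (\<Sum>k<Suc m. \<beta> ^ k)"
      using assms by (intro sum_mono2) auto
    also have "\<dots> = (\<beta> ^ Suc m - 1) / (\<beta> - 1)" using assms by (subst geometric_sum) auto
    also have "\<dots> \<le> \<beta> / (\<beta> - 1) * \<beta> ^ m" using assms by (simp add: divide_right_mono)
    finally show "(\<Sum>k\<in>{1..m}. (a / 2) ^ k) \<le> \<beta> / (\<beta> - 1) * \<beta> ^ m" .
    have "(\<Sum>k\<in>{1..m}. (1 / 2) ^ k) = 1 - (1 / 2 :: real) ^ m"
      by (induction m) (auto simp: field_simps)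
    also have "\<dots> \<le> 1" by simp
    also have "\<dots> \<le> 1 * \<beta> ^ m" using assms by simp
    finally show "(\<Sum>k\<in>{1..m}. (1 / 2 :: real) ^ k) \<le> 1 * \<beta> ^ m" .
  qed (use assms in auto)
  finally show ?thesis by (simp add: algebra_simps)
qed

text \<open>The range of \<open>\<sigma>\<close> is bounded for a reason: smoothing preserves means
  and W1 dominates the distance of means, so for \<open>P\<close> other than a point mass and fixed
  n the left side stays bounded away from 0 as \<open>\<sigma>\<close> grows, whereas the power of
  \<open>\<sigma>\<close> tends to 0. The constant depends on \<open>\<sigma>\<^sub>0\<close>
  through \<open>\<kappa>\<close>.\<close>

theorem theorem4:
  fixes P :: "(real ^ 'd) measure" and s \<sigma>\<^sub>0 :: real
  assumes "prob_space P" and "sets P = sets borel"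
    and "(\<integral>\<^sup>+ x. ennreal (norm x powr s) \<partial>P) < \<infinity>"
    and "upper_SW1_dim P < ereal s"
    and "\<sigma>\<^sub>0 > 0"
  shows "\<exists>C::real. \<forall>\<sigma>::real. \<forall>n::nat. 0 < \<sigma> \<longrightarrow> \<sigma> \<le> \<sigma>\<^sub>0 \<longrightarrow> n > 1 \<longrightarrow>
    (\<integral>\<^sup>+ x. ennreal (sqrt (real n)) * smooth_W1 \<sigma> (empirical_measure n x) P \<partial>(PiM {..<n} (\<lambda>_. P)))
      \<le> ennreal (C * \<sigma> powr (- s / 2 + 1) * (ln (real n)) powr (3 / 2))"
proof -
  note P = assms(1) and sb[measurable_cong] = assms(2)
  interpret P: prob_space P by (rule P)
  obtain t \<alpha> m0 where t: "0 < t" "t < s" and s2: "2 < s" and t\<alpha>: "t < \<alpha> * (1 - 2 / s)"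
    and covers: "\<And>m. m0 \<le> m \<Longrightarrow> \<exists>S F. S \<in> sets borel \<and> measure P S \<ge> 1 - (2 powr (- \<alpha>)) ^ m \<and> finite F \<and>
      S \<subseteq> (\<Union>c\<in>F. cball c (1 / 2 ^ m)) \<and> real (card F) \<le> (2 powr t) ^ m"
    using upper_SW1_dim_less_imp_covers[OF assms(4)] by blast
  obtain M where M: "0 \<le> M" "(\<integral>\<^sup>+x. ennreal ((1 + norm x) powr s) \<partial>P) \<le> ennreal M"
    using shifted_moment_finite[OF P.finite_measure_axioms sb _ assms(3)] s2 by auto
  have sp: "space P = UNIV" using sets_eq_imp_space_eq[OF sb] by simp
  \<comment> \<open>The weight is squared because it is used under a square root; the measure is
    finite because s > 2, by the concentration bound with \<open>E\<close> the whole space and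
    \<tau> = 1.\<close>
  define \<rho> where "\<rho> = density P (\<lambda>x. ennreal ((1 + norm x)\<^sup>2))"
  have conc: "emeasure \<rho> E \<le> ennreal ((1 + M) * \<tau> powr (1 - 2 / s))"
    if "E \<in> sets borel" "0 < \<tau>" "emeasure P E \<le> ennreal \<tau>" for E \<tau>
    unfolding \<rho>_def using moment_concentration[of "\<lambda>x. 1 + norm x" P s M E \<tau>] s2 M that by (simp add: sb)
  have \<rho>U: "emeasure \<rho> UNIV \<le> ennreal (1 + M)"
    using conc[of UNIV 1] P.emeasure_space_1 by (simp add: sp)
  have s\<rho>: "sets \<rho> = sets borel" by (simp add: \<rho>_def sb)
  have fin\<rho>: "finite_measure \<rho>"
    using \<rho>U by (intro finite_measureI) (auto simp: \<rho>_def sp top_unique)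
  interpret R: finite_measure \<rho> by (rule fin\<rho>)
  \<comment> \<open>The decay rate of the complements after reweighting: the P-mass 2^(-\<alpha> m)
    raised to the power 1 - 2/s. The condition 2^t b < 1 is the inequality t < \<alpha> (1 -
    2/s).\<close>
  define b where "b = 2 powr (- (\<alpha> * (1 - 2 / s)))"
  have "\<exists>C\<ge>0. \<forall>k G. finite G \<longrightarrow> (\<Sum>z\<in>G. sqrt (measure \<rho> {x. grid k x = z})) \<le> C * sqrt (2 powr t) ^ k"
  proof (rule sum_sqrt_cells_le[OF fin\<rho> s\<rho>, where b = b and A = "1 + M" and ?m0.0 = m0])
    show "1 \<le> 2 powr t" using t by (simp add: ge_one_powr_ge_zero)
    show "0 < b" by (simp add: b_def)
    have "2 powr t * b = 2 powr (t - \<alpha> * (1 - 2 / s))" by (simp add: b_def powr_add[symmetric])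
    also have "\<dots> < 2 powr 0" using t\<alpha> by (intro powr_less_mono) auto
    finally show "2 powr t * b < 1" by simp
    fix m assume "m0 \<le> m"
    then obtain S F where SF: "S \<in> sets borel" "measure P S \<ge> 1 - (2 powr (- \<alpha>)) ^ m" "finite F"
      "S \<subseteq> (\<Union>c\<in>F. cball c (1 / 2 ^ m))" "real (card F) \<le> (2 powr t) ^ m" using covers by blast
    have "measure P (- S) = 1 - measure P S"
      using P.prob_compl[of S] SF(1) by (simp add: sp sb Compl_eq_Diff_UNIV)
    then have "emeasure P (- S) \<le> ennreal ((2 powr (- \<alpha>)) ^ m)"
      using SF(2) by (simp add: P.emeasure_eq_measure ennreal_leI)
    then have "emeasure \<rho> (- S) \<le> ennreal ((1 + M) * ((2 powr (- \<alpha>)) ^ m) powr (1 - 2 / s))"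
      using SF(1) by (intro conc) auto
    also have "((2 powr (- \<alpha>)) ^ m) powr (1 - 2 / s) = b ^ m"
      by (simp add: b_def powr_realpow[symmetric] powr_powr mult_ac)
    finally have "measure \<rho> (- S) \<le> (1 + M) * b ^ m"
      using M by (simp add: R.emeasure_eq_measure b_def)
    then show "\<exists>S F. S \<in> sets borel \<and> finite F \<and> S \<subseteq> (\<Union>c\<in>F. cball c (1 / 2 ^ m)) \<and>
      real (card F) \<le> (2 powr t) ^ m \<and> measure \<rho> (- S) \<le> (1 + M) * b ^ m"
      using SF by blast
  qed
  then obtain C1 where C1: "0 \<le> C1" and
    cells\<rho>: "\<And>k G. finite G \<Longrightarrow> (\<Sum>z\<in>G. sqrt (measure \<rho> {x. grid k x = z})) \<le> C1 * sqrt (2 powr t) ^ k"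
    by blast
  let ?d = "real CARD('d)"
  define a where "a = sqrt (2 powr t)"
  note weighted = weighted_sqrt_measure_le[OF P.finite_measure_axioms sb fin\<rho>[unfolded \<rho>_def] borel_grid_cell, folded \<rho>_def]
  have cells: "(\<Sum>z\<in>G. sqrt (measure P {x. grid k x = z})) \<le> C1 * a ^ k" if "finite G" for k and G :: "(real ^ 'd) set"
  proof -
    have "(\<Sum>z\<in>G. sqrt (measure P {x. grid k x = z})) \<le> (\<Sum>z\<in>G. sqrt (measure \<rho> {x. grid k x = z}))"
      using weighted[of 1 _ _ 1] by (intro sum_mono) simp
    then show ?thesis using cells\<rho>[OF that, of k] by (simp add: a_def)
  qed
  \<comment> \<open>The corner of a unit cell is within d of each of its points, hence the factor 1
    + d.\<close>
  have cells0: "(\<Sum>z\<in>G. norm z * sqrt (measure P {x. grid 0 x = z})) \<le> (1 + ?d) * C1" if "finite G" for G :: "(real ^ 'd) set"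
  proof -
    have "(\<Sum>z\<in>G. norm z * sqrt (measure P {x. grid 0 x = z})) \<le> (\<Sum>z\<in>G. (1 + ?d) * sqrt (measure \<rho> {x. grid 0 x = z}))"
    proof (intro sum_mono weighted)
      fix z x :: "real ^ 'd" assume "x \<in> {x. grid 0 x = z}"
      then have "norm z \<le> norm x + norm (x - grid 0 x)" using norm_triangle_ineq4[of x "x - grid 0 x"] by simp
      also have "\<dots> \<le> norm x + ?d" using norm_diff_grid_le[of x 0] by simp
      also have "\<dots> \<le> (1 + ?d) * (1 + norm x)" by (simp add: algebra_simps)
      finally show "norm z \<le> (1 + ?d) * (1 + norm x)" .
    qed auto
    also have "\<dots> \<le> (1 + ?d) * C1"
      using cells\<rho>[OF that, of 0] by (simp add: sum_distrib_left[symmetric] mult_left_mono)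
    finally show ?thesis .
  qed
  define \<kappa> where "\<kappa> = max 1 \<sigma>\<^sub>0"
  \<comment> \<open>Half of 2^(s/2), which dominates a = 2^(t/2). Its m-th power becomes \<sigma>^(1
    - s/2) when 2^m is of order 1 / \<sigma>.\<close>
  define \<beta> :: real where "\<beta> = 2 powr (s / 2 - 1)"
  have \<beta>: "1 < \<beta>" using s2 by (simp add: \<beta>_def)
  have a: "0 \<le> a" "a \<le> 2 * \<beta>"
  proof -
    have "a = 2 powr (t / 2)" by (simp add: a_def powr_half_sqrt[symmetric] powr_powr)
    also have "\<dots> \<le> 2 powr (1 + (s / 2 - 1))" using t by (intro powr_mono) auto
    also have "\<dots> = 2 * \<beta>" unfolding powr_add \<beta>_def by simp
    finally show "a \<le> 2 * \<beta>" .
  qed (simp add: a_def)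
  define D where "D = sqrt 2 ^ CARD('d) * exp (?d\<^sup>2 / 2) * (?d * sqrt 2)"
  have D0: "0 \<le> D" by (simp add: D_def)
  \<comment> \<open>In order: transport between unit cells, transport between the finer levels,
    smoothing inside cells of side at most \<sigma>, and the mass outside the box.\<close>
  define K where "K = (1 + ?d) * C1 + 2 * ?d * (C1 * \<beta> / (\<beta> - 1) + 1) + D * (2 * \<kappa>) * C1 + 2 * (1 + ?d * \<kappa>)"
  have \<kappa>: "1 \<le> \<kappa>" by (simp add: \<kappa>_def)
  have K0: "0 \<le> K" unfolding K_def using C1 D0 \<beta> \<kappa> by (intro add_nonneg_nonneg mult_nonneg_nonneg divide_nonneg_nonneg) auto
  \<comment> \<open>The division by a power of ln 2 turns ln n \<ge> ln 2 into a logarithmic factor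
    that is at least 1 after scaling.\<close>
  define C where "C = K * (2 * \<kappa>) powr (s / 2 - 1) / ln 2 powr (3 / 2)"
  show ?thesis
  proof (intro exI[of _ C] allI impI)
    fix \<sigma> :: real and n :: nat
    assume \<sigma>: "0 < \<sigma>" "\<sigma> \<le> \<sigma>\<^sub>0" and n: "1 < n"
    have \<sigma>\<kappa>: "\<sigma> \<le> \<kappa>" using \<sigma> by (simp add: \<kappa>_def)
    obtain m where m: "1 / 2 ^ m \<le> \<sigma>" "2 ^ m \<le> 2 * \<kappa> / \<sigma>"
      using exists_dyadic_scale[OF \<sigma>(1) \<sigma>\<kappa> \<kappa>] by blast
    \<comment> \<open>Large enough that the tail, of order (1 + M) / L, stays bounded after
      multiplication by sqrt n; the added 1 keeps \<open>L\<close> positive.\<close>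
    define L where "L = nat \<lceil>sqrt (real n) * (1 + M)\<rceil> + 1"
    have L: "0 < L" "sqrt (real n) * (1 + M) \<le> real L" unfolding L_def by (simp, linarith)
    define B where "B = {x::real^'d. \<forall>i. - real L \<le> x $ i \<and> x $ i < real L}"
    have Bm[measurable]: "B \<in> sets borel"
      unfolding B_def by (rule borel_half_open_box)
    have out: "real L \<le> norm x" if xB: "x \<notin> B" for x
    proof -
      obtain i where "\<not> (- real L \<le> x $ i \<and> x $ i < real L)" using xB unfolding B_def by blast
      then have "real L \<le> \<bar>x $ i\<bar>" by linarith
      then show ?thesis using component_le_norm_cart[of x i] by linarith
    qed
    have int2: "(\<integral>\<^sup>+x. ennreal ((1 + norm x)\<^sup>2) \<partial>P) \<le> ennreal (1 + M)"
      using \<rho>U by (simp add: \<rho>_def emeasure_density sb)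
    have tail: "ennreal (sqrt (real n)) * (2 * (\<integral>\<^sup>+x. indicator (- B) x * ennreal (norm x + ?d * \<sigma>) \<partial>P))
      \<le> ennreal (2 * (1 + ?d * \<kappa>))"
    proof -
      have "(\<integral>\<^sup>+x. indicator (- B) x * ennreal (norm x + ?d * \<sigma>) \<partial>P)
        \<le> (\<integral>\<^sup>+x. ennreal (1 + ?d * \<kappa>) * (indicator (- B) x * ennreal (1 + norm x)) \<partial>P)"
      proof (rule nn_integral_mono)
        fix x :: "real ^ 'd"
        have "?d * \<sigma> \<le> ?d * \<kappa>" using \<sigma>\<kappa> by (intro mult_left_mono) auto
        moreover have "0 \<le> ?d * \<kappa> * norm x" using \<kappa> by simp
        moreover have "(1 + ?d * \<kappa>) * (1 + norm x) = 1 + norm x + ?d * \<kappa> + ?d * \<kappa> * norm x"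
          by (simp add: algebra_simps)
        ultimately have "norm x + ?d * \<sigma> \<le> (1 + ?d * \<kappa>) * (1 + norm x)" by linarith
        then have "ennreal (norm x + ?d * \<sigma>) \<le> ennreal (1 + ?d * \<kappa>) * ennreal (1 + norm x)"
          using \<kappa> by (subst ennreal_mult[symmetric]) (auto intro: ennreal_leI)
        then show "indicator (- B) x * ennreal (norm x + ?d * \<sigma>) \<le> ennreal (1 + ?d * \<kappa>) * (indicator (- B) x * ennreal (1 + norm x))"
          by (auto split: split_indicator)
      qed
      also have "\<dots> = ennreal (1 + ?d * \<kappa>) * (\<integral>\<^sup>+x. indicator (- B) x * ennreal (1 + norm x) \<partial>P)"
        by (rule nn_integral_cmult) measurable
      also have "\<dots> \<le> ennreal (1 + ?d * \<kappa>) * ennreal ((1 + M) / real L)"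
        using L M by (intro mult_left_mono tail_first_moment_le[OF sb out _ Bm int2]) auto
      finally have "ennreal (sqrt (real n)) * (2 * (\<integral>\<^sup>+x. indicator (- B) x * ennreal (norm x + ?d * \<sigma>) \<partial>P))
        \<le> ennreal (sqrt (real n)) * (2 * (ennreal (1 + ?d * \<kappa>) * ennreal ((1 + M) / real L)))"
        by (intro mult_left_mono) auto
      also have "\<dots> = ennreal (2 * (1 + ?d * \<kappa>) * (sqrt (real n) * (1 + M) / real L))"
        using M \<kappa> by (simp add: ennreal_mult[symmetric] mult_ac flip: ennreal_numeral del: ennreal_plus)
      also have "\<dots> \<le> ennreal (2 * (1 + ?d * \<kappa>) * 1)"
        using L M \<kappa> by (intro ennreal_leI mult_left_mono) auto
      finally show ?thesis by simp
    qed
    have \<beta>m: "1 \<le> \<beta> ^ m" using \<beta> by simp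
    have growth: "2 * ?d * (\<Sum>k\<in>{1..m}. 1 / 2 ^ k * (C1 * a ^ k + 1)) \<le> 2 * ?d * ((C1 * \<beta> / (\<beta> - 1) + 1) * \<beta> ^ m)"
      by (intro mult_left_mono sum_dyadic_growth_le a \<beta> C1) auto
    \<comment> \<open>Here a^m \<le> 2^m \<beta>^m, and the prefactor \<sigma> cancels 2^m up to 2
      \<kappa>; the finest scale thus costs no more than the tree above it.\<close>
    have fine: "D * \<sigma> * (C1 * a ^ m) \<le> D * (2 * \<kappa>) * C1 * \<beta> ^ m"
    proof -
      have "a ^ m \<le> 2 ^ m * \<beta> ^ m" unfolding power_mult_distrib[symmetric] using a by (intro power_mono) auto
      then have "\<sigma> * a ^ m \<le> \<sigma> * (2 ^ m * \<beta> ^ m)" using \<sigma> by (intro mult_left_mono) auto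
      also have "\<dots> = (\<sigma> * 2 ^ m) * \<beta> ^ m" by simp
      also have "\<dots> \<le> 2 * \<kappa> * \<beta> ^ m"
        using m(2) \<sigma> \<beta> by (intro mult_right_mono) (auto simp: field_simps)
      finally have "D * C1 * (\<sigma> * a ^ m) \<le> D * C1 * (2 * \<kappa> * \<beta> ^ m)"
        using D0 C1 by (intro mult_left_mono) auto
      then show ?thesis by (simp add: mult_ac)
    qed
    have "(\<integral>\<^sup>+ x. ennreal (sqrt (real n)) * smooth_W1 \<sigma> (empirical_measure n x) P \<partial>(PiM {..<n} (\<lambda>_. P)))
      \<le> ennreal ((1 + ?d) * C1 + (\<Sum>k\<in>{1..m}. 2 * ?d / 2 ^ k * (C1 * a ^ k + 1)) + D * \<sigma> * (C1 * a ^ m))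
        + ennreal (sqrt (real n)) * (2 * (\<integral>\<^sup>+x. indicator (- B) x * ennreal (norm x + ?d * \<sigma>) \<partial>P))"
      unfolding D_def B_def using n
      by (intro expected_smooth_W1_le[OF P sb _ \<sigma>(1) m(1) L(1) cells cells0]) auto
    also have "\<dots> \<le> ennreal ((1 + ?d) * C1 + (\<Sum>k\<in>{1..m}. 2 * ?d / 2 ^ k * (C1 * a ^ k + 1)) + D * \<sigma> * (C1 * a ^ m))
        + ennreal (2 * (1 + ?d * \<kappa>))"
      by (intro add_left_mono tail)
    also have "\<dots> = ennreal ((1 + ?d) * C1 + 2 * ?d * (\<Sum>k\<in>{1..m}. 1 / 2 ^ k * (C1 * a ^ k + 1)) + D * \<sigma> * (C1 * a ^ m)
        + 2 * (1 + ?d * \<kappa>))"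
    proof -
      have "(\<Sum>k\<in>{1..m}. 2 * ?d / 2 ^ k * (C1 * a ^ k + 1)) = 2 * ?d * (\<Sum>k\<in>{1..m}. 1 / 2 ^ k * (C1 * a ^ k + 1))"
        by (simp add: sum_distrib_left)
      moreover have "0 \<le> (1 + ?d) * C1 + 2 * ?d * (\<Sum>k\<in>{1..m}. 1 / 2 ^ k * (C1 * a ^ k + 1)) + D * \<sigma> * (C1 * a ^ m)"
        using C1 D0 \<sigma> a by (intro add_nonneg_nonneg mult_nonneg_nonneg sum_nonneg) auto
      ultimately show ?thesis using \<kappa> by (simp only: ennreal_plus[symmetric]) (subst ennreal_plus, auto)
    qed
    also have "\<dots> \<le> ennreal (K * \<beta> ^ m)"
    proof (rule ennreal_leI)
      have 1: "(1 + ?d) * C1 \<le> (1 + ?d) * C1 * \<beta> ^ m"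
        using \<beta>m C1 mult_left_mono[OF \<beta>m, of "(1 + ?d) * C1"] by simp
      have 2: "2 * (1 + ?d * \<kappa>) \<le> 2 * (1 + ?d * \<kappa>) * \<beta> ^ m"
        using \<beta>m \<kappa> mult_left_mono[OF \<beta>m, of "2 * (1 + ?d * \<kappa>)"] by simp
      have "K * \<beta> ^ m = (1 + ?d) * C1 * \<beta> ^ m + 2 * ?d * ((C1 * \<beta> / (\<beta> - 1) + 1) * \<beta> ^ m)
        + D * (2 * \<kappa>) * C1 * \<beta> ^ m + 2 * (1 + ?d * \<kappa>) * \<beta> ^ m"
        unfolding K_def by (simp only: distrib_right mult.assoc)
      then show "(1 + ?d) * C1 + 2 * ?d * (\<Sum>k\<in>{1..m}. 1 / 2 ^ k * (C1 * a ^ k + 1)) + D * \<sigma> * (C1 * a ^ m)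
        + 2 * (1 + ?d * \<kappa>) \<le> K * \<beta> ^ m"
        using 1 2 growth fine by linarith
    qed
    also have "\<dots> \<le> ennreal (C * \<sigma> powr (- s / 2 + 1) * (ln (real n)) powr (3 / 2))"
    proof (rule ennreal_leI)
      have "\<beta> ^ m = (2 ^ m) powr (s / 2 - 1)"
        by (simp add: \<beta>_def powr_realpow[symmetric] powr_powr mult.commute)
      also have "\<dots> \<le> (2 * \<kappa> / \<sigma>) powr (s / 2 - 1)" using m(2) s2 by (intro powr_mono2) auto
      also have "\<dots> = (2 * \<kappa>) powr (s / 2 - 1) * \<sigma> powr (- s / 2 + 1)"
      proof -
        have "- s / 2 + 1 = - (s / 2 - 1)" by simp
        then have "\<sigma> powr (- s / 2 + 1) = inverse (\<sigma> powr (s / 2 - 1))" by (simp only: powr_minus)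
        moreover have "(2 * \<kappa> / \<sigma>) powr (s / 2 - 1) = (2 * \<kappa>) powr (s / 2 - 1) / \<sigma> powr (s / 2 - 1)"
          by (rule powr_divide)
        ultimately show ?thesis by (simp only: divide_inverse)
      qed
      finally have 1: "\<beta> ^ m \<le> (2 * \<kappa>) powr (s / 2 - 1) * \<sigma> powr (- s / 2 + 1)" .
      have "ln 2 powr (3 / 2) \<le> ln (real n) powr (3 / 2)" using n by (intro powr_mono2) auto
      then have 2: "1 \<le> ln (real n) powr (3 / 2) / ln 2 powr (3 / 2)" by simp
      have "K * \<beta> ^ m \<le> K * ((2 * \<kappa>) powr (s / 2 - 1) * \<sigma> powr (- s / 2 + 1)) * 1"
        using 1 K0 by (simp add: mult_left_mono)
      also have "\<dots> \<le> K * ((2 * \<kappa>) powr (s / 2 - 1) * \<sigma> powr (- s / 2 + 1)) * (ln (real n) powr (3 / 2) / ln 2 powr (3 / 2))"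
        using 2 K0 by (intro mult_left_mono) auto
      also have "\<dots> = C * \<sigma> powr (- s / 2 + 1) * (ln (real n)) powr (3 / 2)" by (simp add: C_def)
      finally show "K * \<beta> ^ m \<le> C * \<sigma> powr (- s / 2 + 1) * (ln (real n)) powr (3 / 2)" .
    qed
    finally show "(\<integral>\<^sup>+ x. ennreal (sqrt (real n)) * smooth_W1 \<sigma> (empirical_measure n x) P \<partial>(PiM {..<n} (\<lambda>_. P)))
      \<le> ennreal (C * \<sigma> powr (- s / 2 + 1) * (ln (real n)) powr (3 / 2))" .
  qed
qed

end
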